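(* Let $a$ and $b$ be distinct positive integers, let $(s_k)_{k\ge1}$ be a sequence of positive integers, and let $\xi_\varphi$ and $\sigma$ be as in the context. Then $$\lambda_2(\xi_\varphi)=1,\qquad w_2(\xi_\varphi)=w_2^*(\xi_\varphi)=1+\frac{2}{\sigma},$$ $$\hat{\lambda}_2(\xi_\varphi)=\frac{1+\sigma}{2+\sigma},\qquad \hat{w}_2(\xi_\varphi)=\hat{w}_2^*(\xi_\varphi)=2+\sigma.$$
   Context: Sturmian words: define words on the alphabet $\{a,b\}$ by $m_0=b$, $m_1=b^{s_1-1}a$, and $m_{k+1}=m_k^{s_{k+1}}m_{k-1}$ for $k\ge1$. The words $m_k$ are prefixes of one another and converge to an infinite word $m_\varphi$ (the Sturmian characteristic word of slope $\varphi=[0;s_1,s_2,\dots]$). Interpreting the letters $a,b$ as the positive integers $a,b$, let $\xi_\varphi=[0;m_\varphi]$ be the real number whose continued fraction has partial quotients $0$ followed by the successive letters of $m_\varphi$. Set $\sigma=\liminf_{k\to\infty}[0;s_k,s_{k-1},\dots,s_1]$ (so $0\le\sigma<1$; when $\sigma=0$, $1+2/\sigma$ is read as $+\infty$). Exponents, for real $\xi$ and $n\ge1$ (here $n=2$): $H(P)$ is the maximum absolute value of the coefficients of an integer polynomial $P$, and $H(\alpha)$ the height of the minimal polynomial over $\mathbb{Z}$ of an algebraic $\alpha$. $w_n(\xi)$: supremum of real $w$ such that $0<|P(\xi)|\le H(P)^{-w}$ for infinitely many integer polynomials $P$ of degree $\le n$. $w_n^*(\xi)$: supremum of real $w^*$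 such that $0<|\xi-\alpha|\le H(\alpha)^{-w^*-1}$ for infinitely many real algebraic $\alpha$ of degree $\le n$. $\lambda_n(\xi)$: supremum of real $\lambda$ such that $\max_{1\le m\le n}|x_0\xi^m-x_m|\le|x_0|^{-\lambda}$ for infinitely many integer tuples with $x_0\ne0$. $\hat{w}_n(\xi)$: supremum of real $w$ such that for every sufficiently large $X$ there are integers $x_0,\dots,x_n$ with $0<|x_n\xi^n+\dots+x_0|\le X^{-w}$ and $\max|x_m|\le X$. $\hat{w}_n^*(\xi)$: supremum of real $w$ such that for every sufficiently large $X$ there is a real algebraic $\alpha$ of degree $\le n$ with $0<|\xi-\alpha|\le H(\alpha)^{-1}X^{-w}$ and $H(\alpha)\le X$. $\hat{\lambda}_n(\xi)$: supremum of real $\lambda$ such that for every sufficiently large $X$ there are integers $x_0,\dots,x_n$ with $0<|x_0|\le X$ and $\max_{1\le m\le n}|x_0\xi^m-x_m|\le X^{-\lambda}$. *)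

theory Defs
  imports "HOL-Analysis.Analysis" "HOL-Computational_Algebra.Polynomial"
begin

section \<open>Continued fractions and Sturmian words\<close>

text \<open>\<open>cfrac0 [x\<^sub>1, \<dots>, x\<^sub>n]\<close> is the finite continued fraction \<open>[0; x\<^sub>1, \<dots>, x\<^sub>n]\<close>.\<close>

fun cfrac0 :: "nat list \<Rightarrow> real" where
  "cfrac0 [] = 0"
| "cfrac0 (x # xs) = 1 / (real x + cfrac0 xs)"

definition cfrac0_inf :: "(nat \<Rightarrow> nat) \<Rightarrow> real" where
  "cfrac0_inf u = lim (\<lambda>n. cfrac0 (map u [0..<n]))"

text \<open>The slope sequence \<open>s\<close> is indexed from 1; the value \<open>s 0\<close> is never used.\<close>

fun sturm_m :: "nat \<Rightarrow> nat \<Rightarrow> (nat \<Rightarrow> nat) \<Rightarrow> nat \<Rightarrow> nat list" where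
  "sturm_m a b s 0 = [b]"
| "sturm_m a b s (Suc 0) = replicate (s 1 - 1) b @ [a]"
| "sturm_m a b s (Suc (Suc k)) =
     concat (replicate (s (Suc (Suc k))) (sturm_m a b s (Suc k))) @ sturm_m a b s k"

text \<open>The limit word, as a sequence of letters with positions counted from 0: its letter at
  position \<open>i\<close> is the eventual value of the letter at position \<open>i\<close> of \<open>sturm_m a b s k\<close>.\<close>

definition sturm_word :: "nat \<Rightarrow> nat \<Rightarrow> (nat \<Rightarrow> nat) \<Rightarrow> nat \<Rightarrow> nat" where
  "sturm_word a b s i =
     (THE c. \<forall>\<^sub>F k in sequentially. i < length (sturm_m a b s k) \<and> sturm_m a b s k ! i = c)"

lemma sturm_m_neq_Nil: "sturm_m a b s k \<noteq> []"
proof (induction k rule: less_induct)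
  case (less k)
  show ?case
  proof (cases k)
    case (Suc j)
    thus ?thesis using less.IH[of "j - 1"] by (cases j) simp_all
  qed simp
qed

lemma sturm_m_prefix_Suc:
  assumes "\<And>k. k \<ge> 1 \<Longrightarrow> s k \<ge> 1"
  shows "\<exists>v. v \<noteq> [] \<and> sturm_m a b s (Suc (Suc k)) = sturm_m a b s (Suc k) @ v"
proof -
  obtain t where "s (Suc (Suc k)) = Suc t"
    using assms[of "Suc (Suc k)"] by (cases "s (Suc (Suc k))") auto
  thus ?thesis using sturm_m_neq_Nil[of a b s k] by auto
qed

lemma sturm_m_prefix_add:
  assumes "\<And>k. k \<ge> 1 \<Longrightarrow> s k \<ge> 1"
  shows "\<exists>v. length v \<ge> d \<and> sturm_m a b s (Suc (k + d)) = sturm_m a b s (Suc k) @ v"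
proof (induction d)
  case (Suc d)
  then obtain v where v: "length v \<ge> d"
    "sturm_m a b s (Suc (k + d)) = sturm_m a b s (Suc k) @ v" by blast
  obtain u where u: "u \<noteq> []"
    "sturm_m a b s (Suc (Suc (k + d))) = sturm_m a b s (Suc (k + d)) @ u"
    using sturm_m_prefix_Suc[of s a b "k + d", OF assms] by blast
  have "length (v @ u) \<ge> Suc d" using v(1) u(1) by (cases u) auto
  moreover have "sturm_m a b s (Suc (k + Suc d)) = sturm_m a b s (Suc k) @ (v @ u)"
    using u(2) v(2) by (simp del: sturm_m.simps)
  ultimately show ?case by blast
qed (auto simp del: sturm_m.simps)

lemma sturm_word_nth:
  assumes s: "\<And>k. k \<ge> 1 \<Longrightarrow> s k \<ge> 1"
    and i: "i < length (sturm_m a b s (Suc k))"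
  shows "sturm_word a b s i = sturm_m a b s (Suc k) ! i"
  unfolding sturm_word_def
proof (rule the_equality)
  let ?P = "\<lambda>c. \<forall>\<^sub>F j in sequentially. i < length (sturm_m a b s j) \<and> sturm_m a b s j ! i = c"
  have "i < length (sturm_m a b s j) \<and> sturm_m a b s j ! i = sturm_m a b s (Suc k) ! i"
    if "j \<ge> Suc k" for j
  proof -
    define d where "d = j - Suc k"
    have "j = Suc (k + d)" using that by (simp add: d_def)
    moreover obtain v where "sturm_m a b s (Suc (k + d)) = sturm_m a b s (Suc k) @ v"
      using sturm_m_prefix_add[of s d a b k, OF s] by blast
    ultimately show ?thesis using i
      by (auto simp: nth_append simp del: sturm_m.simps)
  qed
  thus *: "?P (sturm_m a b s (Suc k) ! i)"
    unfolding eventually_sequentially by blast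
  fix c assume "?P c"
  from eventually_conj[OF this *] show "c = sturm_m a b s (Suc k) ! i"
    by (auto simp: eventually_sequentially simp del: sturm_m.simps)
qed

lemma length_sturm_m:
  assumes "\<And>k. k \<ge> 1 \<Longrightarrow> s k \<ge> 1"
  shows "k \<le> length (sturm_m a b s (Suc k))"
  using sturm_m_prefix_add[of s k a b 0, OF assms] by (auto simp del: sturm_m.simps)

definition sturm_xi :: "nat \<Rightarrow> nat \<Rightarrow> (nat \<Rightarrow> nat) \<Rightarrow> real" where
  "sturm_xi a b s = cfrac0_inf (sturm_word a b s)"

text \<open>The lower limit of \<open>[0; s\<^sub>k, s\<^sub>k\<^sub>-\<^sub>1, \<dots>, s\<^sub>1]\<close>, taken in the extended reals, where
  division by 0 gives \<open>2 / 0 = \<infinity>\<close>.\<close>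

definition sturm_sigma :: "(nat \<Rightarrow> nat) \<Rightarrow> ereal" where
  "sturm_sigma s = liminf (\<lambda>k. ereal (cfrac0 (rev (map s [1..<Suc k]))))"

lemma ereal_two_div_zero: "1 + 2 / (0::ereal) = \<infinity>"
  by (simp add: divide_ereal_def)

section \<open>Heights\<close>

definition poly_height :: "int poly \<Rightarrow> int" where
  "poly_height p = (MAX i\<in>{..degree p}. \<bar>coeff p i\<bar>)"

abbreviation ipoly :: "int poly \<Rightarrow> real \<Rightarrow> real" where
  "ipoly p x \<equiv> poly (map_poly real_of_int p) x"

text \<open>The minimal polynomial over the integers: an annihilating polynomial of least degree,
  normalised to have coprime coefficients and positive leading coefficient.\<close>

definition is_int_minpoly :: "real \<Rightarrow> int poly \<Rightarrow> bool" where
  "is_int_minpoly \<alpha> p \<longleftrightarrow>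
     p \<noteq> 0 \<and> ipoly p \<alpha> = 0 \<and> (\<forall>q. q \<noteq> 0 \<and> ipoly q \<alpha> = 0 \<longrightarrow> degree p \<le> degree q) \<and>
     content p = 1 \<and> lead_coeff p > 0"

definition int_minpoly :: "real \<Rightarrow> int poly" where
  "int_minpoly \<alpha> = (THE p. is_int_minpoly \<alpha> p)"

lemma ipoly_smult [simp]: "ipoly (smult c p) x = of_int c * ipoly p x"
proof -
  have "map_poly real_of_int (smult c p) = smult (of_int c) (map_poly real_of_int p)"
    by (rule poly_eqI) (simp add: coeff_map_poly)
  thus ?thesis by simp
qed

lemma ipoly_diff [simp]: "ipoly (p - q) x = ipoly p x - ipoly q x"
proof -
  have "map_poly real_of_int (p - q) = map_poly real_of_int p - map_poly real_of_int q"
    by (rule poly_eqI) (simp add: coeff_map_poly)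
  thus ?thesis by simp
qed

lemma is_int_minpoly_unique:
  assumes p: "is_int_minpoly \<alpha> p" and q: "is_int_minpoly \<alpha> q"
  shows "p = q"
proof -
  have deg: "degree p = degree q"
    using p q unfolding is_int_minpoly_def by (meson le_antisym)
  let ?c = "lead_coeff q" and ?d = "lead_coeff p"
  define r where "r = smult ?c p - smult ?d q"
  have root: "ipoly r \<alpha> = 0" using p q by (simp add: r_def is_int_minpoly_def)
  have "r = 0"
  proof (rule ccontr)
    assume r: "r \<noteq> 0"
    have "degree r \<le> degree p" unfolding r_def using deg
      by (intro degree_diff_le) auto
    moreover have "degree p \<le> degree r" using p r root by (auto simp: is_int_minpoly_def)
    ultimately have "degree r = degree p" by simp
    hence "lead_coeff r = 0" unfolding r_def using deg by (simp add: mult.commute)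
    thus False using r by simp
  qed
  hence eq: "smult ?c p = smult ?d q" by (simp add: r_def)
  hence "content (smult ?c p) = content (smult ?d q)" by simp
  hence "?c = ?d" using p q by (simp add: is_int_minpoly_def)
  moreover have "?c \<noteq> 0" using q by (simp add: is_int_minpoly_def)
  ultimately show ?thesis using eq by (auto simp: poly_eq_iff)
qed

lemma is_int_minpoly_exists:
  assumes "algebraic (\<alpha> :: real)"
  shows "\<exists>p. is_int_minpoly \<alpha> p"
proof -
  let ?A = "\<lambda>p. p \<noteq> 0 \<and> ipoly p \<alpha> = 0"
  obtain p0 where p0: "\<And>i. coeff p0 i \<in> \<int>" "p0 \<noteq> 0" "poly p0 \<alpha> = 0"
    using assms by (auto simp: algebraic_def)
  have "map_poly real_of_int (map_poly floor p0) = p0"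
    by (rule poly_eqI) (use p0(1) in \<open>auto simp: coeff_map_poly\<close>)
  hence "?A (map_poly floor p0)" using p0 by auto
  then obtain p where p: "?A p" and min: "\<And>q. ?A q \<Longrightarrow> degree p \<le> degree q"
    using ex_has_least_nat[of ?A _ degree] by blast
  define u :: int where "u = sgn (lead_coeff p)"
  have u: "u = 1 \<or> u = -1" using p by (auto simp: u_def sgn_if)
  define q where "q = smult u (primitive_part p)"
  have ct: "content p > 0" using p
    using normalize_content[of p] unfolding normalize_int_def
    by (metis abs_ge_zero content_eq_zero_iff order_less_le)
  have pq: "p = smult (content p) (primitive_part p)" by simp
  have "ipoly p \<alpha> = of_int (content p) * ipoly (primitive_part p) \<alpha>"
    by (subst pq, subst ipoly_smult) simp
  hence "ipoly q \<alpha> = 0" using p ct by (simp add: q_def)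
  moreover have "q \<noteq> 0" using p u by (auto simp: q_def)
  moreover have "degree q = degree p" using u by (auto simp: q_def)
  moreover have "content q = 1" using p u by (auto simp: q_def)
  moreover have "lead_coeff q > 0"
  proof -
    have "lead_coeff p = content p * lead_coeff (primitive_part p)"
      by (metis lead_coeff_smult pq)
    hence "lead_coeff p * u = content p * lead_coeff q"
      by (simp add: q_def mult_ac)
    moreover have "lead_coeff p * u > 0" using p
      by (simp add: u_def abs_sgn[symmetric])
    ultimately show ?thesis using ct by (simp add: zero_less_mult_iff)
  qed
  ultimately have "is_int_minpoly \<alpha> q" using min unfolding is_int_minpoly_def by simp
  thus ?thesis ..
qed

lemma is_int_minpoly_int_minpoly:
  "algebraic \<alpha> \<Longrightarrow> is_int_minpoly \<alpha> (int_minpoly \<alpha>)"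
  unfolding int_minpoly_def
  by (rule theI') (use is_int_minpoly_exists is_int_minpoly_unique in blast)

definition alg_degree :: "real \<Rightarrow> nat" where
  "alg_degree \<alpha> = degree (int_minpoly \<alpha>)"

definition alg_height :: "real \<Rightarrow> int" where
  "alg_height \<alpha> = poly_height (int_minpoly \<alpha>)"

section \<open>Exponents of Diophantine approximation\<close>

text \<open>All exponents are suprema, in the extended reals, of sets of real numbers. The
  definitions are meant for \<open>n \<ge> 1\<close>.\<close>

definition exp_w :: "nat \<Rightarrow> real \<Rightarrow> ereal" where
  "exp_w n \<xi> = Sup (ereal ` {w.
     infinite {p :: int poly. degree p \<le> n \<and>
       0 < \<bar>ipoly p \<xi>\<bar> \<and> \<bar>ipoly p \<xi>\<bar> \<le> of_int (poly_height p) powr (- w)}})"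

definition exp_w_star :: "nat \<Rightarrow> real \<Rightarrow> ereal" where
  "exp_w_star n \<xi> = Sup (ereal ` {w.
     infinite {\<alpha> :: real. algebraic \<alpha> \<and> alg_degree \<alpha> \<le> n \<and>
       0 < \<bar>\<xi> - \<alpha>\<bar> \<and> \<bar>\<xi> - \<alpha>\<bar> \<le> of_int (alg_height \<alpha>) powr (- w - 1)}})"

text \<open>An integer tuple \<open>(x\<^sub>0, \<dots>, x\<^sub>n)\<close> is a function on \<open>{..n}\<close>, made extensional where
  tuples are counted.\<close>

definition exp_lambda :: "nat \<Rightarrow> real \<Rightarrow> ereal" where
  "exp_lambda n \<xi> = Sup (ereal ` {l.
     infinite {x \<in> {..n} \<rightarrow>\<^sub>E (UNIV :: int set). x 0 \<noteq> 0 \<and>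
       (MAX m\<in>{1..n}. \<bar>of_int (x 0) * \<xi> ^ m - of_int (x m)\<bar>) \<le> \<bar>of_int (x 0)\<bar> powr (- l)}})"

definition exp_w_hat :: "nat \<Rightarrow> real \<Rightarrow> ereal" where
  "exp_w_hat n \<xi> = Sup (ereal ` {w.
     \<forall>\<^sub>F X :: real in at_top. \<exists>x :: nat \<Rightarrow> int.
       0 < \<bar>\<Sum>m\<le>n. of_int (x m) * \<xi> ^ m\<bar> \<and>
       \<bar>\<Sum>m\<le>n. of_int (x m) * \<xi> ^ m\<bar> \<le> X powr (- w) \<and>
       (MAX m\<in>{..n}. \<bar>of_int (x m)\<bar>) \<le> X})"

definition exp_w_hat_star :: "nat \<Rightarrow> real \<Rightarrow> ereal" where
  "exp_w_hat_star n \<xi> = Sup (ereal ` {w.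
     \<forall>\<^sub>F X :: real in at_top. \<exists>\<alpha> :: real. algebraic \<alpha> \<and> alg_degree \<alpha> \<le> n \<and>
       0 < \<bar>\<xi> - \<alpha>\<bar> \<and> \<bar>\<xi> - \<alpha>\<bar> \<le> inverse (of_int (alg_height \<alpha>)) * X powr (- w) \<and>
       of_int (alg_height \<alpha>) \<le> X})"

definition exp_lambda_hat :: "nat \<Rightarrow> real \<Rightarrow> ereal" where
  "exp_lambda_hat n \<xi> = Sup (ereal ` {l.
     \<forall>\<^sub>F X :: real in at_top. \<exists>x :: nat \<Rightarrow> int.
       0 < \<bar>x 0\<bar> \<and> of_int \<bar>x 0\<bar> \<le> X \<and>
       (MAX m\<in>{1..n}. \<bar>of_int (x 0) * \<xi> ^ m - of_int (x m)\<bar>) \<le> X powr (- l)})"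

end

theory Submission
  imports Defs
begin

text \<open>
  Let \<open>M\<^sub>k\<close> be the product of the matrices \<open>(c 1; 1 0)\<close> over the letters \<open>c\<close> of \<open>m\<^sub>k\<close>, and \<open>Q\<^sub>k\<close> its
  upper left entry, so that \<open>Q\<^sub>k\<^sub>+\<^sub>1\<close> is \<open>Q\<^sub>k\<close> to the power \<open>s\<^sub>k\<^sub>+\<^sub>1\<close> times \<open>Q\<^sub>k\<^sub>-\<^sub>1\<close> up to constants. A
  contraction argument gives \<open>ln Q\<^sub>k / ln Q\<^sub>k\<^sub>+\<^sub>1 - [0; s\<^sub>k\<^sub>+\<^sub>1, \<dots>, s\<^sub>1] \<rightarrow> 0\<close>, so the lower limit of the ratio
  of the logarithms is \<open>\<sigma>\<close>.

  Without their last two letters, the prefixes \<open>m\<^sub>k\<^sup>i m\<^sub>k\<^sub>-\<^sub>1\<close> of the Sturmian word are palindromes, so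
  their matrices are symmetric and give integer points \<open>(y\<^sub>0, y\<^sub>1, y\<^sub>2)\<close> at distance about \<open>1 / y\<^sub>0\<close> from
  \<open>y\<^sub>0 (1, \<xi>, \<xi>\<^sup>2)\<close>. Dually, the quadratic polynomial \<open>P\<^sub>k\<close> whose roots are the fixed points of \<open>M\<^sub>k\<close>
  has height at most \<open>Q\<^sub>k\<close> and vanishes on all the points \<open>m\<^sub>k\<^sup>i m\<^sub>k\<^sub>-\<^sub>1\<close>, whence \<open>P\<^sub>k(\<xi>)\<close> is of order at
  most \<open>1 / (Q\<^sub>k Q\<^sub>k\<^sub>+\<^sub>1\<^sup>2)\<close>. These points and polynomials give the lower bounds for all six exponents.

  For the upper bounds, an integer polynomial of height below \<open>Q\<^sub>k\<close> whose value at \<open>\<xi>\<close> is below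
  \<open>1 / (Q\<^sub>k\<^sup>2 Q\<^sub>k\<^sub>-\<^sub>1)\<close> is orthogonal to three points whose determinant is \<open>\<plusminus>(a - b)\<close>, hence is zero.
  Likewise an integer point that is too good an approximation is orthogonal to \<open>P\<^sub>k\<^sub>-\<^sub>1\<close> and \<open>P\<^sub>k\<close>, hence
  is a multiple of the point of \<open>m\<^sub>k m\<^sub>k\<^sub>-\<^sub>1\<close>, and one uses that \<open>\<xi>\<close> is badly approximable.
\<close>


section \<open>Integer matrices and continued fractions\<close>

text \<open>On \<open>int^2^2\<close> the operator \<open>*\<close>, and with it \<open>^\<close>,
  acts entrywise. In a type of its own the matrix product is the multiplication of a monoid, so that
  \<open>^\<close> and \<open>prod_list\<close> are matrix powers and products.\<close>

datatype mat2 = Mat2 (m00: int) (m01: int) (m10: int) (m11: int)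

instantiation mat2 :: monoid_mult
begin

definition one_mat2 :: mat2 where "1 = Mat2 1 0 0 1"

definition times_mat2 :: "mat2 \<Rightarrow> mat2 \<Rightarrow> mat2" where
  "U * V = Mat2 (m00 U * m00 V + m01 U * m10 V) (m00 U * m01 V + m01 U * m11 V)
                (m10 U * m00 V + m11 U * m10 V) (m10 U * m01 V + m11 U * m11 V)"

instance
  by standard (auto simp: one_mat2_def times_mat2_def algebra_simps)

end

lemma mat2_sel_mult [simp]:
  "m00 (U * V) = m00 U * m00 V + m01 U * m10 V"
  "m01 (U * V) = m00 U * m01 V + m01 U * m11 V"
  "m10 (U * V) = m10 U * m00 V + m11 U * m10 V"
  "m11 (U * V) = m10 U * m01 V + m11 U * m11 V"
  by (auto simp: times_mat2_def)

lemma mat2_sel_one [simp]: "m00 1 = 1" "m01 1 = 0" "m10 1 = 0" "m11 1 = 1"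
  by (auto simp: one_mat2_def)

definition mdet :: "mat2 \<Rightarrow> int" where "mdet U = m00 U * m11 U - m01 U * m10 U"

definition mtr :: "mat2 \<Rightarrow> mat2" where "mtr U = Mat2 (m00 U) (m10 U) (m01 U) (m11 U)"

definition msym :: "mat2 \<Rightarrow> bool" where "msym U \<longleftrightarrow> m01 U = m10 U"

lemma mdet_mult: "mdet (U * V) = mdet U * mdet V"
  by (simp add: mdet_def algebra_simps)

lemma mdet_one [simp]: "mdet 1 = 1"
  by (simp add: mdet_def)

lemma mtr_mult: "mtr (U * V) = mtr V * mtr U"
  by (simp add: mtr_def times_mat2_def)

lemma mtr_mtr [simp]: "mtr (mtr U) = U"
  by (simp add: mtr_def)

lemma mtr_power: "mtr (U ^ n) = mtr U ^ n"
proof (induction n)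
  case 0
  show ?case by (simp add: mtr_def one_mat2_def)
qed (simp add: mtr_mult power_commutes)

lemma msym_iff_mtr: "msym U \<longleftrightarrow> mtr U = U"
  by (cases U) (auto simp: msym_def mtr_def)

text \<open>For symmetric \<open>S\<close>, symmetry of \<open>U * S\<close> means
  \<open>U * S = S * mtr U\<close>. Powers of \<open>U\<close> can then be moved across
  \<open>S\<close> one factor at a time, and \<open>S * mtr U ^ n\<close> is the transpose of
  \<open>U ^ n * S\<close>.\<close>

lemma msym_power_mult:
  assumes S: "msym S" and US: "msym (U * S)"
  shows "msym (U ^ n * S)"
proof -
  have c: "U * S = S * mtr U"
    using S US by (simp add: msym_iff_mtr mtr_mult)
  have "U ^ n * S = S * mtr U ^ n"
  proof (induction n)
    case (Suc n)
    have "U ^ Suc n * S = U * (U ^ n * S)" by (simp add: mult.assoc)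
    also have "\<dots> = U * S * mtr U ^ n" by (simp add: Suc.IH mult.assoc)
    also have "\<dots> = S * mtr U ^ Suc n" by (simp add: c mult.assoc)
    finally show ?case .
  qed simp
  thus ?thesis using S by (simp add: msym_iff_mtr mtr_mult mtr_power)
qed

section \<open>Words as matrix products\<close>

definition letter_mat :: "nat \<Rightarrow> mat2" where "letter_mat c = Mat2 (int c) 1 1 0"

definition word_mat :: "nat list \<Rightarrow> mat2" where "word_mat w = prod_list (map letter_mat w)"

lemma word_mat_simps [simp]:
  "word_mat [] = 1"
  "word_mat (c # w) = letter_mat c * word_mat w"
  "word_mat (w @ w') = word_mat w * word_mat w'"
  by (simp_all add: word_mat_def)

lemma word_mat_concat_replicate [simp]:
  "word_mat (concat (replicate n w)) = word_mat w ^ n"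
  by (induction n) auto

lemma word_mat_replicate [simp]: "word_mat (replicate n c) = letter_mat c ^ n"
  by (induction n) auto

lemma letter_mat_sel [simp]:
  "m00 (letter_mat c) = int c" "m01 (letter_mat c) = 1"
  "m10 (letter_mat c) = 1" "m11 (letter_mat c) = 0"
  by (simp_all add: letter_mat_def)

lemma mdet_word_mat: "\<bar>mdet (word_mat w)\<bar> = 1"
proof (induction w)
  case (Cons c w)
  have "mdet (letter_mat c) = -1" by (simp add: mdet_def)
  thus ?case using Cons by (simp add: mdet_mult abs_mult)
qed simp

text \<open>Among the matrices of words in positive letters, this fails only for the empty word.\<close>

definition mat_dominant :: "mat2 \<Rightarrow> bool" where
  "mat_dominant U \<longleftrightarrow> 0 \<le> m11 U \<and> m11 U \<le> m01 U \<and> m11 U \<le> m10 U \<and> m01 U \<le> m00 U \<and>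
     m10 U \<le> m00 U \<and> 1 \<le> m01 U \<and> 1 \<le> m10 U"

lemma mat_dominant_mult:
  assumes "mat_dominant U" "mat_dominant V"
  shows "mat_dominant (U * V)"
proof -
  \<comment> \<open>Fact 1 compares the columns of \<open>V\<close>, fact 2 the rows of
    \<open>U\<close>, term by term.\<close>
  have 1: "m01 U * m11 V \<le> m01 U * m10 V" "m00 U * m01 V \<le> m00 U * m00 V"
     "m10 U * m01 V \<le> m10 U * m00 V" "m11 U * m11 V \<le> m11 U * m10 V"
    using assms by (auto simp: mat_dominant_def intro!: mult_left_mono)
  have 2: "m10 U * m00 V \<le> m00 U * m00 V" "m11 U * m10 V \<le> m01 U * m10 V"
     "m10 U * m01 V \<le> m00 U * m01 V" "m11 U * m11 V \<le> m01 U * m11 V"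
    using assms by (auto simp: mat_dominant_def intro!: mult_right_mono)
  have 3: "0 \<le> m10 U * m01 V" "0 \<le> m11 U * m11 V" "0 \<le> m01 U * m11 V" "0 \<le> m11 U * m10 V"
    using assms by (auto simp: mat_dominant_def)
  have 4: "0 < m00 U * m01 V" "0 < m10 U * m00 V"
    using assms by (auto simp: mat_dominant_def intro!: mult_pos_pos)
  show ?thesis unfolding mat_dominant_def mat2_sel_mult using 1 2 3 4 by linarith
qed

lemma mat_dominant_word_mat:
  assumes "w \<noteq> []" "\<forall>c\<in>set w. c > 0"
  shows "mat_dominant (word_mat w)"
  using assms
proof (induction w)
  case (Cons c w)
  have c: "mat_dominant (letter_mat c)" using Cons.prems by (auto simp: mat_dominant_def)
  show ?case
  proof (cases "w = []")
    case False
    with Cons have "mat_dominant (word_mat w)" by simp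
    with c show ?thesis by (simp add: mat_dominant_mult)
  qed (use c in simp)
qed simp

lemma mat_dominant_pos: "mat_dominant U \<Longrightarrow> 1 \<le> m00 U"
  by (auto simp: mat_dominant_def)

text \<open>The summand \<open>m01 U * m10 V\<close> of the upper left entry lies between 0 and the
  other summand. So \<open>m00\<close> is multiplicative up to a factor 2, which becomes negligible
  after taking logarithms.\<close>

lemma m00_mult_bounds:
  assumes "mat_dominant U" "mat_dominant V"
  shows "m00 U * m00 V \<le> m00 (U * V)" "m00 (U * V) \<le> 2 * m00 U * m00 V"
proof -
  have "0 \<le> m01 U * m10 V" using assms by (auto simp: mat_dominant_def)
  thus "m00 U * m00 V \<le> m00 (U * V)" by simp
  have "m01 U * m10 V \<le> m00 U * m00 V"
    using assms by (intro mult_mono) (auto simp: mat_dominant_def)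
  thus "m00 (U * V) \<le> 2 * m00 U * m00 V" by simp
qed

lemma m00_power_mult_bounds:
  assumes U: "mat_dominant U" and V: "mat_dominant V"
  shows "mat_dominant (U ^ n * V)" "m00 U ^ n * m00 V \<le> m00 (U ^ n * V)"
    "m00 (U ^ n * V) \<le> 2 ^ n * m00 U ^ n * m00 V"
proof -
  have "mat_dominant (U ^ n * V) \<and> m00 U ^ n * m00 V \<le> m00 (U ^ n * V) \<and>
    m00 (U ^ n * V) \<le> 2 ^ n * m00 U ^ n * m00 V"
  proof (induction n)
    case 0
    show ?case using V by simp
  next
    case (Suc n)
    let ?W = "U ^ n * V"
    have eq: "U ^ Suc n * V = U * ?W" by (simp add: mult.assoc)
    have d: "mat_dominant ?W" using Suc by simp
    have "m00 U * (m00 U ^ n * m00 V) \<le> m00 U * m00 ?W"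
      using Suc mat_dominant_pos[OF U] by (intro mult_left_mono) auto
    moreover have "2 * m00 U * m00 ?W \<le> 2 * m00 U * (2 ^ n * m00 U ^ n * m00 V)"
      using Suc mat_dominant_pos[OF U] by (intro mult_left_mono) auto
    ultimately show ?case
      using m00_mult_bounds[OF U d] mat_dominant_mult[OF U d] unfolding eq
      by (auto simp: mult_ac simp del: mat2_sel_mult)
  qed
  thus "mat_dominant (U ^ n * V)" "m00 U ^ n * m00 V \<le> m00 (U ^ n * V)"
    "m00 (U ^ n * V) \<le> 2 ^ n * m00 U ^ n * m00 V" by auto
qed

section \<open>Finite continued fractions\<close>

lemma cfrac0_nonneg: "0 \<le> cfrac0 w"
  by (induction w) auto

lemma cfrac0_le_1: "\<forall>c\<in>set w. c > 0 \<Longrightarrow> cfrac0 w \<le> 1"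
proof (cases w)
  case (Cons c v)
  moreover assume "\<forall>c\<in>set w. c > 0"
  ultimately have "1 \<le> real c + cfrac0 v" using cfrac0_nonneg[of v] by (simp add: add_increasing2)
  thus ?thesis using Cons by simp
qed simp

text \<open>\<open>letter_mat c\<close> acts on the tail \<open>t\<close> as the Moebius map
  \<open>t \<mapsto> 1 / (c + t)\<close>, read as lower row over upper row; products of matrices
  compose these maps.\<close>

lemma cfrac0_append:
  assumes "w \<noteq> []" "\<forall>c\<in>set w. c > 0"
  shows "cfrac0 (w @ w') = (m10 (word_mat w) + m11 (word_mat w) * cfrac0 w') /
    (m00 (word_mat w) + m01 (word_mat w) * cfrac0 w')"
  using assms
proof (induction w)
  case (Cons c w)
  show ?case
  proof (cases "w = []")
    case False
    let ?W = "word_mat w" and ?t = "cfrac0 w'"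
    have IH: "cfrac0 (w @ w') = (m10 ?W + m11 ?W * ?t) / (m00 ?W + m01 ?W * ?t)"
      using Cons False by simp
    have "mat_dominant ?W" using Cons.prems False by (intro mat_dominant_word_mat) auto
    hence "0 < m00 ?W + m01 ?W * ?t"
      using cfrac0_nonneg[of w'] by (auto simp: mat_dominant_def intro!: add_pos_nonneg)
    hence "c + cfrac0 (w @ w') =
       (c * (m00 ?W + m01 ?W * ?t) + (m10 ?W + m11 ?W * ?t)) / (m00 ?W + m01 ?W * ?t)"
      unfolding IH by (simp add: field_simps)
    thus ?thesis by (simp add: algebra_simps)
  qed simp
qed simp

text \<open>Over the common denominator, both numerators are at most \<open>\<bar>mdet W\<bar> = 1\<close>.\<close>

lemma cfrac0_append_approx:
  assumes w: "w \<noteq> []" "\<forall>c\<in>set w. c > 0" and w': "\<forall>c\<in>set w'. c > 0"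
  defines "W \<equiv> word_mat w"
  shows "\<bar>cfrac0 (w @ w') * m00 W - m10 W\<bar> \<le> 1 / m00 W"
    "\<bar>cfrac0 (w @ w') * m01 W - m11 W\<bar> \<le> 1 / m00 W"
proof -
  define t where "t = cfrac0 w'"
  have t: "0 \<le> t" "t \<le> 1" using cfrac0_nonneg cfrac0_le_1[OF w'] by (auto simp: t_def)
  have W: "mat_dominant W" unfolding W_def by (rule mat_dominant_word_mat[OF w])
  define d where "d = m00 W + m01 W * t"
  have d: "m00 W \<le> d" "0 < m00 W" "0 < d" 
    using W t by (auto simp: d_def mat_dominant_def intro!: add_pos_nonneg)
  have eq: "cfrac0 (w @ w') = (m10 W + m11 W * t) / d"
    unfolding W_def t_def d_def by (rule cfrac0_append[OF w])
  have det: "\<bar>real_of_int (mdet W)\<bar> = 1"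
    using mdet_word_mat[of w] unfolding W_def by (metis of_int_1 of_int_abs)
  have "cfrac0 (w @ w') * m00 W - m10 W = t * mdet W / d"
    using d unfolding eq by (simp add: field_simps d_def mdet_def)
  hence "\<bar>cfrac0 (w @ w') * m00 W - m10 W\<bar> = t / d"
    using t d det by (simp add: abs_mult)
  also have "\<dots> \<le> 1 / m00 W" using t d by (intro frac_le) auto
  finally show "\<bar>cfrac0 (w @ w') * m00 W - m10 W\<bar> \<le> 1 / m00 W" .
  have "cfrac0 (w @ w') * m01 W - m11 W = - mdet W / d"
    using d unfolding eq by (simp add: field_simps d_def mdet_def)
  hence "\<bar>cfrac0 (w @ w') * m01 W - m11 W\<bar> = 1 / d"
    using d det by simp
  also have "\<dots> \<le> 1 / m00 W" using d by (intro frac_le) auto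
  finally show "\<bar>cfrac0 (w @ w') * m01 W - m11 W\<bar> \<le> 1 / m00 W" .
qed

text \<open>Two further letters at least double the upper left entry, which pays for the increase of
  the length by 2.\<close>

lemma m00_word_mat_ge:
  assumes "\<forall>c\<in>set w. c > 0"
  shows "length w \<le> 2 * m00 (word_mat w)"
  using assms
proof (induction w rule: induct_list012)
  case (3 x y w)
  let ?W = "word_mat w"
  have IH: "int (length w) \<le> 2 * m00 ?W" using 3 by simp
  have W: "1 \<le> m00 ?W" "0 \<le> m10 ?W"
    using mat_dominant_word_mat[of w] 3 by (cases "w = []"; auto simp: mat_dominant_def)+
  have "0 < int x * int y" using 3 by simp
  hence xy: "1 \<le> int x * int y" by linarith
  have "m00 (word_mat (x # y # w)) = int x * int y * m00 ?W + m00 ?W + int x * m10 ?W"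
    by (simp add: algebra_simps)
  moreover have "1 * m00 ?W \<le> int x * int y * m00 ?W" using W xy by (intro mult_right_mono) auto
  moreover have "0 \<le> int x * m10 ?W" using W by simp
  ultimately have "m00 (word_mat (x # y # w)) \<ge> 2 * m00 ?W" by linarith
  thus ?case using IH W by simp
qed auto

section \<open>Infinite continued fractions\<close>

locale cfrac_seq =
  fixes u :: "nat \<Rightarrow> nat"
  assumes u_pos: "u i > 0"
begin

abbreviation cf_num where "cf_num \<equiv> cfrac0_inf u"

definition is_pref :: "nat list \<Rightarrow> bool" where "is_pref w \<longleftrightarrow> map u [0..<length w] = w"

lemma is_pref_appendD: "is_pref (w @ w') \<Longrightarrow> is_pref w"
  unfolding is_pref_def by (auto simp: append_eq_append_conv map_eq_append_conv upt_add_eq_append[of 0, simplified])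

lemma is_pref_take: "is_pref (map u [0..<n])"
  by (simp add: is_pref_def)

lemma is_pref_pos: "is_pref w \<Longrightarrow> \<forall>c\<in>set w. c > 0"
  unfolding is_pref_def using u_pos by (metis (no_types, lifting) ex_map_conv)

lemma cfrac0_approx:
  assumes w: "is_pref w" "w \<noteq> []" and n: "n \<ge> length w"
  defines "W \<equiv> word_mat w"
  shows "\<bar>cfrac0 (map u [0..<n]) * m00 W - m10 W\<bar> \<le> 1 / m00 W"
    "\<bar>cfrac0 (map u [0..<n]) * m01 W - m11 W\<bar> \<le> 1 / m00 W"
proof -
  have "[0..<n] = [0..<length w] @ [length w..<n]"
    using n by (metis le0 le_add_diff_inverse upt_add_eq_append)
  hence eq: "map u [0..<n] = w @ map u [length w..<n]" using w by (simp add: is_pref_def)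
  have "\<forall>c\<in>set (map u [length w..<n]). c > 0" using u_pos by auto
  from cfrac0_append_approx[OF w(2) is_pref_pos[OF w(1)] this]
  show "\<bar>cfrac0 (map u [0..<n]) * m00 W - m10 W\<bar> \<le> 1 / m00 W"
    "\<bar>cfrac0 (map u [0..<n]) * m01 W - m11 W\<bar> \<le> 1 / m00 W" unfolding eq W_def by auto
qed

text \<open>\<open>lim\<close> carries no information until convergence is shown. All truncations
  that extend a prefix with matrix \<open>W\<close> lie within \<open>1 / m00 W\<close> of the same
  fraction \<open>m10 W / m00 W\<close>, and \<open>m00 W\<close> grows without bound.\<close>

lemma cfrac0_tendsto: "(\<lambda>n. cfrac0 (map u [0..<n])) \<longlonglongrightarrow> cf_num"
proof -
  have "Cauchy (\<lambda>n. cfrac0 (map u [0..<n]))"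
  proof (rule metric_CauchyI)
    fix e :: real assume e: "e > 0"
    obtain N0 :: nat where N0: "real N0 > 4 / e" using reals_Archimedean2 by blast
    define N where "N = max 1 N0"
    define W where "W = word_mat (map u [0..<N])"
    have N: "real N > 4 / e" "N \<ge> 1" using N0 by (auto simp: N_def)
    have "mat_dominant W" unfolding W_def using N u_pos by (intro mat_dominant_word_mat) auto
    hence W1: "1 \<le> real_of_int (m00 W)" using mat_dominant_pos by fastforce
    have "N \<le> 2 * m00 W" using m00_word_mat_ge[of "map u [0..<N]"] u_pos by (auto simp: W_def)
    hence "real N \<le> 2 * real_of_int (m00 W)" by linarith
    hence W2: "2 / e < m00 W" using N by (simp add: field_simps)
    have close: "\<bar>cfrac0 (map u [0..<n]) - m10 W / m00 W\<bar> < e / 2" if "n \<ge> N" for n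
    proof -
      have "\<bar>cfrac0 (map u [0..<n]) * m00 W - m10 W\<bar> \<le> 1 / m00 W"
        unfolding W_def using cfrac0_approx(1)[OF is_pref_take[of N]] that N by auto
      also have "\<dots> \<le> 1" using W1 by simp
      finally have 1: "\<bar>cfrac0 (map u [0..<n]) * m00 W - m10 W\<bar> \<le> 1" .
      have "cfrac0 (map u [0..<n]) - m10 W / m00 W =
        (cfrac0 (map u [0..<n]) * m00 W - m10 W) / m00 W" using W1 by (simp add: field_simps)
      hence "\<bar>cfrac0 (map u [0..<n]) - m10 W / m00 W\<bar> \<le> 1 / m00 W"
        using 1 W1 by (simp add: abs_divide divide_right_mono)
      also have "\<dots> < e / 2" using W2 W1 e by (simp add: field_simps)
      finally show ?thesis .
    qed
    show "\<exists>M. \<forall>m\<ge>M. \<forall>n\<ge>M. dist (cfrac0 (map u [0..<m])) (cfrac0 (map u [0..<n])) < e"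
    proof (intro exI[of _ N] allI impI)
      fix m n assume "m \<ge> N" "n \<ge> N"
      from close[OF this(1)] close[OF this(2)]
      show "dist (cfrac0 (map u [0..<m])) (cfrac0 (map u [0..<n])) < e"
        unfolding dist_real_def by linarith
    qed
  qed
  thus ?thesis unfolding cfrac0_inf_def
    using convergent_LIMSEQ_iff real_Cauchy_convergent by blast
qed

lemma cf_num_approx:
  assumes w: "is_pref w" "w \<noteq> []"
  defines "W \<equiv> word_mat w"
  shows "\<bar>cf_num * m00 W - m10 W\<bar> \<le> 1 / m00 W" "\<bar>cf_num * m01 W - m11 W\<bar> \<le> 1 / m00 W"
proof -
  have "(\<lambda>n. \<bar>cfrac0 (map u [0..<n]) * m00 W - m10 W\<bar>) \<longlonglongrightarrow> \<bar>cf_num * m00 W - m10 W\<bar>"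
    by (intro tendsto_intros cfrac0_tendsto)
  thus "\<bar>cf_num * m00 W - m10 W\<bar> \<le> 1 / m00 W"
    by (rule LIMSEQ_le_const2) (use cfrac0_approx(1)[OF w] in \<open>auto simp: W_def\<close>)
  have "(\<lambda>n. \<bar>cfrac0 (map u [0..<n]) * m01 W - m11 W\<bar>) \<longlonglongrightarrow> \<bar>cf_num * m01 W - m11 W\<bar>"
    by (intro tendsto_intros cfrac0_tendsto)
  thus "\<bar>cf_num * m01 W - m11 W\<bar> \<le> 1 / m00 W"
    by (rule LIMSEQ_le_const2) (use cfrac0_approx(2)[OF w] in \<open>auto simp: W_def\<close>)
qed

lemma cf_num_bounds: "0 < cf_num" "cf_num \<le> 1"
proof -
  \<comment> \<open>A lower bound that does not depend on \<open>n\<close> keeps the inequality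
    strict in the limit.\<close>
  have b: "cfrac0 (map u [0..<n]) \<ge> 1 / (u 0 + 1)" if "n \<ge> 1" for n
  proof -
    have "[0..<n] = 0 # [1..<n]" using that upt_conv_Cons[of 0 n] by simp
    hence "cfrac0 (map u [0..<n]) = 1 / (u 0 + cfrac0 (map u [1..<n]))" by simp
    also have "\<dots> \<ge> 1 / (u 0 + 1)"
      using cfrac0_le_1[of "map u [1..<n]"] cfrac0_nonneg[of "map u [1..<n]"] u_pos
      by (intro divide_left_mono mult_pos_pos) (auto intro!: add_pos_nonneg)
    finally show ?thesis .
  qed
  hence "1 / (u 0 + 1) \<le> cf_num" by (intro LIMSEQ_le_const[OF cfrac0_tendsto]) blast
  moreover have "0 < 1 / real (u 0 + 1)" by simp
  ultimately show "0 < cf_num" by linarith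
  show "cf_num \<le> 1"
    using u_pos by (intro LIMSEQ_le_const2[OF cfrac0_tendsto] exI allI impI cfrac0_le_1) auto
qed

text \<open>One of the two columns of the matrix of a prefix is not proportional to \<open>(x\<^sub>0, x\<^sub>1)\<close>;
  the prefix is taken just long enough for \<open>x\<^sub>0\<close> to be small against the matrix.\<close>

lemma cf_num_badly_approximable:
  assumes B: "\<And>i. u i \<le> B" and x0: "x0 \<noteq> 0"
  shows "1 / (4 * (real B + 1) * \<bar>real_of_int x0\<bar>) \<le> \<bar>x0 * cf_num - real_of_int x1\<bar>"
proof -
  define V where "V n = word_mat (map u [0..<n])" for n
  have VS: "V (Suc n) = V n * letter_mat (u n)" for n by (simp add: V_def)
  have dom: "mat_dominant (V n)" if "n \<ge> 1" for n
    unfolding V_def using that u_pos by (intro mat_dominant_word_mat) auto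
  have ge: "int n \<le> 2 * m00 (V n)" for n
    using m00_word_mat_ge[of "map u [0..<n]"] u_pos by (auto simp: V_def)
  have ex: "2 * \<bar>x0\<bar> \<le> m00 (V n)" if "n = nat (4 * \<bar>x0\<bar>)" for n
    using ge[of n] that by linarith
  define n where "n = (LEAST n. 2 * \<bar>x0\<bar> \<le> m00 (V n))"
  have n1: "2 * \<bar>x0\<bar> \<le> m00 (V n)" unfolding n_def by (rule LeastI[OF ex]) simp
  have n0: "n \<noteq> 0"
  proof
    assume "n = 0"
    hence "m00 (V n) = 1" by (simp add: V_def)
    thus False using n1 x0 by linarith
  qed
  then obtain m where m: "n = Suc m" by (cases n) auto
  have "m < (LEAST n. 2 * \<bar>x0\<bar> \<le> m00 (V n))" using m by (simp add: n_def)
  hence m2: "m00 (V m) < 2 * \<bar>x0\<bar>" using not_less_Least by force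
  have Vm: "m01 (V m) \<le> m00 (V m)" "0 \<le> m00 (V m)"
    using dom[of m] by (cases "m = 0"; auto simp: V_def mat_dominant_def)+
  \<comment> \<open>By minimality of \<open>n\<close> the entry for the prefix one letter shorter is
    still below \<open>2 * \<bar>x0\<bar>\<close>, and one letter multiplies it by at most
    \<open>B + 1\<close>.\<close>
  have "m00 (V n) = m00 (V m) * int (u m) + m01 (V m)" by (simp add: m VS)
  also have "\<dots> \<le> m00 (V m) * int B + m00 (V m)"
    using Vm B[of m] by (intro add_mono mult_left_mono) auto
  also have "\<dots> = m00 (V m) * (int B + 1)" by (simp add: algebra_simps)
  also have "\<dots> \<le> 2 * \<bar>x0\<bar> * (int B + 1)" using m2 by (intro mult_right_mono) auto
  finally have up: "real_of_int (m00 (V n)) \<le> real_of_int (2 * \<bar>x0\<bar> * (int B + 1))"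
    using of_int_le_iff by blast
  define W where "W = V n"
  have W: "mat_dominant W" unfolding W_def by (rule dom) (use n0 in simp)
  have ap: "\<bar>cf_num * m00 W - m10 W\<bar> \<le> 1 / m00 W" "\<bar>cf_num * m01 W - m11 W\<bar> \<le> 1 / m00 W"
    unfolding W_def V_def using cf_num_approx[OF is_pref_take[of n]] n0 by auto
  let ?e = "\<bar>x0 * cf_num - real_of_int x1\<bar>"
  have Wpos: "0 < real_of_int (m00 W)" using W mat_dominant_pos by fastforce
  have half: "\<bar>real_of_int x0\<bar> * (1 / m00 W) \<le> 1 / 2"
    using n1 Wpos by (simp add: W_def field_simps flip: of_int_abs)
  \<comment> \<open>The nonzero integer \<open>x0 * q - x1 * p\<close> has absolute value at least
    1, and the error \<open>cf_num * p - q\<close> accounts for at most 1/2 of it by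
    \<open>half\<close>.\<close>
  have key: "1 / 2 \<le> m00 W * ?e"
    if pq: "\<bar>cf_num * p - q\<bar> \<le> 1 / m00 W" "0 \<le> p" "p \<le> m00 W" and ne: "x0 * q \<noteq> x1 * p"
    for p q :: int
  proof -
    have "1 \<le> \<bar>x0 * q - x1 * p\<bar>" using ne by linarith
    hence "1 \<le> \<bar>real_of_int (x0 * q - x1 * p)\<bar>" by linarith
    also have "real_of_int (x0 * q - x1 * p) =
      p * (x0 * cf_num - x1) - x0 * (cf_num * p - q)" by (simp add: algebra_simps)
    also have "\<bar>\<dots>\<bar> \<le> \<bar>p * (x0 * cf_num - x1)\<bar> + \<bar>x0 * (cf_num * p - q)\<bar>"
      by (rule abs_triangle_ineq4)
    also have "\<dots> = p * ?e + \<bar>real_of_int x0\<bar> * \<bar>cf_num * p - q\<bar>" using pq by (simp add: abs_mult)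
    also have "\<dots> \<le> m00 W * ?e + \<bar>real_of_int x0\<bar> * (1 / m00 W)"
      using pq by (intro add_mono mult_left_mono mult_right_mono) auto
    also have "\<dots> \<le> m00 W * ?e + 1 / 2" using half by simp
    finally show ?thesis by simp
  qed
  have "x0 * m10 W \<noteq> x1 * m00 W \<or> x0 * m11 W \<noteq> x1 * m01 W"
  proof (rule ccontr)
    assume "\<not> ?thesis"
    hence h: "x0 * m10 W = x1 * m00 W" "x0 * m11 W = x1 * m01 W" by auto
    have "x0 * mdet W = m00 W * (x0 * m11 W) - m01 W * (x0 * m10 W)"
      by (simp add: mdet_def algebra_simps)
    also have "\<dots> = 0" unfolding h by simp
    finally have "mdet W = 0" using x0 by simp
    thus False using mdet_word_mat[of "map u [0..<n]"] by (simp add: W_def V_def)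
  qed
  hence "1 / 2 \<le> m00 W * ?e"
    using key[OF ap(1)] key[OF ap(2)] W by (auto simp: mat_dominant_def)
  also have "\<dots> \<le> (2 * \<bar>real_of_int x0\<bar> * (real B + 1)) * ?e"
    using up by (intro mult_right_mono) (auto simp: W_def)
  finally have "1 / 2 \<le> 2 * \<bar>real_of_int x0\<bar> * (real B + 1) * ?e" .
  moreover have "0 < 4 * (real B + 1) * \<bar>real_of_int x0\<bar>" using x0 by simp
  ultimately show ?thesis by (simp only: divide_le_eq if_True) (simp add: algebra_simps)
qed

end

section \<open>Points and polynomials of degree at most two\<close>

text \<open>The roots of \<open>fix_poly U\<close> are the numbers \<open>x\<close> for which \<open>(1, x)\<close> is an eigenvector of \<open>U\<close>.
  A symmetric matrix stands for the point \<open>(m00, m01, m11)\<close>.\<close>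

definition fix_poly :: "mat2 \<Rightarrow> int poly" where
  "fix_poly U = [:- m10 U, m00 U - m11 U, m01 U:]"

definition pairing :: "mat2 \<Rightarrow> int poly \<Rightarrow> int" where
  "pairing Z p = m00 Z * coeff p 0 + m01 Z * coeff p 1 + m11 Z * coeff p 2"

lemma coeff_fix_poly [simp]:
  "coeff (fix_poly U) 0 = - m10 U" "coeff (fix_poly U) (Suc 0) = m00 U - m11 U"
  "coeff (fix_poly U) 2 = m01 U"
  by (simp_all add: fix_poly_def numeral_2_eq_2)

lemma degree_fix_poly: "degree (fix_poly U) \<le> 2"
  by (simp add: fix_poly_def)

text \<open>The pairing measures how far \<open>U * Z\<close> is from symmetric. So the vanishing of
  an integer linear form becomes a symmetry of matrices, that is, palindromicity of words.\<close>

lemma pairing_fix_poly: "msym Z \<Longrightarrow> pairing Z (fix_poly U) = m01 (U * Z) - m10 (U * Z)"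
  by (simp add: pairing_def msym_def algebra_simps)

lemma pairing_fix_poly_eq_0: "msym Z \<Longrightarrow> msym (U * Z) \<Longrightarrow> pairing Z (fix_poly U) = 0"
  unfolding pairing_fix_poly by (simp add: msym_def del: mat2_sel_mult)

lemma ipoly_deg2:
  fixes x :: real
  assumes "degree p \<le> 2"
  shows "ipoly p x = coeff p 0 + coeff p 1 * x + coeff p 2 * x\<^sup>2"
proof -
  have "ipoly p x = (\<Sum>i\<le>2. real_of_int (coeff p i) * x ^ i)"
    using assms by (subst poly_altdef)
      (auto simp: coeff_map_poly coeff_eq_0 degree_map_poly intro!: sum.mono_neutral_left le_degree)
  thus ?thesis by (simp add: numeral_2_eq_2)
qed

text \<open>The cross product of \<open>Y\<close> and \<open>U * Y\<close> is \<open>mdet Y\<close> times the coefficient vector of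
  \<open>fix_poly U\<close>, whence the determinant of the three points is \<open>mdet Y * pairing Z (fix_poly U)\<close>.\<close>

lemma pairing_nondegenerate:
  assumes Y: "msym Y" "msym (U * Y)" and det: "mdet Y \<noteq> 0" and Z: "pairing Z (fix_poly U) \<noteq> 0"
    and p: "degree p \<le> 2" "pairing Y p = 0" "pairing (U * Y) p = 0" "pairing Z p = 0"
  shows "p = 0"
proof -
  obtain p0 p1 p2 where pd: "p0 = coeff p 0" "p1 = coeff p 1" "p2 = coeff p 2" by simp
  obtain y0 y1 y2 where Yd: "Y = Mat2 y0 y1 y1 y2" using Y by (cases Y) (auto simp: msym_def)
  obtain u0 u1 u2 u3 where Ud: "U = Mat2 u0 u1 u2 u3" by (cases U)
  obtain z0 z1 z1' z2 where Zd: "Z = Mat2 z0 z1 z1' z2" by (cases Z)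
  have s: "u0 * y1 + u1 * y2 = u2 * y0 + u3 * y1" using Y by (simp add: Yd Ud msym_def)
  define d where "d = (y0 * y2 - y1 * y1) * (- z0 * u2 + z1 * (u0 - u3) + z2 * u1)"
  have d: "d \<noteq> 0" using det Z by (auto simp: d_def Yd Ud Zd mdet_def pairing_def)
  have e1: "y0 * p0 + y1 * p1 + y2 * p2 = 0"
    using p by (simp add: pairing_def Yd pd)
  have e2: "(u0 * y0 + u1 * y1) * p0 + (u0 * y1 + u1 * y2) * p1 + (u2 * y1 + u3 * y2) * p2 = 0"
    using p by (simp add: pairing_def Yd Ud pd)
  have e3: "z0 * p0 + z1 * p1 + z2 * p2 = 0" using p by (simp add: pairing_def Zd pd)
  have "d * p0 = 0" unfolding d_def using s e1 e2 e3 by algebra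
  moreover have "d * p1 = 0" unfolding d_def using s e1 e2 e3 by algebra
  moreover have "d * p2 = 0" unfolding d_def using s e1 e2 e3 by algebra
  ultimately have "coeff p 0 = 0" "coeff p 1 = 0" "coeff p 2 = 0" using d pd by auto
  moreover have "coeff p n = 0" if "n > 2" for n using p(1) that by (intro coeff_eq_0) simp
  ultimately have "coeff p n = 0" for n
    by (cases "n = 0 \<or> n = 1 \<or> n = 2") auto
  thus ?thesis by (simp add: poly_eq_iff)
qed

text \<open>A point orthogonal to two independent polynomials is determined up to a factor; \<open>Z\<close> is a
  witness for the independence, and \<open>mdet Y = \<plusminus>1\<close> makes \<open>Y\<close> primitive.\<close>

lemma pairing_proportional:
  assumes Y: "msym Y" "\<bar>mdet Y\<bar> = 1" "pairing Y p = 0" "pairing Y q = 0"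
    and X: "pairing X p = 0" "pairing X q = 0"
    and Z: "pairing Z p \<noteq> 0" "pairing Z q = 0" and q: "coeff q 2 \<noteq> 0"
  shows "\<exists>t. m00 X = t * m00 Y \<and> m01 X = t * m01 Y"
proof -
  obtain p0 p1 p2 where pd: "p0 = coeff p 0" "p1 = coeff p 1" "p2 = coeff p 2" by simp
  obtain q0 q1 q2 where qd: "q0 = coeff q 0" "q1 = coeff q 1" "q2 = coeff q 2" by simp
  obtain y0 y1 y2 where Yd: "Y = Mat2 y0 y1 y1 y2" using Y by (cases Y) (auto simp: msym_def)
  obtain x0 x1 x1' x2 where Xd: "X = Mat2 x0 x1 x1' x2" by (cases X)
  obtain z0 z1 z1' z2 where Zd: "Z = Mat2 z0 z1 z1' z2" by (cases Z)
  define D where "D = z0 * p0 + z1 * p1 + z2 * p2"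
  have D: "D * q2 \<noteq> 0" using Z q by (simp add: D_def Zd pairing_def pd qd)
  have e: "y0 * p0 + y1 * p1 + y2 * p2 = 0" "y0 * q0 + y1 * q1 + y2 * q2 = 0"
    "x0 * p0 + x1 * p1 + x2 * p2 = 0" "x0 * q0 + x1 * q1 + x2 * q2 = 0"
    "z0 * q0 + z1 * q1 + z2 * q2 = 0"
    using Y X Z by (simp_all add: pairing_def Yd Xd Zd pd qd)
  \<comment> \<open>The cross product of \<open>X\<close> and \<open>Y\<close> is parallel to both
    \<open>p\<close> and \<open>q\<close>, and pairing with \<open>Z\<close> tells these two
    directions apart; so it vanishes, here in its third coordinate.\<close>
  have "D * q2 * (x0 * y1 - x1 * y0) = 0" unfolding D_def using e by algebra
  hence eq: "x0 * y1 = x1 * y0" using D by simp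
  have "\<bar>y0 * y2 - y1 * y1\<bar> = 1" using Y by (simp add: Yd mdet_def)
  then obtain c where c: "c * (y0 * y2 - y1 * y1) = 1" "c = 1 \<or> c = -1"
    by (metis abs_mult_self_eq mult_1 abs_1 mult_minus_left abs_eq_iff')
  \<comment> \<open>\<open>c\<close> equals \<open>mdet Y\<close>, which is its own inverse;
    expanding \<open>x0 * mdet Y\<close> and \<open>x1 * mdet Y\<close> with \<open>eq\<close>
    exhibits the factor as an integer.\<close>
  have "x0 = c * (x0 * y2 - x1 * y1) * y0" "x1 = c * (x0 * y2 - x1 * y1) * y1"
    using eq c(1) by algebra+
  thus ?thesis by (auto simp: Xd Yd)
qed

text \<open>At a point near a multiple of \<open>(1, \<xi>, \<xi>\<^sup>2)\<close> the pairing is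
  the value of \<open>p\<close> at \<open>\<xi>\<close>, scaled by \<open>m00 Z\<close>, up to the
  approximation error. Being an integer, it is 0 once scaled value and error add up to less than 1;
  conversely a zero pairing bounds the scaled value by the error.\<close>

lemma pairing_approx:
  fixes \<xi> :: real
  assumes p: "degree p \<le> 2" and H: "\<And>i. \<bar>real_of_int (coeff p i)\<bar> \<le> H"
    and e: "\<bar>m00 Z * \<xi> - m01 Z\<bar> \<le> e" "\<bar>m00 Z * \<xi>\<^sup>2 - m11 Z\<bar> \<le> e"
  shows "\<bar>pairing Z p - m00 Z * ipoly p \<xi>\<bar> \<le> 2 * H * e"
proof -
  have "pairing Z p - m00 Z * ipoly p \<xi> =
    - (coeff p 1 * (m00 Z * \<xi> - m01 Z)) - coeff p 2 * (m00 Z * \<xi>\<^sup>2 - m11 Z)"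
    by (simp add: ipoly_deg2[OF p] pairing_def algebra_simps)
  also have "\<bar>\<dots>\<bar> \<le> \<bar>coeff p 1 * (m00 Z * \<xi> - m01 Z)\<bar> + \<bar>coeff p 2 * (m00 Z * \<xi>\<^sup>2 - m11 Z)\<bar>"
    by linarith
  also have "\<dots> \<le> H * e + H * e"
    unfolding abs_mult using H e order_trans[OF abs_ge_zero H[of 0]] by (intro add_mono mult_mono) auto
  finally show ?thesis by simp
qed

section \<open>Heights\<close>

lemma abs_coeff_le_poly_height: "\<bar>coeff p i\<bar> \<le> poly_height p"
proof (cases "i \<le> degree p")
  case True
  thus ?thesis unfolding poly_height_def by (intro Max_ge) auto
next
  case False
  hence "\<bar>coeff p i\<bar> \<le> \<bar>coeff p 0\<bar>" by (simp add: coeff_eq_0)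
  also have "\<dots> \<le> poly_height p" unfolding poly_height_def by (intro Max_ge) auto
  finally show ?thesis .
qed

lemma poly_height_le: "(\<And>i. \<bar>coeff p i\<bar> \<le> B) \<Longrightarrow> poly_height p \<le> B"
  unfolding poly_height_def by (subst Max_le_iff) auto

lemma poly_height_ge_1: "p \<noteq> 0 \<Longrightarrow> 1 \<le> poly_height p"
  using abs_coeff_le_poly_height[of p "degree p"] leading_coeff_neq_0[of p] by linarith

text \<open>Serves to find members of arbitrarily large height in an infinite set of
  polynomials.\<close>

lemma finite_poly_height_le: "finite {p. degree p \<le> n \<and> poly_height p \<le> B}"
proof -
  have "{p. degree p \<le> n \<and> poly_height p \<le> B} \<subseteq>
    Poly ` {xs. set xs \<subseteq> {-B..B} \<and> length xs = Suc n}"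
  proof
    fix p assume p: "p \<in> {p. degree p \<le> n \<and> poly_height p \<le> B}"
    let ?xs = "map (coeff p) [0..<Suc n]"
    have "p = Poly ?xs"
      using p by (intro poly_eqI) (auto simp: nth_default_def coeff_eq_0 simp del: upt_Suc)
    moreover have "set ?xs \<subseteq> {-B..B}"
    proof -
      have "\<bar>coeff p i\<bar> \<le> B" for i using abs_coeff_le_poly_height[of p i] p by auto
      thus ?thesis by (auto simp: abs_le_iff minus_le_iff simp del: upt_Suc)
    qed
    ultimately show "p \<in> Poly ` {xs. set xs \<subseteq> {-B..B} \<and> length xs = Suc n}"
      by (intro image_eqI[of _ _ ?xs]) auto
  qed
  moreover have "finite {xs. set xs \<subseteq> {-B..B} \<and> length xs = Suc n}"
    by (rule finite_lists_length_eq) simp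
  ultimately show ?thesis using finite_surj by blast
qed

lemma ipoly_diff_le:
  assumes p: "degree p \<le> 2" and H: "\<And>i. \<bar>real_of_int (coeff p i)\<bar> \<le> H"
  shows "\<bar>ipoly p x - ipoly p y\<bar> \<le> H * \<bar>x - y\<bar> * (1 + \<bar>x\<bar> + \<bar>y\<bar>)"
proof -
  have "ipoly p x - ipoly p y = (x - y) * (coeff p 1 + coeff p 2 * (x + y))"
    unfolding ipoly_deg2[OF p] by (simp add: algebra_simps power2_eq_square)
  also have "\<bar>\<dots>\<bar> = \<bar>x - y\<bar> * \<bar>coeff p 1 + coeff p 2 * (x + y)\<bar>" by (rule abs_mult)
  also have "\<bar>coeff p 1 + coeff p 2 * (x + y)\<bar> \<le> \<bar>real_of_int (coeff p 1)\<bar> + \<bar>coeff p 2 * (x + y)\<bar>"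
    by (rule abs_triangle_ineq)
  also have "\<dots> \<le> H + H * (\<bar>x\<bar> + \<bar>y\<bar>)"
    unfolding abs_mult using H order_trans[OF abs_ge_zero H[of 0]]
    by (intro add_mono mult_mono) (auto intro: abs_triangle_ineq)
  finally have "\<bar>ipoly p x - ipoly p y\<bar> \<le> \<bar>x - y\<bar> * (H + H * (\<bar>x\<bar> + \<bar>y\<bar>))"
    by (simp add: mult_left_mono)
  thus ?thesis by (simp add: algebra_simps)
qed

lemma algebraic_ipoly_root:
  assumes "p \<noteq> 0" "ipoly p \<alpha> = 0"
  shows "algebraic \<alpha>"
  unfolding algebraic_def
proof (intro exI conjI allI)
  show "coeff (map_poly real_of_int p) i \<in> \<int>" for i by (simp add: coeff_map_poly)
  show "map_poly real_of_int p \<noteq> 0" using assms by (simp add: map_poly_eq_0_iff)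
qed (use assms in simp)

lemma int_minpoly_facts:
  assumes "algebraic \<alpha>"
  shows "int_minpoly \<alpha> \<noteq> 0" "ipoly (int_minpoly \<alpha>) \<alpha> = 0" "1 \<le> alg_height \<alpha>"
    "degree (int_minpoly \<alpha>) \<ge> 1"
proof -
  note mp = is_int_minpoly_int_minpoly[OF assms, unfolded is_int_minpoly_def]
  show 1: "int_minpoly \<alpha> \<noteq> 0" and 2: "ipoly (int_minpoly \<alpha>) \<alpha> = 0" using mp by auto
  show "1 \<le> alg_height \<alpha>" unfolding alg_height_def using 1 by (rule poly_height_ge_1)
  show "degree (int_minpoly \<alpha>) \<ge> 1"
  proof (rule ccontr)
    assume "\<not> ?thesis"
    hence "degree (int_minpoly \<alpha>) = 0" by simp
    then obtain c where "int_minpoly \<alpha> = [:c:]" by (meson degree_eq_zeroE)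
    thus False using 1 2 by (auto simp: map_poly_pCons)
  qed
qed

text \<open>A minimal polynomial of degree 2 is primitive and proportional to \<open>p\<close>, so
  passing from it to \<open>p\<close> multiplies the absolute values of the coefficients by the
  content of \<open>p\<close>. For a minimal polynomial \<open>[:v, u:]\<close> the rational root
  theorem gives \<open>u dvd coeff p 2\<close>, and \<open>\<bar>\<alpha>\<bar> \<le> 1\<close>
  gives \<open>\<bar>v\<bar> \<le> u\<close>.\<close>

lemma quadratic_root_height:
  fixes \<alpha> :: real
  assumes p: "p \<noteq> 0" "degree p \<le> 2" and c2: "coeff p 2 \<noteq> 0"
    and B: "\<And>i. \<bar>coeff p i\<bar> \<le> B" and root: "ipoly p \<alpha> = 0" and \<alpha>: "\<bar>\<alpha>\<bar> \<le> 1"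
  shows "alg_degree \<alpha> \<le> 2" "alg_height \<alpha> \<le> B"
proof -
  define q where "q = int_minpoly \<alpha>"
  have alg: "algebraic \<alpha>" by (rule algebraic_ipoly_root[OF p(1) root])
  note mp = is_int_minpoly_int_minpoly[OF alg, folded q_def, unfolded is_int_minpoly_def]
  have dq: "degree q \<le> degree p" using mp p root by blast
  show "alg_degree \<alpha> \<le> 2" unfolding alg_degree_def using dq p by (simp add: q_def)
  have dp: "degree p = 2" using p c2 le_degree[of p 2] by simp
  have "poly_height q \<le> B"
  proof (cases "degree q = 2")
    case True
    define t where "t = smult (lead_coeff q) p - smult (lead_coeff p) q"
    have "ipoly t \<alpha> = 0" using mp root by (simp add: t_def)
    have "t = 0"
    proof (rule ccontr)
      assume t: "t \<noteq> 0"
      have "degree t \<le> 2" unfolding t_def using True dp by (intro degree_diff_le) auto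
      moreover have "coeff t 2 = 0" unfolding t_def using True dp by simp
      ultimately have "degree t < 2" using t
        by (metis leading_coeff_0_iff linorder_neqE_nat not_less)
      moreover have "degree q \<le> degree t" using mp t \<open>ipoly t \<alpha> = 0\<close> by blast
      ultimately show False using True by simp
    qed
    hence eq: "smult (lead_coeff q) p = smult (lead_coeff p) q" by (simp add: t_def)
    hence "content (smult (lead_coeff q) p) = content (smult (lead_coeff p) q)" by simp
    hence ct: "\<bar>lead_coeff q\<bar> * content p = \<bar>lead_coeff p\<bar>" using mp by simp
    have lq: "lead_coeff q > 0" using mp by blast
    have "\<bar>coeff q i\<bar> \<le> B" for i
    proof -
      have "lead_coeff q * coeff p i = lead_coeff p * coeff q i"
        using arg_cong[OF eq, of "\<lambda>t. coeff t i"] by simp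
      hence "\<bar>lead_coeff q\<bar> * \<bar>coeff p i\<bar> = \<bar>lead_coeff q\<bar> * (content p * \<bar>coeff q i\<bar>)"
        using ct by (metis abs_mult mult.assoc)
      hence e: "\<bar>coeff p i\<bar> = content p * \<bar>coeff q i\<bar>" using lq mp by simp
      have "content p \<ge> 1"
        using ct lq p(1) by (smt (verit) leading_coeff_0_iff mult_le_0_iff zero_less_abs_iff)
      hence "1 * \<bar>coeff q i\<bar> \<le> content p * \<bar>coeff q i\<bar>" by (intro mult_right_mono) auto
      thus ?thesis using e B[of i] by linarith
    qed
    thus ?thesis by (rule poly_height_le)
  next
    case False
    have "degree q = 1" using False dq dp int_minpoly_facts(4)[OF alg, folded q_def] by linarith
    define v u where "v = coeff q 0" and "u = coeff q 1"
    have q: "q = [:v, u:]"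
      using \<open>degree q = 1\<close> by (intro poly_eqI) (auto simp: v_def u_def coeff_pCons coeff_eq_0 split: nat.split)
    have u: "u > 0" using mp \<open>degree q = 1\<close> by (simp add: u_def)
    have cop: "coprime u v"
    proof (rule coprimeI)
      fix c assume "c dvd u" "c dvd v"
      hence "[:c:] dvd q" unfolding const_poly_dvd_iff q by (auto simp: coeff_pCons split: nat.split)
      hence "c dvd content q" by (simp only: const_poly_dvd_iff_dvd_content)
      thus "is_unit c" using mp by argo
    qed
    have "ipoly q \<alpha> = v + u * \<alpha>"
      using ipoly_deg2[of q \<alpha>] \<open>degree q = 1\<close> by (simp add: v_def u_def coeff_eq_0)
    hence r: "real_of_int v = - (real_of_int u * \<alpha>)" using mp by linarith
    have "real_of_int (coeff p 0 * u\<^sup>2 - coeff p 1 * u * v + coeff p 2 * v\<^sup>2) = u\<^sup>2 * ipoly p \<alpha>"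
      unfolding ipoly_deg2[OF p(2)] using r by (simp add: algebra_simps power2_eq_square)
    hence "coeff p 0 * u\<^sup>2 - coeff p 1 * u * v + coeff p 2 * v\<^sup>2 = 0" using root by (simp only: mult_zero_right of_int_eq_0_iff)
    hence "coeff p 2 * v\<^sup>2 = u * (coeff p 1 * v - coeff p 0 * u)"
      by (simp add: algebra_simps power2_eq_square)
    hence "u dvd coeff p 2 * v\<^sup>2" by simp
    hence "u dvd coeff p 2" using cop by (simp add: coprime_dvd_mult_left_iff)
    hence "u \<le> \<bar>coeff p 2\<bar>" using c2 by (meson dvd_imp_le_int abs_ge_self order_trans)
    hence uB: "u \<le> B" using B[of 2] by linarith
    have "\<bar>real_of_int v\<bar> = u * \<bar>\<alpha>\<bar>" using r u by (simp add: abs_mult)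
    also have "\<dots> \<le> real_of_int u * 1" using u \<alpha> by (intro mult_left_mono) auto
    finally have "\<bar>v\<bar> \<le> u" by linarith
    hence "\<bar>coeff q i\<bar> \<le> B" for i using u uB by (auto simp: q coeff_pCons split: nat.split)
    thus ?thesis by (rule poly_height_le)
  qed
  thus "alg_height \<alpha> \<le> B" by (simp add: alg_height_def q_def)
qed

section \<open>Limits and suprema\<close>

lemma tendsto_0_two_step_contraction:
  fixes d \<eta> :: "nat \<Rightarrow> real"
  assumes d: "\<And>k. 0 \<le> d k" "\<And>k. d k \<le> 1"
    and step: "\<forall>\<^sub>F k in sequentially. d (Suc (Suc k)) \<le> d k / 2 + \<eta> k" and \<eta>: "\<eta> \<longlonglongrightarrow> 0"
  shows "d \<longlonglongrightarrow> 0"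
proof (rule LIMSEQ_I)
  fix e :: real assume e: "e > 0"
  have "\<forall>\<^sub>F k in sequentially. \<eta> k < e / 8" using \<eta> e by (intro order_tendstoD) auto
  with step have "\<forall>\<^sub>F k in sequentially. d (Suc (Suc k)) \<le> d k / 2 + e / 8"
    by eventually_elim linarith
  then obtain N where N: "\<And>k. k \<ge> N \<Longrightarrow> d (Suc (Suc k)) \<le> d k / 2 + e / 8"
    unfolding eventually_sequentially by blast
  \<comment> \<open>\<open>e / 4\<close> is fixed by \<open>x \<mapsto> x / 2 + e / 8\<close>, so
    the accumulated errors never exceed it.\<close>
  have pow: "d (M + 2 * n) \<le> (1 / 2) ^ n + e / 4" if "M \<ge> N" for M n
  proof (induction n)
    case 0
    show ?case using d(2)[of M] e by simp
  next
    case (Suc n)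
    have "d (M + 2 * Suc n) \<le> d (M + 2 * n) / 2 + e / 8" using N[of "M + 2 * n"] that by simp
    also have "\<dots> \<le> ((1 / 2) ^ n + e / 4) / 2 + e / 8" using Suc by simp
    also have "\<dots> = (1 / 2) ^ Suc n + e / 4" by (simp add: field_simps)
    finally show ?case .
  qed
  obtain n where n: "(1 / 2 :: real) ^ n < e / 2" using real_arch_pow_inv[of "e / 2" "1 / 2"] e by auto
  have "norm (d k - 0) < e" if k: "k \<ge> N + 2 * n + 1" for k
  proof -
    define j where "j = (k - N) div 2"
    \<comment> \<open>\<open>M\<close> is \<open>N\<close> or \<open>N + 1\<close>, whichever can be
      joined to \<open>k\<close> by double steps.\<close>
    define M where "M = N + (k - N) mod 2"
    have kj: "k = M + 2 * j" using k by (simp add: M_def j_def)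
    have "j \<ge> n" using k by (simp add: j_def)
    hence "(1 / 2 :: real) ^ j \<le> (1 / 2) ^ n" by (intro power_decreasing) auto
    moreover have "M \<ge> N" by (simp add: M_def)
    ultimately have "d (M + 2 * j) < e" using pow[of M j] n e by linarith
    hence "d k < e" by (subst kj)
    thus ?thesis using d(1)[of k] by simp
  qed
  thus "\<exists>N. \<forall>k\<ge>N. norm (d k - 0) < e" by blast
qed

text \<open>Together with \<open>le_mult_powrD\<close> this turns inequalities between powers into
  linear inequalities between logarithms, the form in which the growth of the denominators is
  known.\<close>

lemma le_powrI: "ln A \<le> t * ln Y \<Longrightarrow> A \<le> Y powr t" if "0 < A" "0 < Y" for A Y t :: real
  using that by (simp add: powr_def ln_ge_iff[symmetric] ln_le_cancel_iff[symmetric])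

lemma le_mult_powrD:
  fixes A D Y t :: real
  assumes "0 < A" "0 < Y" "0 < D" "A \<le> D * Y powr t"
  shows "ln A \<le> ln D + t * ln Y"
proof -
  have "ln A \<le> ln (D * Y powr t)" using assms by (subst ln_le_cancel_iff) auto
  thus ?thesis using assms by (simp add: ln_mult ln_powr)
qed

text \<open>\<open>f\<close> may fail to be monotone, hence the least \<open>j\<close> with
  \<open>X < f j\<close>; a value \<open>X\<close> beyond all of \<open>f 0, ..., f N\<close> pushes
  \<open>j\<close> past \<open>N\<close>.\<close>

lemma eventually_between:
  fixes f :: "nat \<Rightarrow> real"
  assumes "filterlim f at_top sequentially"
  shows "\<forall>\<^sub>F X in at_top. \<exists>k\<ge>N. f k \<le> X \<and> X < f (Suc k)"
proof -
  define T where "T = Max (f ` {..N})"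
  have "\<exists>k\<ge>N. f k \<le> X \<and> X < f (Suc k)" if X: "T \<le> X" for X
  proof -
    have "\<forall>\<^sub>F k in sequentially. X + 1 \<le> f k" using assms by (auto simp: filterlim_at_top)
    then obtain j0 where j0: "X < f j0" by (auto simp: eventually_sequentially) (smt (verit) order_refl)
    define j where "j = (LEAST j. X < f j)"
    have j: "X < f j" unfolding j_def using j0 by (rule LeastI)
    have "f i \<le> X" if "i \<le> N" for i
    proof -
      have "f i \<le> T" unfolding T_def using that by (intro Max_ge) auto
      thus ?thesis using X by linarith
    qed
    hence jN: "j > N" using j not_le_imp_less by (metis linorder_not_less)
    then obtain k where k: "j = Suc k" by (cases j) auto
    have "\<not> X < f k" using k not_less_Least[of k "\<lambda>j. X < f j"] by (simp add: j_def)
    thus ?thesis using k j jN by (intro exI[of _ k]) auto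
  qed
  thus ?thesis using eventually_ge_at_top[of T] by (rule eventually_mono[rotated])
qed

text \<open>Gives infinitude without a proof that the \<open>f k\<close> are distinct: on a finite
  set the positive function \<open>g\<close> would have a positive minimum, which the values
  \<open>g (f k)\<close> undercut.\<close>

lemma infinite_if_frequently_small:
  fixes g :: "'a \<Rightarrow> real"
  assumes fr: "\<exists>\<^sub>F k in F. f k \<in> S" and pos: "\<And>x. x \<in> S \<Longrightarrow> g x > 0"
    and lim: "((\<lambda>k. g (f k)) \<longlongrightarrow> 0) F"
  shows "infinite S"
proof
  assume S: "finite S"
  have ne: "S \<noteq> {}" using fr by (auto simp: frequently_def)
  define \<delta> where "\<delta> = Min (g ` S)"
  have "\<delta> > 0" using S ne pos by (simp add: \<delta>_def)
  with lim have "\<forall>\<^sub>F k in F. g (f k) < \<delta>" by (rule order_tendstoD)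
  from frequently_eventually_frequently[OF fr this] obtain k where "f k \<in> S" "g (f k) < \<delta>"
    by (auto dest: frequently_ex)
  moreover have "\<delta> \<le> g (f k)" unfolding \<delta>_def using S \<open>f k \<in> S\<close> by (intro Min_le) auto
  ultimately show False by linarith
qed

text \<open>The cutoff \<open>c\<close> restricts the check of membership to positive
  \<open>w\<close>, or to \<open>w > 1\<close>, where \<open>x powr (- w)\<close> is decreasing in
  \<open>x\<close>.\<close>

lemma le_Sup_ereal_image:
  fixes x :: ereal
  assumes c: "ereal c < x" and S: "\<And>w. c < w \<Longrightarrow> ereal w < x \<Longrightarrow> w \<in> S"
  shows "x \<le> Sup (ereal ` S)"
proof (rule ccontr)
  assume "\<not> ?thesis"
  hence "max (Sup (ereal ` S)) (ereal c) < x" using c by simp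
  then obtain w where w: "max (Sup (ereal ` S)) (ereal c) < ereal w" "ereal w < x"
    using ereal_dense2 by blast
  hence "w \<in> S" using S by simp
  hence "ereal w \<le> Sup (ereal ` S)" by (intro Sup_upper) auto
  thus False using w by (simp add: not_less[symmetric])
qed

lemma Max_1_2_le_iff: "(MAX m\<in>{1..2::nat}. f m) \<le> (e :: real) \<longleftrightarrow> f 1 \<le> e \<and> f 2 \<le> e"
proof -
  have "{1..2::nat} = {1, 2}" by auto
  thus ?thesis by simp
qed

section \<open>Matrices of the Sturmian words\<close>

locale sturm =
  fixes a b :: nat and s :: "nat \<Rightarrow> nat"
  assumes a_pos: "a > 0" and b_pos: "b > 0" and a_neq_b: "a \<noteq> b"
    and s_pos: "\<And>k. k \<ge> 1 \<Longrightarrow> s k \<ge> 1"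
begin

abbreviation m where "m \<equiv> sturm_m a b s"

abbreviation \<xi> where "\<xi> \<equiv> sturm_xi a b s"

definition M :: "nat \<Rightarrow> mat2" where "M k = word_mat (m k)"

text \<open>\<open>Einv k\<close> is the inverse of the matrix of \<open>ab\<close> for even \<open>k\<close> and of \<open>ba\<close> for odd \<open>k\<close>;
  these are the last two letters of \<open>m k\<close> if \<open>k \<ge> 2\<close>. So \<open>Pal k\<close> is the matrix of \<open>m k\<close> without its
  last two letters, which is a palindrome.\<close>

definition Einv :: "nat \<Rightarrow> mat2" where
  "Einv k = (if even k then Mat2 1 (- int a) (- int b) (int a * int b + 1)
             else Mat2 1 (- int b) (- int a) (int a * int b + 1))"

definition Pal :: "nat \<Rightarrow> mat2" where "Pal k = M k * Einv k"

lemma M_Suc_Suc: "M (Suc (Suc k)) = M (Suc k) ^ s (Suc (Suc k)) * M k"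
  by (simp add: M_def)

lemma Einv_Suc_Suc [simp]: "Einv (Suc (Suc k)) = Einv k"
  by (simp add: Einv_def)

lemma Pal_Suc_Suc: "Pal (Suc (Suc k)) = M (Suc k) ^ s (Suc (Suc k)) * Pal k"
  by (simp add: Pal_def M_Suc_Suc mult.assoc)

lemma mdet_M: "\<bar>mdet (M k)\<bar> = 1"
  by (simp add: M_def mdet_word_mat)

lemma mdet_Einv [simp]: "mdet (Einv k) = 1"
  by (simp add: Einv_def mdet_def)

lemma mdet_Pal: "\<bar>mdet (Pal k)\<bar> = 1"
  by (simp add: Pal_def mdet_mult abs_mult mdet_M)

lemma M_0: "M 0 = letter_mat b"
  by (simp add: M_def)

lemma M_1: "M (Suc 0) = letter_mat b ^ (s 1 - 1) * letter_mat a"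
  by (simp add: M_def)

text \<open>The concatenations of \<open>m (k+1)\<close> and \<open>m k\<close> in the two orders
  differ only in that their last two letters, \<open>a\<close> and \<open>b\<close>, are exchanged.
  Deleting these letters leaves the same word.\<close>

lemma M_Suc_Pal: "M (Suc k) * Pal k = M k * Pal (Suc k)"
proof (induction k)
  case 0
  have "letter_mat a * (letter_mat b * Einv 0) = 1" "letter_mat b * (letter_mat a * Einv (Suc 0)) = 1"
    by (simp_all add: times_mat2_def one_mat2_def Einv_def)
  moreover have "M 0 * Pal (Suc 0) =
      letter_mat b ^ (s 1 - 1) * (letter_mat b * (letter_mat a * Einv (Suc 0)))"
    by (simp add: Pal_def M_0 M_1 power_commutes flip: mult.assoc)
  ultimately show ?case by (simp add: Pal_def M_0 M_1 mult.assoc)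
next
  case (Suc k)
  have "M (Suc (Suc k)) * Pal (Suc k) = M (Suc k) ^ s (Suc (Suc k)) * (M k * Pal (Suc k))"
    by (simp add: M_Suc_Suc mult.assoc)
  also have "\<dots> = M (Suc k) ^ s (Suc (Suc k)) * M (Suc k) * Pal k"
    by (simp add: Suc.IH[symmetric] mult.assoc)
  also have "\<dots> = M (Suc k) * Pal (Suc (Suc k))"
    by (simp add: Pal_Suc_Suc power_commutes mult.assoc flip: mult.assoc)
  finally show ?case .
qed

text \<open>The three claims carry each other through the induction. \<open>msym_power_mult\<close>
  makes all \<open>M (k+1) ^ n * Pal k\<close> symmetric; the exponent \<open>n = s (k+2)\<close>
  gives \<open>Pal (k+2)\<close>, and one more factor gives \<open>M (k+2) * Pal (k+1)\<close> by
  \<open>M_Suc_Pal\<close>.\<close>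

lemma msym_Pal_aux: "msym (Pal k) \<and> msym (Pal (Suc k)) \<and> msym (M (Suc k) * Pal k)"
proof (induction k)
  case 0
  have ab: "letter_mat a * (letter_mat b * Einv 0) = 1"
    by (simp add: times_mat2_def one_mat2_def Einv_def)
  have "M (Suc 0) * Pal 0 = letter_mat b ^ (s 1 - 1) * 1"
    by (simp add: Pal_def M_0 M_1 mult.assoc ab)
  moreover have "msym (letter_mat b ^ (s 1 - 1) * 1)"
    by (rule msym_power_mult) (auto simp: msym_def)
  moreover have "Pal (Suc 0) = letter_mat b ^ (s 1 - 1) * (letter_mat a * Einv (Suc 0))"
    by (simp add: Pal_def M_1 mult.assoc)
  moreover have "msym (letter_mat b ^ (s 1 - 1) * (letter_mat a * Einv (Suc 0)))"
    by (rule msym_power_mult) (auto simp: msym_def Einv_def)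
  moreover have "msym (Pal 0)" by (simp add: Pal_def M_0 msym_def Einv_def)
  ultimately show ?case by metis
next
  case (Suc k)
  have "msym (M (Suc k) ^ n * Pal k)" for n using Suc by (intro msym_power_mult) auto
  from this[of "s (Suc (Suc k))"] this[of "Suc (s (Suc (Suc k)))"] Suc show ?case
    by (simp add: M_Suc_Pal[of "Suc k"] Pal_Suc_Suc mult.assoc)
qed

lemma msym_Pal: "msym (Pal k)" using msym_Pal_aux by blast

lemma msym_M_power_Pal: "msym (M (Suc k) ^ n * Pal k)"
  using msym_Pal_aux by (intro msym_power_mult) blast+

text \<open>\<open>E\<close> is the matrix of the two deleted letters, so \<open>M k * Pal k\<close>
  is \<open>Pal k * E * Pal k\<close>, whose asymmetry is \<open>mdet (Pal k)\<close> times that of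
  \<open>E\<close>. As \<open>a \<noteq> b\<close>, this is the nonzero pairing behind all linear
  independence below.\<close>

lemma pairing_Pal_same: "\<bar>pairing (Pal k) (fix_poly (M k))\<bar> = \<bar>int a - int b\<bar>"
proof -
  define E where "E = (if even k then Mat2 (int a * int b + 1) (int a) (int b) 1
                       else Mat2 (int a * int b + 1) (int b) (int a) 1)"
  have "Einv k * E = 1" by (simp add: E_def Einv_def times_mat2_def one_mat2_def algebra_simps)
  hence "M k = Pal k * E" by (simp add: Pal_def mult.assoc)
  hence "pairing (Pal k) (fix_poly (M k)) = m01 (Pal k * E * Pal k) - m10 (Pal k * E * Pal k)"
    by (simp add: pairing_fix_poly msym_Pal del: mat2_sel_mult)
  also have "\<dots> = mdet (Pal k) * (m01 E - m10 E)"
    using msym_Pal[of k] by (simp add: msym_def mdet_def algebra_simps)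
  finally show ?thesis by (auto simp: abs_mult mdet_Pal E_def)
qed

lemma m_letters: "set (m k) \<subseteq> {a, b}"
proof (induction k rule: less_induct)
  case (less k)
  show ?case
  proof (cases k)
    case (Suc j)
    thus ?thesis using less.IH[of "j - 1"] less.IH[of j] by (cases j) (auto split: if_splits)
  qed simp
qed

section \<open>The Sturmian number and the points near it\<close>

lemma sturm_word_letters: "sturm_word a b s i \<in> {a, b}"
proof -
  have "i < length (m (Suc (Suc i)))" using length_sturm_m[of s "Suc i" a b] s_pos by fastforce
  from sturm_word_nth[of s i a b, OF s_pos this] nth_mem[OF this] m_letters[of "Suc (Suc i)"]
  show ?thesis by (auto simp del: sturm_m.simps)
qed

sublocale cfrac_seq "sturm_word a b s"
proof
  show "0 < sturm_word a b s i" for i using sturm_word_letters[of i] a_pos b_pos by auto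
qed

lemma cf_num_eq: "cf_num = \<xi>" by (simp add: sturm_xi_def)

text \<open>The index starts at 1: for \<open>s 1 = 1\<close> the word \<open>m 1 = [a]\<close> does
  not begin with \<open>m 0 = [b]\<close>. Many of the index shifts below have this origin.\<close>

lemma is_pref_m: "is_pref (m (Suc k))"
  unfolding is_pref_def by (rule nth_equalityI) (auto simp: sturm_word_nth[OF s_pos] simp del: sturm_m.simps)

lemma mat_dominant_M: "mat_dominant (M k)"
  unfolding M_def using sturm_m_neq_Nil m_letters[of k] a_pos b_pos
  by (intro mat_dominant_word_mat) auto

definition Q :: "nat \<Rightarrow> real" where "Q k = m00 (M k)"

text \<open>What the estimates use of the matrix of a nonempty prefix. The columns of that matrix
  are two consecutive convergents to \<open>\<xi>\<close>, with the denominator above the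
  numerator.\<close>

definition approx_mat :: "mat2 \<Rightarrow> bool" where
  "approx_mat W \<longleftrightarrow> mat_dominant W \<and>
     \<bar>\<xi> * m00 W - m10 W\<bar> \<le> 1 / m00 W \<and> \<bar>\<xi> * m01 W - m11 W\<bar> \<le> 1 / m00 W"

lemma approx_mat_pref: "is_pref w \<Longrightarrow> w \<noteq> [] \<Longrightarrow> approx_mat (word_mat w)"
  unfolding approx_mat_def
  using cf_num_approx[of w] mat_dominant_word_mat[of w] is_pref_pos[of w] by (simp add: cf_num_eq)

lemma approx_mat_M: "approx_mat (M (Suc k))"
  unfolding M_def by (intro approx_mat_pref is_pref_m sturm_m_neq_Nil)

text \<open>For \<open>i\<close> below the exponent \<open>s (k+3)\<close>, the next factor
  \<open>m (k+2)\<close> of \<open>m (k+3)\<close> starts with \<open>m (k+1)\<close>; for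
  \<open>i\<close> equal to the exponent, the word is \<open>m (k+3)\<close> itself.\<close>

lemma approx_mat_power:
  assumes i: "i \<le> s (Suc (Suc (Suc k)))"
  shows "approx_mat (M (Suc (Suc k)) ^ i * M (Suc k))"
proof -
  let ?n = "s (Suc (Suc (Suc k)))"
  let ?w = "concat (replicate i (m (Suc (Suc k)))) @ m (Suc k)"
  have "\<exists>v. m (Suc (Suc (Suc k))) = ?w @ v"
  proof (cases "i = ?n")
    case True
    thus ?thesis by (subst sturm_m.simps(3)) simp
  next
    case False
    then obtain d where d: "?n = i + Suc d" using i less_iff_Suc_add[of i ?n] by auto
    obtain v where v: "m (Suc (Suc k)) = m (Suc k) @ v"
      using sturm_m_prefix_Suc[of s a b k, OF s_pos] by blast
    have "m (Suc (Suc (Suc k))) = concat (replicate i (m (Suc (Suc k)))) @ m (Suc (Suc k)) @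
        concat (replicate d (m (Suc (Suc k)))) @ m (Suc k)"
      by (subst sturm_m.simps(3))
        (simp only: d replicate_add concat_append replicate_Suc concat.simps append_assoc)
    also have "\<dots> = ?w @ v @ concat (replicate d (m (Suc (Suc k)))) @ m (Suc k)"
      by (subst (2) v) (simp del: sturm_m.simps)
    finally show ?thesis by blast
  qed
  hence "is_pref ?w" using is_pref_m[of "Suc (Suc k)"] is_pref_appendD by metis
  moreover have "?w \<noteq> []" using sturm_m_neq_Nil by (simp del: sturm_m.simps)
  ultimately have "approx_mat (word_mat ?w)" by (rule approx_mat_pref)
  thus ?thesis by (simp add: M_def del: sturm_m.simps)
qed

text \<open>One generous constant: it absorbs the deletion of two letters, the bound on the partial
  quotients and the comparison of \<open>m00\<close> with \<open>m01\<close>.\<close>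

definition C :: real where "C = 2 * (real a + 1) * (real b + 1)"

lemma C_ge: "C \<ge> 8"
proof -
  have "2 * 2 \<le> (real a + 1) * (real b + 1)" using a_pos b_pos by (intro mult_mono) auto
  thus ?thesis unfolding C_def by linarith
qed

lemma xi_bounds: "0 < \<xi>" "\<xi> \<le> 1"
  using cf_num_bounds by (simp_all add: cf_num_eq)

text \<open>The columns of \<open>Y\<close> are bounded integer combinations of those of
  \<open>W\<close>, so both are close to multiples of \<open>(1, \<xi>)\<close>. Symmetry links
  them: the lower entry of the first column is the upper entry of the second, which puts
  \<open>m11 Y\<close> near \<open>m00 Y * \<xi>\<^sup>2\<close>.\<close>

lemma approx_point:
  assumes W: "approx_mat W" and Y: "Y = W * Einv k" "msym Y"
  shows "\<bar>m00 Y * \<xi> - m01 Y\<bar> \<le> C / m00 W" "\<bar>m00 Y * \<xi>\<^sup>2 - m11 Y\<bar> \<le> C / m00 W"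
    "\<bar>real_of_int (m00 Y)\<bar> \<le> C * m00 W" "C \<le> m00 W \<Longrightarrow> m00 W \<le> C * m00 Y"
proof -
  \<comment> \<open>\<open>C\<close> is symmetric in the two letters, so both parities of
    \<open>k\<close> are treated at once.\<close>
  obtain c d :: nat where cd: "(c = a \<and> d = b) \<or> (c = b \<and> d = a)"
    "Einv k = Mat2 1 (- int c) (- int d) (int c * int d + 1)"
    unfolding Einv_def by (cases "even k") (auto simp: mult.commute)
  have cd0: "c \<ge> 1" "d \<ge> 1" using cd a_pos b_pos by auto
  have Ccd: "C = 2 * (real c + 1) * (real d + 1)" using cd(1) by (elim disjE conjE) (simp_all only: C_def mult_ac)
  have dom: "mat_dominant W" using W by (simp add: approx_mat_def)
  define q where "q = real_of_int (m00 W)"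
  have q: "1 \<le> q" using mat_dominant_pos[OF dom] by (simp add: q_def)
  define e0 e1 where "e0 = \<xi> * m00 W - m10 W" and "e1 = \<xi> * m01 W - m11 W"
  have e: "\<bar>e0\<bar> \<le> 1 / q" "\<bar>e1\<bar> \<le> 1 / q" using W by (auto simp: approx_mat_def e0_def e1_def q_def)
  have sy: "m01 Y = m10 Y" using Y by (simp add: msym_def)
  have Y0: "m00 Y = m00 W - m01 W * int d" "m10 Y = m10 W - m11 W * int d"
    "m01 Y = - m00 W * int c + m01 W * (int c * int d + 1)"
    "m11 Y = - m10 W * int c + m11 W * (int c * int d + 1)"
    unfolding Y(1) by (simp_all add: cd)
  have f0: "m00 Y * \<xi> - m01 Y = e0 - d * e1"
    unfolding sy unfolding Y0 e0_def e1_def by (simp add: algebra_simps)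
  have f1: "m01 Y * \<xi> - m11 Y = - c * e0 + (real c * real d + 1) * e1"
    unfolding Y0 e0_def e1_def by (simp add: algebra_simps)
  have de: "\<bar>d * e1\<bar> \<le> d * (1 / q)" "\<bar>c * e0\<bar> \<le> c * (1 / q)"
    "\<bar>(real c * real d + 1) * e1\<bar> \<le> (real c * real d + 1) * (1 / q)"
  proof -
    have "\<bar>r * t\<bar> \<le> r * (1 / q)" if "\<bar>t\<bar> \<le> 1 / q" "0 \<le> r" for r t :: real
      unfolding abs_mult abs_of_nonneg[OF that(2)] by (rule mult_left_mono[OF that])
    from this[OF e(2), of "real d"] this[OF e(1), of "real c"] this[OF e(2), of "real c * real d + 1"]
    show "\<bar>d * e1\<bar> \<le> d * (1 / q)" "\<bar>c * e0\<bar> \<le> c * (1 / q)"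
      "\<bar>(real c * real d + 1) * e1\<bar> \<le> (real c * real d + 1) * (1 / q)"
      by (simp_all only: of_nat_0_le_iff add_nonneg_nonneg mult_nonneg_nonneg zero_le_one)
  qed
  have g0: "\<bar>m00 Y * \<xi> - m01 Y\<bar> \<le> (1 + d) * (1 / q)"
    unfolding f0 using de e by (simp add: algebra_simps)
  have g1: "\<bar>m01 Y * \<xi> - m11 Y\<bar> \<le> (c + (real c * real d + 1)) * (1 / q)"
    unfolding f1 using de e unfolding distrib_right by linarith
  have "(1 + d) * (1 / q) \<le> C * (1 / q)"
    using q unfolding Ccd by (intro mult_right_mono) (auto simp: algebra_simps)
  thus "\<bar>m00 Y * \<xi> - m01 Y\<bar> \<le> C / m00 W" using g0 by (simp add: q_def)
  have "m00 Y * \<xi>\<^sup>2 - m11 Y = \<xi> * (m00 Y * \<xi> - m01 Y) + (m01 Y * \<xi> - m11 Y)"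
    by (simp add: algebra_simps power2_eq_square)
  also have "\<bar>\<dots>\<bar> \<le> \<bar>\<xi>\<bar> * \<bar>m00 Y * \<xi> - m01 Y\<bar> + \<bar>m01 Y * \<xi> - m11 Y\<bar>"
    by (metis abs_mult abs_triangle_ineq)
  also have "\<dots> \<le> 1 * ((1 + d) * (1 / q)) + (c + (real c * real d + 1)) * (1 / q)"
    using g0 g1 xi_bounds by (intro add_mono mult_mono) auto
  also have "\<dots> = (c + d + real c * real d + 2) * (1 / q)" by (simp add: algebra_simps)
  also have "\<dots> \<le> C * (1 / q)"
    using q unfolding Ccd by (intro mult_right_mono) (auto simp: algebra_simps)
  finally show "\<bar>m00 Y * \<xi>\<^sup>2 - m11 Y\<bar> \<le> C / m00 W" by (simp add: q_def)
  have W01: "0 \<le> real_of_int (m01 W)" "real_of_int (m01 W) \<le> q"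
    using dom by (auto simp: mat_dominant_def q_def)
  have wd: "m01 W * real d \<le> q * d" "0 \<le> m01 W * real d"
    using W01 by (auto intro!: mult_right_mono)
  have "\<bar>real_of_int (m00 Y)\<bar> = \<bar>q - m01 W * real d\<bar>" by (simp add: Y0 q_def)
  also have "\<dots> \<le> q + q * d" using wd q by linarith
  also have "\<dots> = (1 + real d) * q" by (simp add: algebra_simps)
  also have "\<dots> \<le> C * q" using q unfolding Ccd by (intro mult_right_mono) (auto simp: algebra_simps)
  finally show "\<bar>real_of_int (m00 Y)\<bar> \<le> C * m00 W" by (simp add: q_def)
  show "m00 W \<le> C * m00 Y" if "C \<le> m00 W"
  proof -
    \<comment> \<open>Appending the two deleted letters recovers \<open>W\<close> from
      \<open>Y\<close>. Since \<open>m01 Y\<close> is near \<open>\<xi> * m00 Y\<close>, this bounds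
      \<open>m00 W\<close> by a constant times \<open>m00 Y\<close>.\<close>
    have "m00 W = (int c * int d + 1) * m00 Y + int d * m01 Y"
      unfolding Y0 by (simp add: algebra_simps)
    hence "real_of_int (m00 W) = real_of_int ((int c * int d + 1) * m00 Y + int d * m01 Y)"
      by (rule arg_cong)
    hence "q = (real c * real d + 1) * m00 Y + d * m01 Y" by (simp add: q_def)
    also have "\<dots> = (real c * real d + 1 + d * \<xi>) * m00 Y - d * (m00 Y * \<xi> - m01 Y)"
      by (simp add: algebra_simps)
    finally have eq: "(real c * real d + 1 + d * \<xi>) * m00 Y = q + d * (m00 Y * \<xi> - m01 Y)" by simp
    have "\<bar>d * (m00 Y * \<xi> - m01 Y)\<bar> \<le> d * ((1 + d) * (1 / q))"
      unfolding abs_mult using g0 by (intro mult_mono) auto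
    also have "\<dots> \<le> q / 2"
    proof -
      have "0 \<le> 2 * (1 + real d) * real c" by simp
      hence "2 * (1 + real d) \<le> C" by (simp add: Ccd algebra_simps)
      hence "2 * (1 + real d) \<le> q" unfolding q_def by (rule order_trans[OF _ that])
      hence qd: "1 + real d \<le> q / 2" by simp
      hence "real d * (1 + real d) \<le> q * (q / 2)" using q by (intro mult_mono) linarith+
      thus ?thesis using q by (simp add: field_simps)
    qed
    finally have h: "q / 2 \<le> (real c * real d + 1 + d * \<xi>) * m00 Y" using eq by linarith
    have pos: "0 < real c * real d + 1 + d * \<xi>" using xi_bounds
      by (intro add_pos_nonneg[OF add_nonneg_pos] mult_nonneg_nonneg) auto
    have "0 < (real c * real d + 1 + d * \<xi>) * m00 Y" using h q by linarith
    hence y0: "0 < real_of_int (m00 Y)" using pos zero_less_mult_pos by blast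
    have "d * \<xi> \<le> d" using xi_bounds by (simp add: mult_left_le)
    hence "2 * (real c * real d + 1 + d * \<xi>) \<le> C" unfolding Ccd by (simp add: algebra_simps)
    hence "2 * (real c * real d + 1 + d * \<xi>) * m00 Y \<le> C * m00 Y"
      using y0 by (intro mult_right_mono) auto
    moreover have "q \<le> 2 * (real c * real d + 1 + d * \<xi>) * m00 Y"
      using h unfolding mult.assoc[of 2] by linarith
    ultimately show ?thesis by (simp add: q_def)
  qed
qed

section \<open>Diophantine estimates\<close>

lemma Q_ge_1: "1 \<le> Q k"
  using mat_dominant_pos[OF mat_dominant_M[of k]] by (simp add: Q_def)

lemma Q_pos: "0 < Q k"
  using Q_ge_1[of k] by linarith

lemma Q_rec_lower: "Q (Suc k) ^ s (Suc (Suc k)) * Q k \<le> Q (Suc (Suc k))"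
  using m00_power_mult_bounds(2)[OF mat_dominant_M[of "Suc k"] mat_dominant_M[of k], of "s (Suc (Suc k))"]
  unfolding Q_def M_Suc_Suc of_int_power[symmetric] of_int_mult[symmetric] by linarith

lemma Q_rec_upper: "Q (Suc (Suc k)) \<le> 2 ^ s (Suc (Suc k)) * Q (Suc k) ^ s (Suc (Suc k)) * Q k"
proof -
  have "real_of_int (m00 (M (Suc (Suc k)))) \<le>
     real_of_int (2 ^ s (Suc (Suc k)) * m00 (M (Suc k)) ^ s (Suc (Suc k)) * m00 (M k))"
    using m00_power_mult_bounds(3)[OF mat_dominant_M[of "Suc k"] mat_dominant_M[of k], of "s (Suc (Suc k))"]
    unfolding M_Suc_Suc by linarith
  thus ?thesis by (simp add: Q_def)
qed

lemma Q_mult_le: "Q (Suc k) * Q k \<le> Q (Suc (Suc k))"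
proof -
  have "Q (Suc k) ^ 1 \<le> Q (Suc k) ^ s (Suc (Suc k))"
    using s_pos[of "Suc (Suc k)"] Q_ge_1 by (intro power_increasing) auto
  hence "Q (Suc k) * Q k \<le> Q (Suc k) ^ s (Suc (Suc k)) * Q k"
    using Q_pos[of k] by (intro mult_right_mono) auto
  thus ?thesis using Q_rec_lower[of k] by linarith
qed

lemma Q_Suc_le: "Q (Suc k) \<le> Q (Suc (Suc k))"
proof -
  have "Q (Suc k) * 1 \<le> Q (Suc k) * Q k" using Q_ge_1 Q_pos[of "Suc k"] by (intro mult_left_mono) auto
  thus ?thesis using Q_mult_le[of k] by linarith
qed

lemma Q_at_top: "filterlim Q at_top sequentially"
proof -
  have "real k / 2 - 1 \<le> Q k" for k
  proof (cases k)
    case (Suc j)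
    have "int j \<le> 2 * m00 (M k)"
      using m00_word_mat_ge[of "m k"] length_sturm_m[of s j a b, OF s_pos] m_letters[of k] a_pos b_pos
      unfolding M_def Suc by fastforce
    hence "real j \<le> 2 * real_of_int (m00 (M k))" by linarith
    thus ?thesis by (simp add: Q_def Suc)
  qed (use Q_ge_1[of 0] in simp)
  hence "Z \<le> Q k" if "k \<ge> nat \<lceil>2 * Z + 2\<rceil>" for Z k
    using that real_nat_ceiling_ge[of "2 * Z + 2"] by (smt (verit) field_sum_of_halves of_nat_mono)
  thus ?thesis unfolding filterlim_at_top eventually_sequentially by blast
qed

lemma abs_coeff_fix_poly_M: "\<bar>real_of_int (coeff (fix_poly (M k)) i)\<bar> \<le> Q k"
proof -
  have "\<bar>coeff (fix_poly (M k)) i\<bar> \<le> m00 (M k)"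
    using mat_dominant_M[of k]
    by (auto simp: fix_poly_def mat_dominant_def coeff_pCons split: nat.split)
  thus ?thesis by (simp add: Q_def flip: of_int_abs)
qed

lemma m00_M_mult:
  "Q j * Q k \<le> m00 (M j * M k)" "m00 (M j * M k) \<le> 2 * Q j * Q k"
proof -
  note m00_mult_bounds[OF mat_dominant_M[of j] mat_dominant_M[of k]]
  hence "real_of_int (m00 (M j) * m00 (M k)) \<le> m00 (M j * M k)"
    "real_of_int (m00 (M j * M k)) \<le> real_of_int (2 * m00 (M j) * m00 (M k))"
    by (simp_all only: of_int_le_iff)
  thus "Q j * Q k \<le> m00 (M j * M k)" "m00 (M j * M k) \<le> 2 * Q j * Q k" by (simp_all add: Q_def)
qed

lemma M_Pal_eq_power:
  "M (Suc k) * Pal (Suc (Suc k)) = M (Suc k) ^ Suc (s (Suc (Suc k))) * Pal k"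
  by (simp add: Pal_Suc_Suc mult.assoc)

text \<open>\<open>M (k+2) * Pal (k+1)\<close> is a power of \<open>M (k+1)\<close> times
  \<open>Pal k\<close>, so one more factor \<open>M (k+1)\<close> leaves it symmetric. Its large
  size, about \<open>Q (k+2) * Q (k+1)\<close>, is what makes the polynomial small at
  \<open>\<xi>\<close>.\<close>

lemma pairing_M_Pal_left: "pairing (M (Suc (Suc k)) * Pal (Suc k)) (fix_poly (M (Suc k))) = 0"
proof (rule pairing_fix_poly_eq_0)
  have eq: "M (Suc (Suc k)) * Pal (Suc k) = M (Suc k) ^ Suc (s (Suc (Suc k))) * Pal k"
    by (simp only: M_Suc_Pal M_Pal_eq_power)
  show "msym (M (Suc (Suc k)) * Pal (Suc k))" unfolding eq by (rule msym_M_power_Pal)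
  show "msym (M (Suc k) * (M (Suc (Suc k)) * Pal (Suc k)))"
    using msym_M_power_Pal[of k "Suc (Suc (s (Suc (Suc k))))"] unfolding eq by (simp add: mult.assoc)
qed

lemma msym_M_Pal: "msym (M (Suc k) * Pal k)"
  using msym_M_power_Pal[of k 1] by simp

lemma msym_M2_Pal: "msym (M (Suc k) * (M (Suc k) * Pal k))"
  using msym_M_power_Pal[of k 2] by (simp add: power2_eq_square mult.assoc)

lemma approx_point_M_Pal:
  fixes k
  defines "Y \<equiv> M (Suc (Suc k)) * Pal (Suc k)" and "W \<equiv> M (Suc (Suc k)) * M (Suc k)"
  shows "\<bar>m00 Y * \<xi> - m01 Y\<bar> \<le> C / m00 W" "\<bar>m00 Y * \<xi>\<^sup>2 - m11 Y\<bar> \<le> C / m00 W"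
    "\<bar>real_of_int (m00 Y)\<bar> \<le> C * m00 W" "C \<le> m00 W \<Longrightarrow> m00 W \<le> C * m00 Y"
proof -
  have "approx_mat W" using approx_mat_power[of 1 k] s_pos[of "Suc (Suc (Suc k))"]
    by (simp add: W_def)
  moreover have "Y = W * Einv (Suc k)" by (simp add: Y_def W_def Pal_def mult.assoc)
  moreover have "msym Y" unfolding Y_def by (rule msym_M_Pal)
  ultimately show "\<bar>m00 Y * \<xi> - m01 Y\<bar> \<le> C / m00 W" "\<bar>m00 Y * \<xi>\<^sup>2 - m11 Y\<bar> \<le> C / m00 W"
    "\<bar>real_of_int (m00 Y)\<bar> \<le> C * m00 W" "C \<le> m00 W \<Longrightarrow> m00 W \<le> C * m00 Y"
    by (rule approx_point)+
qed

text \<open>The polynomial pairs to 0 with a point of size about \<open>Q (k+1) * Q (k+2)\<close>,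
  so \<open>m00 Y\<close> times its value at \<open>\<xi>\<close> is pure approximation error, at
  most of order \<open>1 / Q (k+2)\<close>. Dividing by \<open>m00 Y\<close>, which the hypothesis
  makes comparable to \<open>m00 W\<close>, gives the bound.\<close>

lemma fix_poly_small:
  assumes k: "C \<le> Q (Suc k)"
  shows "\<bar>ipoly (fix_poly (M (Suc k))) \<xi>\<bar> \<le> 2 * C\<^sup>2 / (Q (Suc k) * (Q (Suc (Suc k)))\<^sup>2)"
proof -
  let ?P = "fix_poly (M (Suc k))"
  define Y where "Y = M (Suc (Suc k)) * Pal (Suc k)"
  define W where "W = M (Suc (Suc k)) * M (Suc k)"
  note Y = approx_point_M_Pal[of k, folded Y_def W_def]
  have w: "Q (Suc (Suc k)) * Q (Suc k) \<le> m00 W" unfolding W_def by (rule m00_M_mult)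
  have "1 * Q (Suc k) \<le> Q (Suc (Suc k)) * Q (Suc k)" using Q_ge_1 Q_pos[of "Suc k"]
    by (intro mult_right_mono) auto
  hence CW: "C \<le> m00 W" using k w by linarith
  have Cp: "0 < C" using C_ge by linarith
  have Wp: "0 < real_of_int (m00 W)" using CW Cp by linarith
  have Y0: "m00 W \<le> C * m00 Y" by (rule Y(4)[OF CW])
  have "pairing Y ?P = 0" unfolding Y_def by (rule pairing_M_Pal_left)
  with pairing_approx[OF degree_fix_poly abs_coeff_fix_poly_M Y(1,2), of "Suc k"]
  have *: "\<bar>m00 Y * ipoly ?P \<xi>\<bar> \<le> 2 * Q (Suc k) * (C / m00 W)" by simp
  have "m00 W * \<bar>ipoly ?P \<xi>\<bar> \<le> C * m00 Y * \<bar>ipoly ?P \<xi>\<bar>"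
    using Y0 by (intro mult_right_mono) auto
  also have "\<dots> \<le> C * \<bar>m00 Y * ipoly ?P \<xi>\<bar>"
    unfolding abs_mult mult.assoc using Cp by (intro mult_left_mono mult_right_mono) auto
  also have "\<dots> \<le> C * (2 * Q (Suc k) * (C / m00 W))" using * Cp by (intro mult_left_mono) auto
  finally have "\<bar>ipoly ?P \<xi>\<bar> \<le> 2 * C\<^sup>2 * Q (Suc k) / (m00 W)\<^sup>2"
    using Wp by (simp add: field_simps power2_eq_square)
  also have "\<dots> \<le> 2 * C\<^sup>2 * Q (Suc k) / (Q (Suc (Suc k)) * Q (Suc k))\<^sup>2"
    using w Q_pos[of "Suc k"] Q_pos[of "Suc (Suc k)"] Cp Wp
    by (intro divide_left_mono power_mono mult_pos_pos[OF zero_less_power zero_less_power]) auto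
  also have "\<dots> = 2 * C\<^sup>2 / (Q (Suc k) * (Q (Suc (Suc k)))\<^sup>2)"
    using Q_pos[of "Suc k"] Q_pos[of "Suc (Suc k)"] by (simp add: field_simps power2_eq_square)
  finally show ?thesis .
qed

text \<open>Three linearly independent points are too close to \<open>(1, \<xi>, \<xi>\<^sup>2)\<close> for \<open>p\<close> to be small at
  \<open>\<xi>\<close> without annihilating all of them.\<close>

lemma ipoly_lower_bound:
  assumes p: "degree p \<le> 2" "p \<noteq> 0" and H: "\<And>i. \<bar>real_of_int (coeff p i)\<bar> \<le> H"
    and HQ: "4 * C * H \<le> Q (Suc (Suc k))"
  shows "1 / (8 * C * (Q (Suc (Suc k)))\<^sup>2 * Q (Suc k)) \<le> \<bar>ipoly p \<xi>\<bar>"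
proof (rule ccontr)
  let ?K = "Suc (Suc k)"
  \<comment> \<open>The largest of the three points comes from a prefix with \<open>m00\<close> at
    most \<open>B\<close>, and \<open>2 * C * B\<close> is the denominator in the claim.\<close>
  define B where "B = 4 * (Q ?K)\<^sup>2 * Q (Suc k)"
  assume "\<not> ?thesis"
  hence small: "\<bar>ipoly p \<xi>\<bar> < 1 / (2 * C * B)" by (simp add: B_def)
  have Cp: "0 < C" using C_ge by linarith
  have Bp: "0 < B" using Q_pos[of ?K] Q_pos[of "Suc k"] by (simp add: B_def)
  have H0: "0 \<le> H" using H[of 0] by linarith
  \<comment> \<open>By \<open>HQ\<close> the point is so large against the height that the error is
    at most 1/2; by \<open>small\<close> it is small enough for the scaled value to stay below 1/2.
    An integer of absolute value below 1 is 0.\<close>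
  have zero: "pairing Y p = 0"
    if W: "approx_mat W" "Y = W * Einv j" "msym Y" and q: "Q ?K \<le> m00 W" "m00 W \<le> B" for W Y j
  proof -
    note e = approx_point[OF W]
    have "2 * H * (C / m00 W) \<le> 2 * H * (C / Q ?K)"
      using q Cp H0 Q_pos[of ?K] by (intro mult_left_mono divide_left_mono mult_pos_pos) auto
    also have "\<dots> \<le> 1 / 2" using HQ Q_pos[of ?K] by (simp add: field_simps)
    finally have 1: "\<bar>pairing Y p - m00 Y * ipoly p \<xi>\<bar> \<le> 1 / 2"
      using pairing_approx[OF p(1) H e(1,2)] by linarith
    have "\<bar>m00 Y * ipoly p \<xi>\<bar> \<le> C * B * \<bar>ipoly p \<xi>\<bar>"
      unfolding abs_mult using e(3) Cp
      by (intro mult_right_mono order_trans[OF e(3) mult_left_mono[OF q(2)]]) auto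
    also have "\<dots> < C * B * (1 / (2 * C * B))"
      using small Cp Bp by (intro mult_strict_left_mono) auto
    also have "\<dots> = 1 / 2" using Cp Bp by simp
    finally have "\<bar>real_of_int (pairing Y p)\<bar> < 1" using 1 by linarith
    thus ?thesis by linarith
  qed
  have q2: "Q ?K \<le> (Q ?K)\<^sup>2" using Q_ge_1[of ?K] by (simp add: power2_eq_square)
  have qB: "Q ?K * Q (Suc k) \<le> (Q ?K)\<^sup>2 * Q (Suc k)" "(Q ?K)\<^sup>2 \<le> (Q ?K)\<^sup>2 * Q (Suc k)"
    using mult_right_mono[OF q2, of "Q (Suc k)"] Q_pos[of "Suc k"]
      mult_left_mono[OF Q_ge_1[of "Suc k"], of "(Q ?K)\<^sup>2"] by simp_all
  have Z1: "pairing (Pal ?K) p = 0"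
  proof (rule zero[OF approx_mat_M, of _ "Suc k" ?K])
    show "real_of_int (m00 (M ?K)) \<le> B" 
      using q2 qB(2) Q_pos[of ?K] unfolding B_def Q_def[symmetric] mult.assoc by linarith
  qed (simp_all add: Pal_def msym_Pal[unfolded Pal_def, of ?K, simplified] Q_def del: mat2_sel_mult)
  have Z2: "pairing (M ?K * Pal (Suc k)) p = 0"
  proof (rule zero)
    show "approx_mat (M ?K * M (Suc k))"
      using approx_mat_power[of 1 k] s_pos[of "Suc ?K"] by simp
    show "M ?K * Pal (Suc k) = M ?K * M (Suc k) * Einv (Suc k)" by (simp add: Pal_def mult.assoc)
    show "msym (M ?K * Pal (Suc k))" by (rule msym_M_Pal)
    have "Q ?K * 1 \<le> Q ?K * Q (Suc k)" using Q_ge_1 Q_pos[of ?K] by (intro mult_left_mono) auto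
    thus "Q ?K \<le> m00 (M ?K * M (Suc k))" using m00_M_mult(1)[of ?K "Suc k"] by linarith
    show "m00 (M ?K * M (Suc k)) \<le> B" 
      using m00_M_mult(2)[of ?K "Suc k"] qB(1) mult_pos_pos[OF Q_pos[of ?K] Q_pos[of "Suc k"]]
      unfolding B_def mult.assoc by linarith
  qed
  \<comment> \<open>If \<open>s (?K + 1)\<close> is at least 2, two copies of \<open>m ?K\<close>
    followed by \<open>m (k+1)\<close> form a prefix. If it is 1, that word goes wrong in its last
    two letters, and the same point comes from the prefix \<open>m (?K + 1)\<close> followed by
    \<open>m ?K\<close>.\<close>
  have Z3: "pairing (M ?K * (M ?K * Pal (Suc k))) p = 0"
  proof (cases "s (Suc ?K) = 1")
    case True
    have eq: "M ?K * (M ?K * Pal (Suc k)) = M (Suc ?K) * Pal ?K"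
      using True by (simp only: M_Suc_Pal[of ?K] Pal_Suc_Suc[of "Suc k"]) simp
    have W: "M (Suc ?K) = M ?K * M (Suc k)" using True by (simp add: M_Suc_Suc[of "Suc k"])
    have Qb: "Q (Suc ?K) \<le> 2 * Q ?K * Q (Suc k)"
      using m00_M_mult(2)[of ?K "Suc k"] W by (simp only: Q_def)
    show ?thesis
    proof (rule zero)
      show "approx_mat (M (Suc ?K) * M ?K)"
        using approx_mat_power[of 1 "Suc k"] s_pos[of "Suc (Suc ?K)"] by simp
      show "M ?K * (M ?K * Pal (Suc k)) = M (Suc ?K) * M ?K * Einv ?K"
        unfolding eq unfolding Pal_def by (simp only: mult.assoc)
      show "msym (M ?K * (M ?K * Pal (Suc k)))" by (rule msym_M2_Pal)
      have "Q ?K \<le> Q (Suc ?K) * Q ?K" using Q_ge_1 Q_pos[of ?K] by simp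
      thus "Q ?K \<le> m00 (M (Suc ?K) * M ?K)" using m00_M_mult(1)[of "Suc ?K" ?K] by linarith
      have "2 * Q (Suc ?K) * Q ?K \<le> 2 * (2 * Q ?K * Q (Suc k)) * Q ?K"
        using Qb Q_pos[of ?K] by (intro mult_right_mono mult_left_mono) auto
      also have "\<dots> = B" by (simp add: B_def power2_eq_square)
      finally show "m00 (M (Suc ?K) * M ?K) \<le> B" using m00_M_mult(2)[of "Suc ?K" ?K] by linarith
    qed
  next
    case False
    show ?thesis
    proof (rule zero)
      show "approx_mat (M ?K ^ 2 * M (Suc k))"
        using approx_mat_power[of 2 k] s_pos[of "Suc ?K"] False by simp
      show "M ?K * (M ?K * Pal (Suc k)) = M ?K ^ 2 * M (Suc k) * Einv (Suc k)"
        by (simp add: power2_eq_square Pal_def mult.assoc)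
      show "msym (M ?K * (M ?K * Pal (Suc k)))" by (rule msym_M2_Pal)
      note b = m00_power_mult_bounds(2,3)[OF mat_dominant_M[of ?K] mat_dominant_M[of "Suc k"], of 2]
      have "real_of_int (m00 (M ?K) ^ 2 * m00 (M (Suc k))) \<le> m00 (M ?K ^ 2 * M (Suc k))"
        using b(1) by (simp only: of_int_le_iff)
      thus "Q ?K \<le> m00 (M ?K ^ 2 * M (Suc k))"
        using q2 qB unfolding of_int_mult of_int_power Q_def[symmetric] by linarith
      have "real_of_int (m00 (M ?K ^ 2 * M (Suc k))) \<le>
          real_of_int (2 ^ 2 * m00 (M ?K) ^ 2 * m00 (M (Suc k)))"
        using b(2) by (simp only: of_int_le_iff)
      thus "m00 (M ?K ^ 2 * M (Suc k)) \<le> B" by (simp add: B_def Q_def del: mat2_sel_mult)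
    qed
  qed
  have "p = 0"
  proof (rule pairing_nondegenerate[OF _ _ _ _ p(1) Z2 Z3 Z1])
    show "msym (M ?K * Pal (Suc k))" by (rule msym_M_Pal)
    show "msym (M ?K * (M ?K * Pal (Suc k)))" by (rule msym_M2_Pal)
    show "mdet (M ?K * Pal (Suc k)) \<noteq> 0"
      using mdet_M[of ?K] mdet_Pal[of "Suc k"] by (auto simp: mdet_mult)
    show "pairing (Pal ?K) (fix_poly (M ?K)) \<noteq> 0"
      using pairing_Pal_same[of ?K] a_neq_b by auto
  qed
  thus False using p by simp
qed

section \<open>Bad approximability and lower bounds for simultaneous approximation\<close>

lemma badly_approximable:
  fixes x0 x1 :: int
  assumes "x0 \<noteq> 0"
  shows "1 / (4 * C * \<bar>real_of_int x0\<bar>) \<le> \<bar>x0 * \<xi> - x1\<bar>"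
proof -
  have "sturm_word a b s i \<le> max a b" for i using sturm_word_letters[of i] by auto
  from cf_num_badly_approximable[OF this assms, of x1]
  have "1 / (4 * (real (max a b) + 1) * \<bar>real_of_int x0\<bar>) \<le> \<bar>x0 * \<xi> - x1\<bar>"
    by (simp add: cf_num_eq)
  moreover have "real (max a b) + 1 \<le> C"
    using a_pos b_pos by (auto simp: C_def algebra_simps max_def)
  hence "1 / (4 * C * \<bar>real_of_int x0\<bar>) \<le> 1 / (4 * (real (max a b) + 1) * \<bar>real_of_int x0\<bar>)"
    using assms by (intro divide_left_mono mult_right_mono mult_left_mono mult_pos_pos) auto
  ultimately show ?thesis by linarith
qed

text \<open>A better point would pair to 0 with the polynomials of \<open>M (k+1)\<close> and
  \<open>M (k+2)\<close>, hence be an integer multiple of the point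
  \<open>M (k+2) * Pal (k+1)\<close>. That point has size at most of order
  \<open>Q (k+2) * Q (k+1)\<close> and obeys the bad approximability of \<open>\<xi>\<close>;
  multiples of it are no better.\<close>

lemma simultaneous_lower_bound:
  fixes x0 x1 x2 :: int
  assumes k: "C \<le> Q (Suc k)" and x0: "x0 \<noteq> 0"
    and X: "\<bar>x0\<bar> \<le> (Q (Suc (Suc k)))\<^sup>2 * Q (Suc k) / (8 * C\<^sup>2)"
    and e: "\<bar>x0 * \<xi> - x1\<bar> \<le> e" "\<bar>x0 * \<xi>\<^sup>2 - x2\<bar> \<le> e"
  shows "1 / (8 * C\<^sup>2 * Q (Suc (Suc k)) * Q (Suc k)) \<le> e"
proof (rule ccontr)
  let ?K = "Suc (Suc k)"
  assume "\<not> ?thesis"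
  hence small: "e < 1 / (8 * C\<^sup>2 * Q ?K * Q (Suc k))" by simp
  have Cp: "0 < C" "1 \<le> C" using C_ge by auto
  have C2: "1 \<le> C\<^sup>2" using Cp by simp
  have e0: "0 \<le> e" using e by linarith
  define x where "x = Mat2 x0 x1 x1 x2"
  define Y where "Y = M ?K * Pal (Suc k)"
  \<comment> \<open>The error contributes less than 1/4 and the scaled value at most 1/4. The
    premises are chosen to fit both \<open>j = k+1\<close> and \<open>j = k+2\<close>.\<close>
  have zero: "pairing x (fix_poly (M j)) = 0"
    if j: "\<bar>ipoly (fix_poly (M j)) \<xi>\<bar> \<le> 2 * C\<^sup>2 / ((Q ?K)\<^sup>2 * Q (Suc k))" "Q j \<le> Q ?K * Q (Suc k)" for j
  proof -
    let ?P = "fix_poly (M j)"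
    have "2 * Q j * e \<le> 2 * (Q ?K * Q (Suc k)) * e" using j e0 by (intro mult_right_mono) auto
    also have "\<dots> < 2 * (Q ?K * Q (Suc k)) * (1 / (8 * C\<^sup>2 * Q ?K * Q (Suc k)))"
      using small Q_pos by (intro mult_strict_left_mono) auto
    also have "\<dots> = 1 / (4 * C\<^sup>2)" using Q_pos[of ?K] Q_pos[of "Suc k"] by (simp add: field_simps)
    also have "\<dots> \<le> 1 / 4" using C2 Cp by (intro divide_left_mono) auto
    finally have 1: "\<bar>pairing x ?P - x0 * ipoly ?P \<xi>\<bar> < 1 / 4"
      using pairing_approx[OF degree_fix_poly abs_coeff_fix_poly_M, of x \<xi> e j] e
      by (simp add: x_def)
    have "\<bar>x0 * ipoly ?P \<xi>\<bar> \<le>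
      ((Q ?K)\<^sup>2 * Q (Suc k) / (8 * C\<^sup>2)) * (2 * C\<^sup>2 / ((Q ?K)\<^sup>2 * Q (Suc k)))"
      unfolding abs_mult using X j Q_pos[of ?K] Q_pos[of "Suc k"] by (intro mult_mono) auto
    also have "\<dots> = 1 / 4" using Q_pos[of ?K] Q_pos[of "Suc k"] Cp by (simp add: field_simps)
    finally have "\<bar>real_of_int (pairing x ?P)\<bar> < 1" using 1 by linarith
    thus ?thesis by linarith
  qed
  have p1: "pairing x (fix_poly (M (Suc k))) = 0"
    using fix_poly_small[OF k] Q_ge_1[of ?K] Q_pos[of "Suc k"]
    by (intro zero) (auto simp: mult.commute)
  have p2: "pairing x (fix_poly (M ?K)) = 0"
  proof (rule zero)
    have "(Q ?K)\<^sup>2 * Q (Suc k) = (Q ?K * Q (Suc k)) * Q ?K" by (simp add: power2_eq_square)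
    also have "\<dots> \<le> Q (Suc ?K) * Q (Suc ?K)"
      using Q_mult_le[of "Suc k"] Q_Suc_le[of "Suc k"] Q_pos by (intro mult_mono) (auto intro: less_imp_le)
    also have "\<dots> \<le> Q ?K * (Q (Suc ?K))\<^sup>2"
      using Q_ge_1[of ?K] Q_pos[of "Suc ?K"] by (simp add: power2_eq_square)
    finally have "2 * C\<^sup>2 / (Q ?K * (Q (Suc ?K))\<^sup>2) \<le> 2 * C\<^sup>2 / ((Q ?K)\<^sup>2 * Q (Suc k))"
      using Cp by (intro divide_left_mono mult_pos_pos zero_less_power Q_pos) auto
    moreover have "C \<le> Q ?K" using k Q_Suc_le[of k] by linarith
    ultimately show "\<bar>ipoly (fix_poly (M ?K)) \<xi>\<bar> \<le> 2 * C\<^sup>2 / ((Q ?K)\<^sup>2 * Q (Suc k))"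
      using fix_poly_small[of "Suc k"] by linarith
    show "Q ?K \<le> Q ?K * Q (Suc k)" using Q_ge_1[of "Suc k"] Q_pos[of ?K] by simp
  qed
  have "\<exists>t. m00 x = t * m00 Y \<and> m01 x = t * m01 Y"
  proof (rule pairing_proportional[OF _ _ _ _ p1 p2])
    show "msym Y" unfolding Y_def by (rule msym_M_Pal)
    show "\<bar>mdet Y\<bar> = 1" by (simp add: Y_def mdet_mult abs_mult mdet_M mdet_Pal)
    show "pairing Y (fix_poly (M (Suc k))) = 0" unfolding Y_def by (rule pairing_M_Pal_left)
    show "pairing Y (fix_poly (M ?K)) = 0" unfolding Y_def
      by (rule pairing_fix_poly_eq_0[OF msym_M_Pal msym_M2_Pal])
    \<comment> \<open>\<open>Pal (k+1)\<close> separates the two polynomials: that of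
      \<open>M (k+2)\<close> annihilates it, that of \<open>M (k+1)\<close> does not.\<close>
    show "pairing (Pal (Suc k)) (fix_poly (M (Suc k))) \<noteq> 0"
      using pairing_Pal_same[of "Suc k"] a_neq_b by auto
    show "pairing (Pal (Suc k)) (fix_poly (M ?K)) = 0"
      by (rule pairing_fix_poly_eq_0[OF msym_Pal msym_M_Pal])
    show "coeff (fix_poly (M ?K)) 2 \<noteq> 0" using mat_dominant_M[of ?K] by (simp add: mat_dominant_def)
  qed
  then obtain t where t: "x0 = t * m00 Y" "x1 = t * m01 Y" by (auto simp: x_def)
  have t0: "t \<noteq> 0" "m00 Y \<noteq> 0" using t x0 by auto
  have "1 / (4 * C * (C * (2 * Q ?K * Q (Suc k)))) \<le> 1 / (4 * C * \<bar>real_of_int (m00 Y)\<bar>)"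
  proof (intro divide_left_mono mult_left_mono)
    have "C * m00 (M ?K * M (Suc k)) \<le> C * (2 * Q ?K * Q (Suc k))"
      using Cp m00_M_mult(2) by (intro mult_left_mono) auto
    thus "\<bar>real_of_int (m00 Y)\<bar> \<le> C * (2 * Q ?K * Q (Suc k))"
      using approx_point_M_Pal(3)[of k, folded Y_def] by linarith
  qed (use Cp t0 Q_pos in auto)
  also have "\<dots> \<le> \<bar>m00 Y * \<xi> - m01 Y\<bar>" by (rule badly_approximable[OF t0(2)])
  also have "\<dots> \<le> \<bar>real_of_int t\<bar> * \<bar>m00 Y * \<xi> - m01 Y\<bar>"
  proof -
    have "1 \<le> \<bar>real_of_int t\<bar>" using t0 by linarith
    from mult_right_mono[OF this] show ?thesis by simp
  qed
  also have "\<dots> = \<bar>x0 * \<xi> - x1\<bar>" by (simp add: t abs_mult[symmetric] algebra_simps)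
  also have "\<dots> \<le> e" by (rule e)
  finally show False using small by (simp add: power2_eq_square mult_ac)
qed

section \<open>Growth of the denominators\<close>

definition cf :: "nat \<Rightarrow> real" where "cf k = cfrac0 (rev (map s [1..<Suc k]))"

lemma cf_Suc: "cf (Suc k) = 1 / (s (Suc k) + cf k)"
  by (simp add: cf_def)

lemma cf_bounds: "0 \<le> cf k" "cf k \<le> 1"
proof -
  show "0 \<le> cf k" unfolding cf_def by (rule cfrac0_nonneg)
  show "cf k \<le> 1" unfolding cf_def by (rule cfrac0_le_1) (use s_pos in fastforce)
qed

definition L :: "nat \<Rightarrow> real" where "L k = ln (Q k)"

lemma L_nonneg: "0 \<le> L k"
  using Q_ge_1 by (simp add: L_def)

lemma L_rec_lower: "s (Suc (Suc k)) * L (Suc k) + L k \<le> L (Suc (Suc k))"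
proof -
  have "ln (Q (Suc k) ^ s (Suc (Suc k)) * Q k) \<le> L (Suc (Suc k))"
    unfolding L_def using Q_rec_lower[of k] Q_pos by (subst ln_le_cancel_iff) auto
  thus ?thesis using Q_pos[of k] Q_pos[of "Suc k"] by (simp add: L_def ln_mult ln_realpow)
qed

lemma L_rec_upper: "L (Suc (Suc k)) \<le> s (Suc (Suc k)) * (ln 2 + L (Suc k)) + L k"
proof -
  have "L (Suc (Suc k)) \<le> ln (2 ^ s (Suc (Suc k)) * Q (Suc k) ^ s (Suc (Suc k)) * Q k)"
    unfolding L_def using Q_rec_upper[of k] Q_pos by (subst ln_le_cancel_iff) auto
  thus ?thesis using Q_pos[of k] Q_pos[of "Suc k"]
    by (simp add: L_def ln_mult ln_realpow algebra_simps)
qed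

lemma L_add_le: "L (Suc k) + L k \<le> L (Suc (Suc k))"
proof -
  have "1 * L (Suc k) \<le> s (Suc (Suc k)) * L (Suc k)"
    using s_pos[of "Suc (Suc k)"] L_nonneg by (intro mult_right_mono) auto
  thus ?thesis using L_rec_lower[of k] by linarith
qed

lemma L_Suc_le: "L (Suc k) \<le> L (Suc (Suc k))"
  using L_add_le[of k] L_nonneg[of k] by linarith

lemma L_at_top: "filterlim L at_top sequentially"
  unfolding L_def by (rule filterlim_compose[OF ln_at_top Q_at_top])

lemma L_eventually_ge: "\<forall>\<^sub>F k in sequentially. B \<le> L k"
  using L_at_top by (auto simp: filterlim_at_top)

lemma Q_eventually_ge: "\<forall>\<^sub>F k in sequentially. B \<le> Q k"
  using Q_at_top by (auto simp: filterlim_at_top)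

text \<open>The indices start at 1 because \<open>Q 0 \<le> Q 1\<close> fails for
  \<open>s 1 = 1\<close> and \<open>a < b\<close>.\<close>

definition r :: "nat \<Rightarrow> real" where "r k = L (Suc k) / L (Suc (Suc k))"

lemma r_bounds: "0 \<le> r k" "r k \<le> 1"
  using L_nonneg L_Suc_le[of k] by (auto simp: r_def divide_le_eq_1 less_le)

text \<open>Both sequences follow \<open>x \<mapsto> 1 / (n + x)\<close> with
  \<open>n = s (k+3)\<close>, the sequence \<open>r\<close> only up to the powers of 2 lost in the
  recursion of \<open>Q\<close>. One step multiplies the distance by at most \<open>r (k+1)\<close>,
  which may be close to 1, but two steps multiply it by at most 1/2, up to vanishing errors.\<close>

lemma r_minus_cf_tendsto: "(\<lambda>k. \<bar>r k - cf (Suc (Suc k))\<bar>) \<longlonglongrightarrow> 0"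
proof -
  define d where "d k = \<bar>r k - cf (Suc (Suc k))\<bar>" for k
  define \<eta> where "\<eta> k = 2 * (ln 2 / L (Suc k))" for k
  have inv: "(\<lambda>k. ln 2 / L k) \<longlonglongrightarrow> 0"
    by (rule tendsto_divide_0[OF tendsto_const filterlim_at_top_imp_at_infinity[OF L_at_top]])
  have step: "d (Suc k) \<le> r (Suc k) * d k + ln 2 / L (Suc (Suc k))" if L: "L (Suc k) > 0" for k
  proof -
    let ?n = "real (s (Suc (Suc (Suc k))))"
    let ?L1 = "L (Suc k)" and ?L2 = "L (Suc (Suc k))" and ?L3 = "L (Suc (Suc (Suc k)))"
    let ?c = "cf (Suc (Suc k))" and ?c' = "cf (Suc (Suc (Suc k)))"
    have n1: "1 \<le> ?n" using s_pos[of "Suc (Suc (Suc k))"] by simp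
    have L2: "0 < ?L2" "0 < ?L3" using L L_Suc_le[of k] L_Suc_le[of "Suc k"] by linarith+
    have c: "0 \<le> ?c" "?c \<le> 1" "0 \<le> ?c'" "?c' \<le> 1" by (rule cf_bounds)+
    \<comment> \<open>\<open>e\<close> is the logarithm of the loss, at most \<open>ln 2\<close> for
      each of the \<open>?n\<close> factors; multiplication by \<open>?c' \<le> 1 / ?n\<close> makes
      its contribution independent of \<open>?n\<close>.\<close>
    define e where "e = ?L3 - (?n * ?L2 + ?L1)"
    have e: "0 \<le> e" "e \<le> ?n * ln 2"
      using L_rec_lower[of "Suc k"] L_rec_upper[of "Suc k"] by (auto simp: e_def algebra_simps)
    have c': "?c' = 1 / (?n + ?c)" by (rule cf_Suc)
    have nc: "0 < ?n + ?c" using n1 c by linarith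
    have "r (Suc k) - ?c' = ?c' * r (Suc k) * (?c - r k) - ?c' * e / ?L3"
    proof -
      have "?c' * r (Suc k) * (?c - r k) = ?c' / ?L3 * (?c * ?L2 - ?L1)"
        using L2 by (simp add: r_def field_simps)
      moreover have "r (Suc k) - ?c' = ?c' / ?L3 * (?c * ?L2 - ?L1 - e)"
        unfolding c' r_def e_def using nc L2 by (simp add: field_simps)
      ultimately show ?thesis by (simp only: right_diff_distrib[of _ _ e] times_divide_eq_left)
    qed
    hence "d (Suc k) \<le> \<bar>?c' * r (Suc k) * (?c - r k)\<bar> + \<bar>?c' * e / ?L3\<bar>"
      unfolding d_def by linarith
    also have "\<bar>?c' * r (Suc k) * (?c - r k)\<bar> \<le> 1 * (r (Suc k) * d k)"
      unfolding d_def abs_mult mult.assoc abs_minus_commute[of "r k"]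
      using c r_bounds[of "Suc k"] by (intro mult_mono) auto
    also have "\<bar>?c' * e / ?L3\<bar> \<le> ln 2 / ?L2"
    proof -
      have "?c' * e \<le> ?c' * (?n * ln 2)" using c e by (intro mult_left_mono) auto
      also have "\<dots> = (?c' * ?n) * ln 2" by simp
      also have "\<dots> \<le> 1 * ln 2" unfolding c' using nc c by (intro mult_right_mono) (auto simp: field_simps)
      finally have "?c' * e \<le> ln 2" by simp
      hence "?c' * e / ?L3 \<le> ln 2 / ?L2"
        using L2 L_Suc_le[of "Suc k"] by (intro frac_le) auto
      thus ?thesis using c e L2 by simp
    qed
    finally show ?thesis by simp
  qed
  have "d (Suc (Suc k)) \<le> d k / 2 + \<eta> (Suc k)" if L: "L (Suc k) > 0" for k
  proof -
    have Lp: "0 < L (Suc (Suc k))" "0 < L (Suc (Suc (Suc k)))" "0 < L (Suc (Suc (Suc (Suc k))))"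
      using L L_Suc_le[of k] L_Suc_le[of "Suc k"] L_Suc_le[of "Suc (Suc k)"] by linarith+
    have d0: "0 \<le> d k" by (simp add: d_def)
    \<comment> \<open>The product telescopes to \<open>L (k+2) / L (k+4)\<close>, and
      \<open>L (k+4) \<ge> L (k+3) + L (k+2) \<ge> 2 * L (k+2)\<close>.\<close>
    have rr: "r (Suc (Suc k)) * r (Suc k) \<le> 1 / 2"
    proof -
      have "r (Suc (Suc k)) * r (Suc k) = L (Suc (Suc k)) / L (Suc (Suc (Suc (Suc k))))"
        using Lp by (simp add: r_def)
      also have "\<dots> \<le> 1 / 2"
        using L_add_le[of "Suc (Suc k)"] L_Suc_le[of "Suc k"] Lp by (simp add: field_simps)
      finally show ?thesis .
    qed
    have "d (Suc (Suc k)) \<le> r (Suc (Suc k)) * d (Suc k) + ln 2 / L (Suc (Suc (Suc k)))"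
      by (rule step[OF Lp(1)])
    also have "r (Suc (Suc k)) * d (Suc k) \<le> r (Suc (Suc k)) * (r (Suc k) * d k + ln 2 / L (Suc (Suc k)))"
      using r_bounds by (intro mult_left_mono step[OF L]) auto
    also have "\<dots> = (r (Suc (Suc k)) * r (Suc k)) * d k + r (Suc (Suc k)) * (ln 2 / L (Suc (Suc k)))"
      by (simp add: algebra_simps)
    also have "\<dots> \<le> 1 / 2 * d k + 1 * (ln 2 / L (Suc (Suc k)))"
      using rr d0 r_bounds Lp by (intro add_mono mult_right_mono) auto
    also have "ln 2 / L (Suc (Suc (Suc k))) \<le> ln 2 / L (Suc (Suc k))"
      using Lp L_Suc_le[of "Suc k"] by (intro divide_left_mono) auto
    finally show ?thesis by (simp add: \<eta>_def)
  qed
  moreover have "\<forall>\<^sub>F k in sequentially. L (Suc k) > 0"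
    using eventually_sequentially_Suc[of "\<lambda>k. L k \<ge> 1"] L_eventually_ge[of 1]
    by (auto elim: eventually_mono)
  ultimately have "\<forall>\<^sub>F k in sequentially. d (Suc (Suc k)) \<le> d k / 2 + \<eta> (Suc k)"
    by (auto elim: eventually_mono)
  moreover have "(\<lambda>k. \<eta> (Suc k)) \<longlonglongrightarrow> 0"
    unfolding \<eta>_def
    by (rule tendsto_mult_right_zero, rule LIMSEQ_Suc[of "\<lambda>k. ln 2 / L (Suc k)"], rule LIMSEQ_Suc[OF inv])
  moreover have "0 \<le> d k" "d k \<le> 1" for k
    using r_bounds[of k] cf_bounds[of "Suc (Suc k)"] by (auto simp: d_def)
  ultimately have "d \<longlonglongrightarrow> 0" by (intro tendsto_0_two_step_contraction[of d "\<lambda>k. \<eta> (Suc k)"]) auto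
  thus ?thesis by (simp add: d_def[abs_def])
qed

section \<open>The lower limit as a bound for the growth\<close>

definition \<sigma> :: real where "\<sigma> = real_of_ereal (sturm_sigma s)"

lemma sturm_sigma_eq_liminf: "sturm_sigma s = liminf (\<lambda>k. ereal (cf k))"
  by (simp add: sturm_sigma_def cf_def)

lemma sturm_sigma_eq: "sturm_sigma s = ereal \<sigma>" and sigma_nonneg: "0 \<le> \<sigma>"
proof -
  have 0: "0 \<le> sturm_sigma s"
    unfolding sturm_sigma_eq_liminf by (rule Liminf_bounded) (simp add: cf_bounds)
  have "sturm_sigma s \<le> limsup (\<lambda>k. ereal (cf k))"
    unfolding sturm_sigma_eq_liminf by (rule Liminf_le_Limsup) simp
  also have "\<dots> \<le> 1" by (rule Limsup_bounded) (simp add: cf_bounds)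
  finally have 1: "sturm_sigma s \<le> 1" .
  show "sturm_sigma s = ereal \<sigma>" "0 \<le> \<sigma>" using 0 1 unfolding \<sigma>_def
    by (cases "sturm_sigma s"; auto)+
qed

text \<open>The summand \<open>B\<close> stands for the logarithms of all later constants. Of the
  room between \<open>\<rho>\<close> and \<open>\<sigma>\<close>, one third is spent on the lower
  limit, one on the difference between \<open>r\<close> and \<open>cf\<close>, and one on
  \<open>B\<close>, which is outgrown by \<open>L\<close>.\<close>

lemma L_ratio_lower:
  assumes "\<rho> < \<sigma>"
  shows "\<forall>\<^sub>F k in sequentially. \<rho> * L (Suc (Suc k)) + B \<le> L (Suc k)"
proof -
  define \<rho>1 where "\<rho>1 = (2 * \<rho> + \<sigma>) / 3"
  define \<rho>2 where "\<rho>2 = (\<rho> + 2 * \<sigma>) / 3"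
  have \<rho>: "\<rho> < \<rho>1" "\<rho>1 < \<rho>2" "\<rho>2 < \<sigma>" using assms by (auto simp: \<rho>1_def \<rho>2_def)
  have "ereal \<rho>2 < liminf (\<lambda>k. ereal (cf k))"
    using \<rho> sturm_sigma_eq sturm_sigma_eq_liminf by (metis less_ereal.simps(1))
  hence "\<forall>\<^sub>F k in sequentially. cf k > \<rho>2" by (auto dest: less_LiminfD)
  hence 1: "\<forall>\<^sub>F k in sequentially. cf (Suc (Suc k)) > \<rho>2"
    by (intro eventually_compose_filterlim[OF _ filterlim_compose[OF filterlim_Suc filterlim_Suc]])
  have 2: "\<forall>\<^sub>F k in sequentially. \<bar>r k - cf (Suc (Suc k))\<bar> < \<rho>2 - \<rho>1"
    using r_minus_cf_tendsto \<rho> by (intro order_tendstoD) auto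
  have 3: "\<forall>\<^sub>F k in sequentially. L (Suc (Suc k)) \<ge> max 1 (B / (\<rho>1 - \<rho>))"
    by (intro eventually_compose_filterlim[OF L_eventually_ge filterlim_compose[OF filterlim_Suc filterlim_Suc]])
  show ?thesis using 1 2 3
  proof eventually_elim
    case (elim k)
    have Lp: "L (Suc (Suc k)) > 0" using elim by linarith
    have "r k \<ge> \<rho>1" using elim by linarith
    hence "\<rho>1 * L (Suc (Suc k)) \<le> L (Suc k)" using Lp by (simp add: r_def field_simps)
    moreover have "B \<le> (\<rho>1 - \<rho>) * L (Suc (Suc k))" using elim \<rho> by (simp add: field_simps)
    ultimately show ?case by (simp add: algebra_simps)
  qed
qed

text \<open>The room is divided as before. A lower limit is approached only along a subsequence,
  hence \<open>\<exists>\<^sub>F\<close>.\<close>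

lemma L_ratio_upper:
  assumes "\<sigma> < \<rho>"
  shows "\<exists>\<^sub>F k in sequentially. L (Suc k) + B \<le> \<rho> * L (Suc (Suc k))"
proof -
  define \<rho>1 where "\<rho>1 = (2 * \<rho> + \<sigma>) / 3"
  define \<rho>2 where "\<rho>2 = (\<rho> + 2 * \<sigma>) / 3"
  have \<rho>: "\<rho> > \<rho>1" "\<rho>1 > \<rho>2" "\<rho>2 > \<sigma>" using assms by (auto simp: \<rho>1_def \<rho>2_def)
  have "liminf (\<lambda>k. ereal (cf k)) < ereal \<rho>2"
    using \<rho> sturm_sigma_eq sturm_sigma_eq_liminf by (metis less_ereal.simps(1))
  hence "\<not> (\<forall>\<^sub>F k in sequentially. cf k \<ge> \<rho>2)" using Liminf_bounded[of "ereal \<rho>2" "\<lambda>k. ereal (cf k)"]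
    by (auto simp: not_le[symmetric])
  hence "\<not> (\<forall>\<^sub>F k in sequentially. cf (Suc (Suc k)) \<ge> \<rho>2)"
    by (simp add: eventually_sequentially_Suc[of "\<lambda>k. cf k \<ge> \<rho>2"]
      eventually_sequentially_Suc[of "\<lambda>k. cf (Suc k) \<ge> \<rho>2"])
  hence 1: "\<exists>\<^sub>F k in sequentially. cf (Suc (Suc k)) < \<rho>2"
    by (simp add: frequently_def not_less)
  have 2: "\<forall>\<^sub>F k in sequentially. \<bar>r k - cf (Suc (Suc k))\<bar> < \<rho>1 - \<rho>2"
    using r_minus_cf_tendsto \<rho> by (intro order_tendstoD) auto
  have 3: "\<forall>\<^sub>F k in sequentially. L (Suc (Suc k)) \<ge> max 1 (B / (\<rho> - \<rho>1))"
    by (intro eventually_compose_filterlim[OF L_eventually_ge filterlim_compose[OF filterlim_Suc filterlim_Suc]])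
  have "\<exists>\<^sub>F k in sequentially. cf (Suc (Suc k)) < \<rho>2 \<and>
      \<bar>r k - cf (Suc (Suc k))\<bar> < \<rho>1 - \<rho>2 \<and> L (Suc (Suc k)) \<ge> max 1 (B / (\<rho> - \<rho>1))"
    using frequently_eventually_frequently[OF 1 eventually_conj[OF 2 3]] .
  thus ?thesis
  proof (rule frequently_elim1)
    fix k assume elim: "cf (Suc (Suc k)) < \<rho>2 \<and>
      \<bar>r k - cf (Suc (Suc k))\<bar> < \<rho>1 - \<rho>2 \<and> L (Suc (Suc k)) \<ge> max 1 (B / (\<rho> - \<rho>1))"
    have Lp: "L (Suc (Suc k)) > 0" using elim by linarith
    have "r k \<le> \<rho>1" using elim by linarith
    hence "L (Suc k) \<le> \<rho>1 * L (Suc (Suc k))" using Lp by (simp add: r_def field_simps)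
    moreover have "B \<le> (\<rho> - \<rho>1) * L (Suc (Suc k))" using elim \<rho> by (simp add: field_simps)
    ultimately show "L (Suc k) + B \<le> \<rho> * L (Suc (Suc k))" by (simp add: algebra_simps)
  qed
qed

section \<open>Upper bounds for approximation by polynomials and algebraic numbers\<close>

text \<open>So \<open>\<xi>\<close> is neither rational nor quadratic:
  \<open>ipoly_lower_bound\<close> applies as soon as a denominator exceeds the height by a constant
  factor.\<close>

lemma ipoly_xi_nonzero:
  assumes "p \<noteq> 0" "degree p \<le> 2"
  shows "ipoly p \<xi> \<noteq> 0"
proof -
  have "\<forall>\<^sub>F k in sequentially. 4 * C * poly_height p \<le> Q (Suc (Suc k))"
    using Q_eventually_ge[of "4 * C * poly_height p"]
    by (simp add: eventually_sequentially_Suc[of "\<lambda>k. _ \<le> Q k"]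
        eventually_sequentially_Suc[of "\<lambda>k. _ \<le> Q (Suc k)"])
  then obtain k where k: "4 * C * poly_height p \<le> Q (Suc (Suc k))"
    by (auto simp: eventually_sequentially)
  have "1 / (8 * C * (Q (Suc (Suc k)))\<^sup>2 * Q (Suc k)) \<le> \<bar>ipoly p \<xi>\<bar>"
    using abs_coeff_le_poly_height[of p]
    by (intro ipoly_lower_bound[OF assms(2,1) _ k]) (simp flip: of_int_abs)
  moreover have "0 < 1 / (8 * C * (Q (Suc (Suc k)))\<^sup>2 * Q (Suc k))"
    using C_ge Q_pos[of "Suc k"] Q_pos[of "Suc (Suc k)"] by simp
  ultimately show ?thesis by linarith
qed

lemma ln_lower_bound_eq:
  "ln (1 / (8 * C * (Q (Suc (Suc k)))\<^sup>2 * Q (Suc k))) = - ln (8 * C) - 2 * L (Suc (Suc k)) - L (Suc k)"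
  using C_ge Q_pos[of "Suc k"] Q_pos[of "Suc (Suc k)"] by (simp add: ln_div ln_mult ln_realpow L_def)

lemma C_pos: "0 < C"
  using C_ge by linarith

text \<open>For \<open>p\<close> of large height \<open>H\<close> take \<open>k\<close> with
  \<open>Q (k+1) \<le> 4 * C * H < Q (k+2)\<close>. The lower bound for the value forces
  \<open>(w - 1) * L (k+1) \<le> 2 * L (k+2)\<close> up to a constant, against
  \<open>L_ratio_lower\<close>. \<open>D\<close> is 1 for polynomials and 4 for minimal polynomials
  of algebraic approximations; the product form of the claim makes sense for
  \<open>\<sigma> = 0\<close> too.\<close>

lemma w_upper_aux:
  fixes w D :: real
  assumes inf: "infinite S" and D: "D > 0"
    and S: "\<And>p. p \<in> S \<Longrightarrow> p \<noteq> 0 \<and> degree p \<le> 2 \<and> \<bar>ipoly p \<xi>\<bar> \<le> D * poly_height p powr (- w)"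
  shows "\<sigma> * (w - 1) \<le> 2"
proof (rule ccontr)
  assume neg: "\<not> ?thesis"
  have w: "w > 1"
  proof (rule ccontr)
    assume "\<not> w > 1"
    hence "\<sigma> * (w - 1) \<le> 0" using sigma_nonneg by (simp add: mult_nonneg_nonpos)
    thus False using neg by simp
  qed
  define \<rho> where "\<rho> = 2 / (w - 1)"
  have "\<rho> < \<sigma>" using neg w by (simp add: \<rho>_def field_simps)
  define B0 where "B0 = ln (8 * C) + ln D + w * ln (4 * C)"
  from L_ratio_lower[OF \<open>\<rho> < \<sigma>\<close>, of "(B0 + 1) / (w - 1)"] obtain N where
    N0: "\<And>k. k \<ge> N \<Longrightarrow> \<rho> * L (Suc (Suc k)) + (B0 + 1) / (w - 1) \<le> L (Suc k)"
    unfolding eventually_sequentially by blast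
  have N: "2 * L (Suc (Suc k)) + (B0 + 1) \<le> (w - 1) * L (Suc k)" if "k \<ge> N" for k
  proof -
    have "(w - 1) * (\<rho> * L (Suc (Suc k)) + (B0 + 1) / (w - 1)) \<le> (w - 1) * L (Suc k)"
      using that w N0 by (intro mult_left_mono) auto
    moreover have "x * (y / x) = y" if "x > 0" for x y :: real using that by simp
    from this[of "w - 1" "B0 + 1"] this[of "w - 1" 2] w
    have "(w - 1) * (\<rho> * L (Suc (Suc k)) + (B0 + 1) / (w - 1)) = 2 * L (Suc (Suc k)) + (B0 + 1)"
      by (simp only: \<rho>_def distrib_left mult.assoc[symmetric] diff_gt_0_iff_gt)
    ultimately show ?thesis by simp
  qed
  obtain T where T: "\<And>X. X \<ge> T \<Longrightarrow> \<exists>k\<ge>Suc N. Q k \<le> X \<and> X < Q (Suc k)"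
    using eventually_between[OF Q_at_top, of "Suc N"] by (auto simp: eventually_at_top_linorder)
  have "\<not> S \<subseteq> {p. degree p \<le> 2 \<and> poly_height p \<le> \<lceil>T\<rceil>}"
    using inf finite_poly_height_le finite_subset by blast
  then obtain p where "p \<in> S" "\<not> poly_height p \<le> \<lceil>T\<rceil>" using S by blast
  hence p: "p \<in> S" "poly_height p > \<lceil>T\<rceil>" by auto
  define H where "H = real_of_int (poly_height p)"
  have H1: "H \<ge> 1" using poly_height_ge_1 S[OF p(1)] by (simp add: H_def)
  have "1 * H \<le> 4 * C * H" using H1 C_ge by (intro mult_right_mono) auto
  moreover have "T \<le> H" using p(2) unfolding H_def by linarith
  ultimately have "T \<le> 4 * C * H" by linarith
  from T[OF this] obtain j where "j \<ge> Suc N" "Q j \<le> 4 * C * H" "4 * C * H < Q (Suc j)" by blast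
  then obtain k where k: "k \<ge> N" "Q (Suc k) \<le> 4 * C * H" "4 * C * H < Q (Suc (Suc k))"
    by (cases j) auto
  have "1 / (8 * C * (Q (Suc (Suc k)))\<^sup>2 * Q (Suc k)) \<le> \<bar>ipoly p \<xi>\<bar>"
    using abs_coeff_le_poly_height[of p] k(3) S[OF p(1)]
    by (intro ipoly_lower_bound[where H = H]) (auto simp: H_def simp flip: of_int_abs)
  also have "\<dots> \<le> D * H powr (- w)" using S[OF p(1)] by (simp add: H_def)
  finally have "ln (1 / (8 * C * (Q (Suc (Suc k)))\<^sup>2 * Q (Suc k))) \<le> ln D + (- w) * ln H"
    using C_pos Q_pos[of "Suc k"] Q_pos[of "Suc (Suc k)"] H1 D by (intro le_mult_powrD) auto
  moreover have "L (Suc k) \<le> ln (4 * C) + ln H"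
  proof -
    have "L (Suc k) \<le> ln (4 * C * H)" unfolding L_def using k(2) Q_pos C_pos H1
      by (subst ln_le_cancel_iff) auto
    thus ?thesis using C_pos H1 by (simp add: ln_mult)
  qed
  hence "w * L (Suc k) \<le> w * ln (4 * C) + w * ln H"
    using mult_left_mono[of "L (Suc k)" "ln (4 * C) + ln H" w] w by (simp add: distrib_left)
  ultimately have "(w - 1) * L (Suc k) \<le> 2 * L (Suc (Suc k)) + B0"
    unfolding ln_lower_bound_eq B0_def by (simp add: algebra_simps)
  thus False using N[OF k(1)] by linarith
qed

text \<open>The test value is \<open>X = Q (k+2) / (4 * C)\<close>, the largest height bound that
  \<open>ipoly_lower_bound\<close> admits, along the subsequence where
  \<open>L (k+1) / L (k+2)\<close> is close to \<open>\<sigma>\<close>.\<close>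

lemma w_hat_upper_aux:
  fixes w D :: real
  assumes D: "D > 0"
    and ev: "\<forall>\<^sub>F X :: real in at_top. \<exists>p. p \<noteq> 0 \<and> degree p \<le> 2 \<and>
      (\<forall>i. \<bar>real_of_int (coeff p i)\<bar> \<le> X) \<and> \<bar>ipoly p \<xi>\<bar> \<le> D * X powr (- w)"
  shows "w \<le> 2 + \<sigma>"
proof (rule ccontr)
  assume "\<not> ?thesis"
  hence \<rho>: "\<sigma> < w - 2" by simp
  define B0 where "B0 = ln (8 * C) + ln D + w * ln (4 * C)"
  have "filterlim (\<lambda>k. 1 / (4 * C) * Q (Suc (Suc k))) at_top sequentially"
    using C_pos by (intro filterlim_tendsto_pos_mult_at_top[OF tendsto_const]
      filterlim_compose[OF Q_at_top filterlim_compose[OF filterlim_Suc filterlim_Suc]]) auto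
  hence "filterlim (\<lambda>k. Q (Suc (Suc k)) / (4 * C)) at_top sequentially" by simp
  from eventually_compose_filterlim[OF ev this]
    frequently_eventually_frequently[OF L_ratio_upper[OF \<rho>, of "B0 + 1"]]
  obtain k p where k: "L (Suc k) + (B0 + 1) \<le> (w - 2) * L (Suc (Suc k))"
    and p: "p \<noteq> 0" "degree p \<le> 2" "\<And>i. \<bar>real_of_int (coeff p i)\<bar> \<le> Q (Suc (Suc k)) / (4 * C)"
      "\<bar>ipoly p \<xi>\<bar> \<le> D * (Q (Suc (Suc k)) / (4 * C)) powr (- w)"
    by (force dest!: frequently_ex)
  have "1 / (8 * C * (Q (Suc (Suc k)))\<^sup>2 * Q (Suc k)) \<le> \<bar>ipoly p \<xi>\<bar>"
    using C_pos by (intro ipoly_lower_bound[OF p(2,1,3)]) auto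
  also note p(4)
  finally have "ln (1 / (8 * C * (Q (Suc (Suc k)))\<^sup>2 * Q (Suc k))) \<le>
      ln D + (- w) * ln (Q (Suc (Suc k)) / (4 * C))"
    using C_pos Q_pos[of "Suc k"] Q_pos[of "Suc (Suc k)"] D by (intro le_mult_powrD) auto
  also have "ln (Q (Suc (Suc k)) / (4 * C)) = L (Suc (Suc k)) - ln (4 * C)"
    using C_pos Q_pos[of "Suc (Suc k)"] by (simp add: ln_div L_def)
  finally have "(w - 2) * L (Suc (Suc k)) \<le> L (Suc k) + B0"
    unfolding ln_lower_bound_eq B0_def by (simp add: algebra_simps)
  thus False using k by linarith
qed

lemma ereal_le_w_bound:
  assumes "\<sigma> * (w - 1) \<le> 2"
  shows "ereal w \<le> 1 + 2 / sturm_sigma s"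
proof (cases "\<sigma> = 0")
  case True
  thus ?thesis by (simp add: sturm_sigma_eq divide_ereal_def)
next
  case False
  hence \<sigma>: "\<sigma> > 0" using sigma_nonneg by simp
  hence "w \<le> 1 + 2 / \<sigma>" using assms by (simp add: field_simps)
  moreover have "1 + 2 / sturm_sigma s = ereal (1 + 2 / \<sigma>)"
    using \<sigma> by (simp add: sturm_sigma_eq one_ereal_def numeral_eq_ereal)
  ultimately show ?thesis by simp
qed

lemma exp_w_le: "exp_w 2 \<xi> \<le> 1 + 2 / sturm_sigma s"
  unfolding exp_w_def
proof (rule Sup_least)
  fix x assume "x \<in> ereal ` {w. infinite {p :: int poly. degree p \<le> 2 \<and>
       0 < \<bar>ipoly p \<xi>\<bar> \<and> \<bar>ipoly p \<xi>\<bar> \<le> of_int (poly_height p) powr (- w)}}"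
  then obtain w where w: "x = ereal w" and inf: "infinite {p :: int poly. degree p \<le> 2 \<and>
       0 < \<bar>ipoly p \<xi>\<bar> \<and> \<bar>ipoly p \<xi>\<bar> \<le> of_int (poly_height p) powr (- w)}" by blast
  have "\<sigma> * (w - 1) \<le> 2" by (rule w_upper_aux[OF inf, of 1]) auto
  thus "x \<le> 1 + 2 / sturm_sigma s" unfolding w by (rule ereal_le_w_bound)
qed

text \<open>The minimal polynomial vanishes at \<open>\<alpha>\<close>, and 4 bounds the factor
  \<open>1 + \<bar>\<xi>\<bar> + \<bar>\<alpha>\<bar>\<close> of \<open>ipoly_diff_le\<close>, as
  \<open>\<xi> \<le> 1\<close> and \<open>\<bar>\<alpha>\<bar> \<le> 2\<close>.\<close>

lemma minpoly_at_xi: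
  assumes \<alpha>: "algebraic \<alpha>" "alg_degree \<alpha> \<le> 2" "\<bar>\<xi> - \<alpha>\<bar> \<le> 1"
  shows "\<bar>ipoly (int_minpoly \<alpha>) \<xi>\<bar> \<le> 4 * (alg_height \<alpha> * \<bar>\<xi> - \<alpha>\<bar>)"
proof -
  have H: "\<bar>real_of_int (coeff (int_minpoly \<alpha>) i)\<bar> \<le> alg_height \<alpha>" for i
    using abs_coeff_le_poly_height[of "int_minpoly \<alpha>" i] unfolding alg_height_def
    by (simp flip: of_int_abs)
  have "\<bar>ipoly (int_minpoly \<alpha>) \<xi>\<bar> \<le> alg_height \<alpha> * \<bar>\<xi> - \<alpha>\<bar> * (1 + \<bar>\<xi>\<bar> + \<bar>\<alpha>\<bar>)"
    using ipoly_diff_le[OF _ H, of \<xi> \<alpha>] \<alpha> int_minpoly_facts(2)[OF \<alpha>(1)] by (simp add: alg_degree_def)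
  also have "\<dots> \<le> alg_height \<alpha> * \<bar>\<xi> - \<alpha>\<bar> * 4"
    using \<alpha>(3) xi_bounds int_minpoly_facts(3)[OF \<alpha>(1)] by (intro mult_left_mono) auto
  finally show ?thesis by simp
qed

lemma exp_w_star_le: "exp_w_star 2 \<xi> \<le> 1 + 2 / sturm_sigma s"
  unfolding exp_w_star_def
proof (rule Sup_least)
  fix x assume "x \<in> ereal ` {w. infinite {\<alpha> :: real. algebraic \<alpha> \<and> alg_degree \<alpha> \<le> 2 \<and>
       0 < \<bar>\<xi> - \<alpha>\<bar> \<and> \<bar>\<xi> - \<alpha>\<bar> \<le> of_int (alg_height \<alpha>) powr (- w - 1)}}"
  then obtain w where w: "x = ereal w" and "infinite {\<alpha> :: real. algebraic \<alpha> \<and> alg_degree \<alpha> \<le> 2 \<and>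
       0 < \<bar>\<xi> - \<alpha>\<bar> \<and> \<bar>\<xi> - \<alpha>\<bar> \<le> of_int (alg_height \<alpha>) powr (- w - 1)}" (is "infinite ?A") by blast
  have "\<sigma> * (w - 1) \<le> 2"
  proof (cases "w \<le> 1")
    case True
    hence "\<sigma> * (w - 1) \<le> 0" using sigma_nonneg by (simp add: mult_nonneg_nonpos)
    thus ?thesis by linarith
  next
    case False
    let ?S = "int_minpoly ` ?A"
    \<comment> \<open>Infinitely many numbers have infinitely many minimal polynomials, as each
      polynomial has only finitely many roots.\<close>
    have "infinite ?S"
    proof
      assume fin: "finite ?S"
      have "?A \<subseteq> (\<Union>p\<in>?S. {x. ipoly p x = 0})" using int_minpoly_facts(2) by auto
      moreover have "finite (\<Union>p\<in>?S. {x. ipoly p x = 0})"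
      proof (intro finite_UN_I fin)
        fix p assume "p \<in> ?S"
        hence "p \<noteq> 0" using int_minpoly_facts(1) by auto
        hence "map_poly real_of_int p \<noteq> 0" by (simp add: map_poly_eq_0_iff)
        thus "finite {x. ipoly p x = 0}" by (rule poly_roots_finite)
      qed
      ultimately show False using \<open>infinite ?A\<close> finite_subset by blast
    qed
    thus ?thesis
    proof (rule w_upper_aux[of _ 4])
      fix p assume "p \<in> ?S"
      then obtain \<alpha> where p: "p = int_minpoly \<alpha>" and \<alpha>: "algebraic \<alpha>" "alg_degree \<alpha> \<le> 2"
        "\<bar>\<xi> - \<alpha>\<bar> \<le> of_int (alg_height \<alpha>) powr (- w - 1)" by auto
      define H where "H = real_of_int (alg_height \<alpha>)"
      have H1: "1 \<le> H" using int_minpoly_facts(3)[OF \<alpha>(1)] by (simp add: H_def)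
      have "H powr (- w - 1) \<le> H powr 0" using H1 False by (intro powr_mono) auto
      hence "\<bar>\<xi> - \<alpha>\<bar> \<le> 1" using \<alpha>(3) H1 by (simp add: H_def)
      from minpoly_at_xi[OF \<alpha>(1,2) this] have "\<bar>ipoly p \<xi>\<bar> \<le> 4 * (H * \<bar>\<xi> - \<alpha>\<bar>)"
        by (simp add: p H_def)
      also have "\<dots> \<le> 4 * (H * H powr (- w - 1))"
        using H1 \<alpha>(3) by (intro mult_left_mono) (auto simp: H_def)
      also have "H * H powr (- w - 1) = H powr (- w)" using H1 by (simp add: powr_mult_base)
      finally show "p \<noteq> 0 \<and> degree p \<le> 2 \<and> \<bar>ipoly p \<xi>\<bar> \<le> 4 * poly_height p powr (- w)"
        using int_minpoly_facts(1)[OF \<alpha>(1)] \<alpha>(2) by (simp add: p H_def alg_height_def alg_degree_def)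
    qed simp
  qed
  thus "x \<le> 1 + 2 / sturm_sigma s" unfolding w by (rule ereal_le_w_bound)
qed

lemma exp_w_hat_le: "exp_w_hat 2 \<xi> \<le> 2 + sturm_sigma s"
  unfolding exp_w_hat_def
proof (rule Sup_least)
  let ?ev = "\<lambda>w. \<forall>\<^sub>F X :: real in at_top. \<exists>x :: nat \<Rightarrow> int.
       0 < \<bar>\<Sum>m\<le>2. of_int (x m) * \<xi> ^ m\<bar> \<and>
       \<bar>\<Sum>m\<le>2. of_int (x m) * \<xi> ^ m\<bar> \<le> X powr (- w) \<and>
       (MAX m\<in>{..2}. \<bar>of_int (x m)\<bar>) \<le> X"
  fix x assume "x \<in> ereal ` {w. ?ev w}"
  then obtain w where w: "x = ereal w" and ev: "?ev w" by blast
  have "w \<le> 2 + \<sigma>"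
  proof (rule w_hat_upper_aux[of 1])
    show "\<forall>\<^sub>F X :: real in at_top. \<exists>p. p \<noteq> 0 \<and> degree p \<le> 2 \<and>
      (\<forall>i. \<bar>real_of_int (coeff p i)\<bar> \<le> X) \<and> \<bar>ipoly p \<xi>\<bar> \<le> 1 * X powr (- w)"
      using ev
    proof eventually_elim
      case (elim X)
      then obtain x :: "nat \<Rightarrow> int" where x: "0 < \<bar>\<Sum>m\<le>2. of_int (x m) * \<xi> ^ m\<bar>"
        "\<bar>\<Sum>m\<le>2. of_int (x m) * \<xi> ^ m\<bar> \<le> X powr (- w)" "(MAX m\<in>{..2}. \<bar>of_int (x m)\<bar>) \<le> X" by blast
      have xi: "\<bar>real_of_int (x i)\<bar> \<le> X" if "i \<le> 2" for i
        using x(3) that by (subst (asm) Max_le_iff) auto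
      define p where "p = [:x 0, x 1, x 2:]"
      have dp: "degree p \<le> 2" by (simp add: p_def)
      have eq: "ipoly p \<xi> = (\<Sum>m\<le>2. of_int (x m) * \<xi> ^ m)"
        unfolding ipoly_deg2[OF dp] by (simp add: p_def numeral_2_eq_2)
      have "p \<noteq> 0" using x(1) unfolding eq[symmetric] by auto
      moreover have "\<bar>real_of_int (coeff p i)\<bar> \<le> X" for i
        using xi[of 0] xi[of 1] xi[of 2] by (auto simp: p_def coeff_pCons split: nat.split)
      ultimately show ?case using dp x(2) unfolding eq[symmetric] by auto
    qed
  qed simp
  thus "x \<le> 2 + sturm_sigma s" unfolding w
    by (simp add: sturm_sigma_eq numeral_eq_ereal)
qed

lemma exp_w_hat_star_le: "exp_w_hat_star 2 \<xi> \<le> 2 + sturm_sigma s"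
  unfolding exp_w_hat_star_def
proof (rule Sup_least)
  let ?ev = "\<lambda>w. \<forall>\<^sub>F X :: real in at_top. \<exists>\<alpha> :: real. algebraic \<alpha> \<and> alg_degree \<alpha> \<le> 2 \<and>
       0 < \<bar>\<xi> - \<alpha>\<bar> \<and> \<bar>\<xi> - \<alpha>\<bar> \<le> inverse (of_int (alg_height \<alpha>)) * X powr (- w) \<and>
       of_int (alg_height \<alpha>) \<le> X"
  fix x assume "x \<in> ereal ` {w. ?ev w}"
  then obtain w where w: "x = ereal w" and ev: "?ev w" by blast
  have "w \<le> 2 + \<sigma>"
  proof (cases "w \<le> 0")
    case True
    thus ?thesis using sigma_nonneg by linarith
  next
    case False
    show ?thesis
    proof (rule w_hat_upper_aux[of 4])
      show "\<forall>\<^sub>F X :: real in at_top. \<exists>p. p \<noteq> 0 \<and> degree p \<le> 2 \<and>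
        (\<forall>i. \<bar>real_of_int (coeff p i)\<bar> \<le> X) \<and> \<bar>ipoly p \<xi>\<bar> \<le> 4 * X powr (- w)"
        using ev eventually_ge_at_top[of 1]
      proof eventually_elim
        case (elim X)
        then obtain \<alpha> where \<alpha>: "algebraic \<alpha>" "alg_degree \<alpha> \<le> 2"
          "\<bar>\<xi> - \<alpha>\<bar> \<le> inverse (of_int (alg_height \<alpha>)) * X powr (- w)" "of_int (alg_height \<alpha>) \<le> X" by blast
        define H where "H = real_of_int (alg_height \<alpha>)"
        have H1: "1 \<le> H" using int_minpoly_facts(3)[OF \<alpha>(1)] by (simp add: H_def)
        have b: "H * \<bar>\<xi> - \<alpha>\<bar> \<le> X powr (- w)" using \<alpha>(3) H1 by (simp add: H_def field_simps)
        \<comment> \<open>The positive exponent puts \<open>\<alpha>\<close> within distance 1 of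
          \<open>\<xi>\<close>, as \<open>minpoly_at_xi\<close> requires.\<close>
        have "X powr (- w) \<le> X powr 0" using elim False by (intro powr_mono) auto
        hence "H * \<bar>\<xi> - \<alpha>\<bar> \<le> 1" using b elim by simp
        moreover have "1 * \<bar>\<xi> - \<alpha>\<bar> \<le> H * \<bar>\<xi> - \<alpha>\<bar>" using H1 by (intro mult_right_mono) auto
        ultimately have "\<bar>\<xi> - \<alpha>\<bar> \<le> 1" by simp
        from minpoly_at_xi[OF \<alpha>(1,2) this] b
        have "\<bar>ipoly (int_minpoly \<alpha>) \<xi>\<bar> \<le> 4 * X powr (- w)" by (simp add: H_def)
        moreover have "\<bar>real_of_int (coeff (int_minpoly \<alpha>) i)\<bar> \<le> X" for i
          using abs_coeff_le_poly_height[of "int_minpoly \<alpha>" i] \<alpha>(4) unfolding alg_height_def by linarith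
        ultimately show ?case using int_minpoly_facts(1)[OF \<alpha>(1)] \<alpha>(2)
          by (intro exI[of _ "int_minpoly \<alpha>"]) (auto simp: alg_degree_def)
      qed
    qed simp
  qed
  thus "x \<le> 2 + sturm_sigma s" unfolding w
    by (simp add: sturm_sigma_eq numeral_eq_ereal)
qed

section \<open>Lower bounds for approximation by polynomials and algebraic numbers\<close>

lemma filterlim_Suc_Suc: "filterlim (\<lambda>k. Suc (Suc k)) sequentially sequentially"
  by (intro filterlim_compose[OF filterlim_Suc filterlim_Suc])

lemma Q_Suc_at_top:
  "filterlim (\<lambda>k. Q (Suc k)) at_top sequentially" "filterlim (\<lambda>k. Q (Suc (Suc k))) at_top sequentially"
  by (rule filterlim_compose[OF Q_at_top] filterlim_Suc filterlim_Suc_Suc)+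

lemma C_le_Q_eventually: "\<forall>\<^sub>F k in sequentially. C \<le> Q (Suc k)"
  using Q_Suc_at_top(1) by (auto simp: filterlim_at_top)

text \<open>\<open>m01 (M k)\<close> is the upper left entry for the word without its last letter.
  The comparison keeps the leading coefficient of \<open>fix_poly (M k)\<close> of the order of
  \<open>Q k\<close>.\<close>

lemma m00_M_le_m01: "Q k \<le> C * m01 (M k)"
proof -
  obtain w c where w: "m k = w @ [c]" using sturm_m_neq_Nil[of a b s k] by (metis rev_exhaust)
  have c: "real c + 1 \<le> C" "\<forall>c\<in>set w. c > 0"
    using m_letters[of k] w a_pos b_pos by (auto simp: C_def algebra_simps)
  define W where "W = word_mat w"
  have W: "m01 W \<le> m00 W" "0 \<le> m00 W"
    using mat_dominant_word_mat[OF _ c(2)] by (cases "w = []"; auto simp: W_def mat_dominant_def)+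
  have M: "M k = W * letter_mat c" by (simp add: M_def w W_def)
  have "Q k = m00 W * real c + m01 W" by (simp add: Q_def M)
  also have "\<dots> \<le> m00 W * (real c + 1)" using W by (simp add: algebra_simps)
  also have "\<dots> \<le> m00 W * C" using W c by (intro mult_left_mono) auto
  also have "\<dots> = C * m01 (M k)" by (simp add: M)
  finally show ?thesis .
qed

lemma fix_poly_nonzero: "fix_poly (M k) \<noteq> 0"
proof
  assume "fix_poly (M k) = 0"
  hence "coeff (fix_poly (M k)) 2 = 0" by simp
  thus False using mat_dominant_M[of k] by (simp add: mat_dominant_def)
qed

text \<open>The constant \<open>2 * C\<^sup>2\<close> of \<open>fix_poly_small\<close>, divided by
  the constant \<open>\<xi> / C\<close> of the slope bound in
  \<open>quadratic_approximation\<close>.\<close>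

definition D :: real where "D = 2 * C ^ 3 / \<xi>"

lemma D_pos: "0 < D"
  using C_pos xi_bounds by (simp add: D_def)

text \<open>The polynomial changes sign on \<open>[0, 1]\<close>, and \<open>\<alpha>\<close> is a
  root there. Its value at \<open>\<xi>\<close> is \<open>\<xi> - \<alpha>\<close> times a cofactor
  whose summands are all nonnegative, one of them being \<open>m01 U * \<xi>\<close>, of the order
  of \<open>Q (k+1)\<close>. So the distance is smaller than the value by that order.\<close>

lemma quadratic_approximation:
  assumes k: "C \<le> Q (Suc k)"
  shows "\<exists>\<alpha>. algebraic \<alpha> \<and> alg_degree \<alpha> \<le> 2 \<and> 1 \<le> alg_height \<alpha> \<and> alg_height \<alpha> \<le> Q (Suc k) \<and>
    0 < \<bar>\<xi> - \<alpha>\<bar> \<and> \<bar>\<xi> - \<alpha>\<bar> \<le> D / ((Q (Suc k))\<^sup>2 * (Q (Suc (Suc k)))\<^sup>2)"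
proof -
  define U where "U = M (Suc k)"
  define P where "P = fix_poly U"
  have dom: "mat_dominant U" unfolding U_def by (rule mat_dominant_M)
  have P: "P \<noteq> 0" "degree P \<le> 2" unfolding P_def U_def by (rule fix_poly_nonzero degree_fix_poly)+
  have val: "ipoly P x = m01 U * x\<^sup>2 + (m00 U - m11 U) * x - m10 U" for x :: real
    by (simp add: ipoly_deg2[OF P(2)]) (simp add: P_def algebra_simps)
  have "\<exists>x\<ge>0. x \<le> 1 \<and> ipoly P x = 0"
  proof (rule IVT)
    show "ipoly P 0 \<le> 0" "0 \<le> ipoly P 1" using dom by (auto simp: val mat_dominant_def)
  qed auto
  then obtain \<alpha> where \<alpha>: "0 \<le> \<alpha>" "\<alpha> \<le> 1" "ipoly P \<alpha> = 0" by blast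
  have alg: "algebraic \<alpha>" by (rule algebraic_ipoly_root[OF P(1) \<alpha>(3)])
  have c2: "coeff P 2 \<noteq> 0" using dom by (simp add: P_def mat_dominant_def)
  have B: "\<bar>coeff P i\<bar> \<le> m00 U" for i
    using abs_coeff_fix_poly_M[of "Suc k" i] by (simp add: P_def U_def Q_def flip: of_int_abs)
  have deg: "alg_degree \<alpha> \<le> 2" and "alg_height \<alpha> \<le> m00 U"
    using quadratic_root_height[OF P c2 B \<alpha>(3)] \<alpha> by auto
  hence ht: "alg_height \<alpha> \<le> Q (Suc k)" by (simp add: Q_def U_def)
  have ne: "ipoly P \<xi> \<noteq> 0" by (rule ipoly_xi_nonzero[OF P])
  hence "\<alpha> \<noteq> \<xi>" using \<alpha>(3) by auto
  have "ipoly P \<xi> = ipoly P \<xi> - ipoly P \<alpha>" using \<alpha>(3) by simp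
  also have "\<dots> = (\<xi> - \<alpha>) * (m01 U * \<xi> + (m01 U * \<alpha> + (m00 U - m11 U)))"
    unfolding val by (simp add: algebra_simps power2_eq_square)
  finally have eq: "\<bar>ipoly P \<xi>\<bar> = \<bar>\<xi> - \<alpha>\<bar> * \<bar>m01 U * \<xi> + (m01 U * \<alpha> + (m00 U - m11 U))\<bar>"
    by (simp add: abs_mult)
  have "0 \<le> real_of_int (m01 U) * \<alpha>" "0 \<le> real_of_int (m00 U - m11 U)"
    using dom \<alpha> by (auto simp: mat_dominant_def)
  hence lower: "\<bar>\<xi> - \<alpha>\<bar> * (m01 U * \<xi>) \<le> \<bar>ipoly P \<xi>\<bar>"
    unfolding eq by (intro mult_left_mono) auto
  have "Q (Suc k) * \<xi> \<le> C * m01 U * \<xi>"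
    using m00_M_le_m01[of "Suc k"] xi_bounds unfolding U_def by (intro mult_right_mono) auto
  hence "\<bar>\<xi> - \<alpha>\<bar> * (Q (Suc k) * \<xi>) \<le> \<bar>\<xi> - \<alpha>\<bar> * (C * m01 U * \<xi>)"
    by (intro mult_left_mono) auto
  also have "\<dots> = C * (\<bar>\<xi> - \<alpha>\<bar> * (m01 U * \<xi>))" by simp
  also have "\<dots> \<le> C * \<bar>ipoly P \<xi>\<bar>" using lower C_pos by (intro mult_left_mono) auto
  also have "\<dots> \<le> C * (2 * C\<^sup>2 / (Q (Suc k) * (Q (Suc (Suc k)))\<^sup>2))"
    unfolding P_def U_def using fix_poly_small[OF k] C_pos by (intro mult_left_mono) auto
  also have "\<dots> = 2 * C ^ 3 / (Q (Suc k) * (Q (Suc (Suc k)))\<^sup>2)"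
    by (simp add: power2_eq_square power3_eq_cube)
  finally have "\<bar>\<xi> - \<alpha>\<bar> \<le> 2 * C ^ 3 / (Q (Suc k) * (Q (Suc (Suc k)))\<^sup>2) / (Q (Suc k) * \<xi>)"
    using Q_pos[of "Suc k"] xi_bounds by (subst pos_le_divide_eq) auto
  also have "\<dots> = D / ((Q (Suc k))\<^sup>2 * (Q (Suc (Suc k)))\<^sup>2)"
    using xi_bounds by (simp add: D_def power2_eq_square mult_ac)
  finally show ?thesis using alg deg ht int_minpoly_facts(3)[OF alg] \<open>\<alpha> \<noteq> \<xi>\<close> by auto
qed

lemma frequently_w:
  assumes w: "1 < w" "\<sigma> * (w - 1) < 2"
  shows "\<exists>\<^sub>F k in sequentially. C \<le> Q (Suc k) \<and> (w - 1) * L (Suc k) + B \<le> 2 * L (Suc (Suc k))"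
proof -
  have \<sigma>: "\<sigma> < 2 / (w - 1)" using w by (simp add: field_simps)
  show ?thesis
  proof (rule frequently_elim1[OF frequently_eventually_frequently[OF
        L_ratio_upper[OF \<sigma>, of "B / (w - 1)"] C_le_Q_eventually]])
    fix k assume *: "L (Suc k) + B / (w - 1) \<le> 2 / (w - 1) * L (Suc (Suc k)) \<and> C \<le> Q (Suc k)"
    have "L (Suc k) + B / (w - 1) = ((w - 1) * L (Suc k) + B) / (w - 1)"
      using w by (simp add: add_divide_distrib)
    moreover have "2 / (w - 1) * L (Suc (Suc k)) = 2 * L (Suc (Suc k)) / (w - 1)" by simp
    ultimately have "(w - 1) * L (Suc k) + B \<le> 2 * L (Suc (Suc k))"
      using * w by (simp add: divide_le_cancel)
    thus "C \<le> Q (Suc k) \<and> (w - 1) * L (Suc k) + B \<le> 2 * L (Suc (Suc k))" using * by blast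
  qed
qed

lemma less_w_bound:
  assumes w: "1 < w" "ereal w < 1 + 2 / sturm_sigma s"
  shows "\<sigma> * (w - 1) < 2"
proof (cases "\<sigma> = 0")
  case False
  hence \<sigma>: "\<sigma> > 0" using sigma_nonneg by simp
  have "1 + 2 / sturm_sigma s = ereal (1 + 2 / \<sigma>)"
    using \<sigma> by (simp add: sturm_sigma_eq one_ereal_def numeral_eq_ereal)
  hence "w < 1 + 2 / \<sigma>" using w by simp
  thus ?thesis using \<sigma> by (simp add: field_simps)
qed simp

lemma one_less_w_bound: "ereal 1 < 1 + 2 / sturm_sigma s"
proof (cases "\<sigma> = 0")
  case True
  thus ?thesis by (simp add: sturm_sigma_eq divide_ereal_def)
next
  case False
  hence \<sigma>: "\<sigma> > 0" using sigma_nonneg by simp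
  have "1 + 2 / sturm_sigma s = ereal (1 + 2 / \<sigma>)"
    using \<sigma> by (simp add: sturm_sigma_eq one_ereal_def numeral_eq_ereal)
  thus ?thesis using \<sigma> by simp
qed

lemma tendsto_0_bound_Q:
  assumes "\<forall>\<^sub>F k in sequentially. \<bar>f k\<bar> \<le> B / Q (Suc k)"
  shows "(\<lambda>k. \<bar>f k\<bar>) \<longlonglongrightarrow> 0"
proof (rule tendsto_sandwich[OF _ assms tendsto_const])
  show "(\<lambda>k. B / Q (Suc k)) \<longlonglongrightarrow> 0"
    by (rule tendsto_divide_0[OF tendsto_const filterlim_at_top_imp_at_infinity[OF Q_Suc_at_top(1)]])
qed simp

lemma exp_w_ge: "1 + 2 / sturm_sigma s \<le> exp_w 2 \<xi>"
  unfolding exp_w_def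
proof (rule le_Sup_ereal_image[OF one_less_w_bound])
  fix w assume w: "1 < w" "ereal w < 1 + 2 / sturm_sigma s"
  let ?S = "{p :: int poly. degree p \<le> 2 \<and>
       0 < \<bar>ipoly p \<xi>\<bar> \<and> \<bar>ipoly p \<xi>\<bar> \<le> of_int (poly_height p) powr (- w)}"
  let ?P = "\<lambda>k. fix_poly (M (Suc k))"
  have "infinite ?S"
  proof (rule infinite_if_frequently_small[where f = ?P and g = "\<lambda>p. \<bar>ipoly p \<xi>\<bar>" and F = sequentially])
    show "\<exists>\<^sub>F k in sequentially. ?P k \<in> ?S"
    proof (rule frequently_elim1[OF frequently_w[OF w(1) less_w_bound[OF w], of "ln (2 * C\<^sup>2)"]])
      fix k assume k: "C \<le> Q (Suc k) \<and> (w - 1) * L (Suc k) + ln (2 * C\<^sup>2) \<le> 2 * L (Suc (Suc k))"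
      have H: "1 \<le> poly_height (?P k)" by (rule poly_height_ge_1[OF fix_poly_nonzero])
      have HQ: "poly_height (?P k) \<le> Q (Suc k)"
      proof -
        have "poly_height (?P k) \<le> m00 (M (Suc k))"
          using abs_coeff_fix_poly_M[of "Suc k"] by (intro poly_height_le) (simp add: Q_def flip: of_int_abs)
        thus ?thesis by (simp add: Q_def)
      qed
      have "\<bar>ipoly (?P k) \<xi>\<bar> \<le> 2 * C\<^sup>2 / (Q (Suc k) * (Q (Suc (Suc k)))\<^sup>2)"
        using k by (intro fix_poly_small) auto
      also have "\<dots> \<le> Q (Suc k) powr (- w)"
      proof (rule le_powrI)
        have "ln (2 * C\<^sup>2 / (Q (Suc k) * (Q (Suc (Suc k)))\<^sup>2)) =
          ln (2 * C\<^sup>2) - L (Suc k) - 2 * L (Suc (Suc k))"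
          using C_pos Q_pos[of "Suc k"] Q_pos[of "Suc (Suc k)"]
          by (simp add: ln_div ln_mult ln_realpow L_def)
        also have "\<dots> \<le> - w * ln (Q (Suc k))" using k by (simp add: L_def algebra_simps)
        finally show "ln (2 * C\<^sup>2 / (Q (Suc k) * (Q (Suc (Suc k)))\<^sup>2)) \<le> - w * ln (Q (Suc k))" .
      qed (use C_pos Q_pos[of "Suc k"] Q_pos[of "Suc (Suc k)"] in auto)
      \<comment> \<open>The exponent is negative, so passing from \<open>Q\<close> to the possibly
        smaller height only weakens the bound.\<close>
      also have "\<dots> \<le> poly_height (?P k) powr (- w)"
        using H HQ w by (intro powr_mono2') auto
      finally show "?P k \<in> ?S"
        using degree_fix_poly ipoly_xi_nonzero[OF fix_poly_nonzero degree_fix_poly] by auto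
    qed
    have "\<forall>\<^sub>F k in sequentially. \<bar>ipoly (?P k) \<xi>\<bar> \<le> 2 * C\<^sup>2 / Q (Suc k)"
      using C_le_Q_eventually
    proof eventually_elim
      case (elim k)
      have "Q (Suc k) * 1 \<le> Q (Suc k) * (Q (Suc (Suc k)))\<^sup>2"
        using Q_pos[of "Suc k"] Q_ge_1[of "Suc (Suc k)"] by (intro mult_left_mono) auto
      hence "2 * C\<^sup>2 / (Q (Suc k) * (Q (Suc (Suc k)))\<^sup>2) \<le> 2 * C\<^sup>2 / Q (Suc k)"
        using Q_pos[of "Suc k"] Q_pos[of "Suc (Suc k)"] by (intro divide_left_mono) auto
      thus ?case using fix_poly_small[OF elim] by linarith
    qed
    thus "(\<lambda>k. \<bar>ipoly (?P k) \<xi>\<bar>) \<longlonglongrightarrow> 0" by (rule tendsto_0_bound_Q)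
  qed auto
  thus "w \<in> {w. infinite {p :: int poly. degree p \<le> 2 \<and>
       0 < \<bar>ipoly p \<xi>\<bar> \<and> \<bar>ipoly p \<xi>\<bar> \<le> of_int (poly_height p) powr (- w)}}" by blast
qed

text \<open>Chosen for every \<open>k\<close>; its properties are available once
  \<open>C \<le> Q (k+1)\<close>.\<close>

definition \<alpha> :: "nat \<Rightarrow> real" where
  "\<alpha> k = (SOME \<alpha>. algebraic \<alpha> \<and> alg_degree \<alpha> \<le> 2 \<and> 1 \<le> alg_height \<alpha> \<and> alg_height \<alpha> \<le> Q (Suc k) \<and>
    0 < \<bar>\<xi> - \<alpha>\<bar> \<and> \<bar>\<xi> - \<alpha>\<bar> \<le> D / ((Q (Suc k))\<^sup>2 * (Q (Suc (Suc k)))\<^sup>2))"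

lemma \<alpha>_props:
  assumes "C \<le> Q (Suc k)"
  shows "algebraic (\<alpha> k)" "alg_degree (\<alpha> k) \<le> 2" "1 \<le> alg_height (\<alpha> k)"
    "alg_height (\<alpha> k) \<le> Q (Suc k)" "0 < \<bar>\<xi> - \<alpha> k\<bar>"
    "\<bar>\<xi> - \<alpha> k\<bar> \<le> D / ((Q (Suc k))\<^sup>2 * (Q (Suc (Suc k)))\<^sup>2)"
  using someI_ex[OF quadratic_approximation[OF assms]] unfolding \<alpha>_def[symmetric] by auto

lemma ln_\<alpha>_bound:
  "ln (D / ((Q (Suc k))\<^sup>2 * (Q (Suc (Suc k)))\<^sup>2)) = ln D - 2 * L (Suc k) - 2 * L (Suc (Suc k))"
  using D_pos Q_pos[of "Suc k"] Q_pos[of "Suc (Suc k)"] by (simp add: ln_div ln_mult ln_realpow L_def)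

lemma \<alpha>_bound_pos: "0 < D / ((Q (Suc k))\<^sup>2 * (Q (Suc (Suc k)))\<^sup>2)"
  using D_pos Q_pos[of "Suc k"] Q_pos[of "Suc (Suc k)"] by simp

lemma exp_w_star_ge: "1 + 2 / sturm_sigma s \<le> exp_w_star 2 \<xi>"
  unfolding exp_w_star_def
proof (rule le_Sup_ereal_image[OF one_less_w_bound])
  fix w assume w: "1 < w" "ereal w < 1 + 2 / sturm_sigma s"
  let ?S = "{\<alpha> :: real. algebraic \<alpha> \<and> alg_degree \<alpha> \<le> 2 \<and>
       0 < \<bar>\<xi> - \<alpha>\<bar> \<and> \<bar>\<xi> - \<alpha>\<bar> \<le> of_int (alg_height \<alpha>) powr (- w - 1)}"
  have "infinite ?S"
  proof (rule infinite_if_frequently_small[where f = \<alpha> and g = "\<lambda>x. \<bar>\<xi> - x\<bar>" and F = sequentially])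
    show "\<exists>\<^sub>F k in sequentially. \<alpha> k \<in> ?S"
    proof (rule frequently_elim1[OF frequently_w[OF w(1) less_w_bound[OF w], of "ln D"]])
      fix k assume k: "C \<le> Q (Suc k) \<and> (w - 1) * L (Suc k) + ln D \<le> 2 * L (Suc (Suc k))"
      hence \<alpha>: "C \<le> Q (Suc k)" by blast
      note \<alpha>_props(6)[OF \<alpha>]
      also have "D / ((Q (Suc k))\<^sup>2 * (Q (Suc (Suc k)))\<^sup>2) \<le> Q (Suc k) powr (- w - 1)"
      proof (rule le_powrI[OF \<alpha>_bound_pos Q_pos])
        show "ln (D / ((Q (Suc k))\<^sup>2 * (Q (Suc (Suc k)))\<^sup>2)) \<le> (- w - 1) * ln (Q (Suc k))"
          unfolding ln_\<alpha>_bound L_def[symmetric] using k by (simp add: algebra_simps)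
      qed
      also have "\<dots> \<le> alg_height (\<alpha> k) powr (- w - 1)"
        using \<alpha>_props(3,4)[OF \<alpha>] w by (intro powr_mono2') auto
      finally show "\<alpha> k \<in> ?S" using \<alpha>_props[OF \<alpha>] by simp
    qed
    have "\<forall>\<^sub>F k in sequentially. \<bar>\<xi> - \<alpha> k\<bar> \<le> D / Q (Suc k)"
      using C_le_Q_eventually
    proof eventually_elim
      case (elim k)
      have "Q (Suc k) * 1 \<le> (Q (Suc k))\<^sup>2 * (Q (Suc (Suc k)))\<^sup>2"
        using Q_ge_1[of "Suc k"] Q_ge_1[of "Suc (Suc k)"]
        by (intro mult_mono) (auto simp: one_le_power self_le_power)
      hence "D / ((Q (Suc k))\<^sup>2 * (Q (Suc (Suc k)))\<^sup>2) \<le> D / Q (Suc k)"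
        using Q_pos[of "Suc k"] Q_pos[of "Suc (Suc k)"] D_pos by (intro divide_left_mono) auto
      thus ?case using \<alpha>_props(6)[OF elim] by linarith
    qed
    thus "(\<lambda>k. \<bar>\<xi> - \<alpha> k\<bar>) \<longlonglongrightarrow> 0" by (rule tendsto_0_bound_Q)
  qed auto
  thus "w \<in> {w. infinite {\<alpha> :: real. algebraic \<alpha> \<and> alg_degree \<alpha> \<le> 2 \<and>
       0 < \<bar>\<xi> - \<alpha>\<bar> \<and> \<bar>\<xi> - \<alpha>\<bar> \<le> of_int (alg_height \<alpha>) powr (- w - 1)}}" by blast
qed

lemma less_w_hat_bound: "ereal w < 2 + sturm_sigma s \<Longrightarrow> w - 2 < \<sigma>"
  by (simp add: sturm_sigma_eq numeral_eq_ereal)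

text \<open>On \<open>Q (k+1) \<le> X < Q (k+2)\<close> one polynomial, or one quadratic number,
  serves for all \<open>X\<close>. The worst case is the right end, whence the comparison with
  \<open>L (k+2)\<close>.\<close>

lemma eventually_uniform:
  assumes w: "w - 2 < \<sigma>"
  shows "\<forall>\<^sub>F X in at_top. \<exists>k. C \<le> Q (Suc k) \<and> Q (Suc k) \<le> X \<and> X < Q (Suc (Suc k)) \<and>
    (w - 2) * L (Suc (Suc k)) + B \<le> L (Suc k)"
proof -
  obtain N where N: "\<And>k. k \<ge> N \<Longrightarrow> C \<le> Q (Suc k) \<and> (w - 2) * L (Suc (Suc k)) + B \<le> L (Suc k)"
    using eventually_conj[OF C_le_Q_eventually L_ratio_lower[OF w, of B]]
    unfolding eventually_sequentially by blast
  show ?thesis using eventually_between[OF Q_Suc_at_top(1), of N]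
    by eventually_elim (use N in blast)
qed

lemma zero_less_w_hat_bound: "ereal 0 < 2 + sturm_sigma s"
  using sigma_nonneg by (simp add: sturm_sigma_eq numeral_eq_ereal)

lemma exp_w_hat_ge: "2 + sturm_sigma s \<le> exp_w_hat 2 \<xi>"
  unfolding exp_w_hat_def
proof (rule le_Sup_ereal_image[OF zero_less_w_hat_bound])
  fix w assume w: "0 < w" "ereal w < 2 + sturm_sigma s"
  have "\<forall>\<^sub>F X :: real in at_top. \<exists>x :: nat \<Rightarrow> int.
       0 < \<bar>\<Sum>m\<le>2. of_int (x m) * \<xi> ^ m\<bar> \<and>
       \<bar>\<Sum>m\<le>2. of_int (x m) * \<xi> ^ m\<bar> \<le> X powr (- w) \<and>
       (MAX m\<in>{..2}. \<bar>of_int (x m)\<bar>) \<le> X"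
    using eventually_uniform[OF less_w_hat_bound[OF w(2)], of "ln (2 * C\<^sup>2)"]
  proof eventually_elim
    case (elim X)
    then obtain k where k: "C \<le> Q (Suc k)" "Q (Suc k) \<le> X" "X < Q (Suc (Suc k))"
      "(w - 2) * L (Suc (Suc k)) + ln (2 * C\<^sup>2) \<le> L (Suc k)" by blast
    define P where "P = fix_poly (M (Suc k))"
    have P: "P \<noteq> 0" "degree P \<le> 2" unfolding P_def by (rule fix_poly_nonzero degree_fix_poly)+
    have eq: "(\<Sum>m\<le>2. of_int (coeff P m) * \<xi> ^ m) = ipoly P \<xi>"
      by (simp add: ipoly_deg2[OF P(2)] numeral_2_eq_2)
    have X: "0 < X" using k(2) Q_pos[of "Suc k"] by linarith
    have "\<bar>ipoly P \<xi>\<bar> \<le> 2 * C\<^sup>2 / (Q (Suc k) * (Q (Suc (Suc k)))\<^sup>2)"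
      unfolding P_def by (rule fix_poly_small[OF k(1)])
    also have "\<dots> \<le> Q (Suc (Suc k)) powr (- w)"
    proof (rule le_powrI)
      have "ln (2 * C\<^sup>2 / (Q (Suc k) * (Q (Suc (Suc k)))\<^sup>2)) =
        ln (2 * C\<^sup>2) - L (Suc k) - 2 * L (Suc (Suc k))"
        using C_pos Q_pos[of "Suc k"] Q_pos[of "Suc (Suc k)"]
        by (simp add: ln_div ln_mult ln_realpow L_def)
      also have "\<dots> \<le> - w * ln (Q (Suc (Suc k)))" using k(4) by (simp add: L_def algebra_simps)
      finally show "ln (2 * C\<^sup>2 / (Q (Suc k) * (Q (Suc (Suc k)))\<^sup>2)) \<le> - w * ln (Q (Suc (Suc k)))" .
    qed (use C_pos Q_pos[of "Suc k"] Q_pos[of "Suc (Suc k)"] in auto)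
    also have "\<dots> \<le> X powr (- w)" using X k(3) w by (intro powr_mono2') auto
    finally have 1: "\<bar>ipoly P \<xi>\<bar> \<le> X powr (- w)" .
    have 2: "(MAX m\<in>{..2}. \<bar>real_of_int (coeff P m)\<bar>) \<le> X"
      using abs_coeff_fix_poly_M[of "Suc k"] k(2) unfolding P_def
      by (subst Max_le_iff) (auto intro: order_trans)
    show ?case using 1 2 ipoly_xi_nonzero[OF P] unfolding eq[symmetric] by (intro exI[of _ "coeff P"]) simp
  qed
  thus "w \<in> {w. \<forall>\<^sub>F X :: real in at_top. \<exists>x :: nat \<Rightarrow> int.
       0 < \<bar>\<Sum>m\<le>2. of_int (x m) * \<xi> ^ m\<bar> \<and>
       \<bar>\<Sum>m\<le>2. of_int (x m) * \<xi> ^ m\<bar> \<le> X powr (- w) \<and>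
       (MAX m\<in>{..2}. \<bar>of_int (x m)\<bar>) \<le> X}" by blast
qed

lemma exp_w_hat_star_ge: "2 + sturm_sigma s \<le> exp_w_hat_star 2 \<xi>"
  unfolding exp_w_hat_star_def
proof (rule le_Sup_ereal_image[OF zero_less_w_hat_bound])
  fix w assume w: "0 < w" "ereal w < 2 + sturm_sigma s"
  have "\<forall>\<^sub>F X :: real in at_top. \<exists>\<alpha> :: real. algebraic \<alpha> \<and> alg_degree \<alpha> \<le> 2 \<and>
       0 < \<bar>\<xi> - \<alpha>\<bar> \<and> \<bar>\<xi> - \<alpha>\<bar> \<le> inverse (of_int (alg_height \<alpha>)) * X powr (- w) \<and>
       of_int (alg_height \<alpha>) \<le> X"
    using eventually_uniform[OF less_w_hat_bound[OF w(2)], of "ln D"]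
  proof eventually_elim
    case (elim X)
    then obtain k where k: "C \<le> Q (Suc k)" "Q (Suc k) \<le> X" "X < Q (Suc (Suc k))"
      "(w - 2) * L (Suc (Suc k)) + ln D \<le> L (Suc k)" by blast
    define H where "H = real_of_int (alg_height (\<alpha> k))"
    have H: "1 \<le> H" "H \<le> Q (Suc k)" using \<alpha>_props(3,4)[OF k(1)] by (auto simp: H_def)
    have X: "0 < X" using k(2) Q_pos[of "Suc k"] by linarith
    have "Q (Suc k) * (D / ((Q (Suc k))\<^sup>2 * (Q (Suc (Suc k)))\<^sup>2)) \<le> Q (Suc (Suc k)) powr (- w)"
    proof (rule le_powrI)
      have "ln (Q (Suc k) * (D / ((Q (Suc k))\<^sup>2 * (Q (Suc (Suc k)))\<^sup>2))) =
          L (Suc k) + (ln D - 2 * L (Suc k) - 2 * L (Suc (Suc k)))"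
      proof -
        have "ln (x * y) = ln x + ln y" if "0 < x" "0 < y" for x y :: real
          using that by (simp add: ln_mult)
        from this[OF Q_pos \<alpha>_bound_pos] show ?thesis unfolding ln_\<alpha>_bound L_def[symmetric] .
      qed
      also have "\<dots> \<le> - w * ln (Q (Suc (Suc k)))" using k(4) by (simp add: L_def algebra_simps)
      finally show "ln (Q (Suc k) * (D / ((Q (Suc k))\<^sup>2 * (Q (Suc (Suc k)))\<^sup>2))) \<le>
          - w * ln (Q (Suc (Suc k)))" .
      show "0 < Q (Suc k) * (D / ((Q (Suc k))\<^sup>2 * (Q (Suc (Suc k)))\<^sup>2))"
        by (rule mult_pos_pos[OF Q_pos \<alpha>_bound_pos])
    qed (rule Q_pos)
    also have "\<dots> \<le> X powr (- w)" using X k(3) w by (intro powr_mono2') auto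
    finally have 1: "Q (Suc k) * (D / ((Q (Suc k))\<^sup>2 * (Q (Suc (Suc k)))\<^sup>2)) \<le> X powr (- w)" .
    have "H * \<bar>\<xi> - \<alpha> k\<bar> \<le> Q (Suc k) * (D / ((Q (Suc k))\<^sup>2 * (Q (Suc (Suc k)))\<^sup>2))"
      using H \<alpha>_props(6)[OF k(1)] by (intro mult_mono) auto
    hence "H * \<bar>\<xi> - \<alpha> k\<bar> \<le> X powr (- w)" using 1 by (rule order_trans)
    hence "\<bar>\<xi> - \<alpha> k\<bar> \<le> inverse H * X powr (- w)" using H by (simp add: field_simps)
    thus ?case using \<alpha>_props[OF k(1)] k(2) unfolding H_def by (intro exI[of _ "\<alpha> k"]) linarith
  qed
  thus "w \<in> {w. \<forall>\<^sub>F X :: real in at_top. \<exists>\<alpha> :: real. algebraic \<alpha> \<and> alg_degree \<alpha> \<le> 2 \<and>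
       0 < \<bar>\<xi> - \<alpha>\<bar> \<and> \<bar>\<xi> - \<alpha>\<bar> \<le> inverse (of_int (alg_height \<alpha>)) * X powr (- w) \<and>
       of_int (alg_height \<alpha>) \<le> X}" by blast
qed

section \<open>Simultaneous approximation\<close>

lemma exp_lambda_le: "exp_lambda 2 \<xi> \<le> 1"
  unfolding exp_lambda_def
proof (rule Sup_least)
  let ?S = "\<lambda>l. {x \<in> {..2} \<rightarrow>\<^sub>E (UNIV :: int set). x 0 \<noteq> 0 \<and>
       (MAX m\<in>{1..2}. \<bar>of_int (x 0) * \<xi> ^ m - of_int (x m)\<bar>) \<le> \<bar>of_int (x 0)\<bar> powr (- l)}"
  fix y assume "y \<in> ereal ` {l. infinite (?S l)}"
  then obtain l where l: "y = ereal l" and inf: "infinite (?S l)" by blast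
  have "l \<le> 1"
  proof (rule ccontr)
    assume "\<not> l \<le> 1"
    hence l1: "l > 1" by simp
    \<comment> \<open>Bad approximability bounds \<open>\<bar>x 0\<bar>\<close> by this power when
      \<open>l > 1\<close>; the added 1 leaves room for the errors of \<open>x 1\<close> and
      \<open>x 2\<close>.\<close>
    define T where "T = \<lceil>(4 * C) powr (1 / (l - 1))\<rceil> + 1"
    have "?S l \<subseteq> {..2} \<rightarrow>\<^sub>E {-T..T}"
    proof
      fix x assume x: "x \<in> ?S l"
      define z where "z = \<bar>real_of_int (x 0)\<bar>"
      have z1: "1 \<le> z" using x by (auto simp: z_def)
      have e: "\<bar>x 0 * \<xi> - x 1\<bar> \<le> z powr (- l)" "\<bar>x 0 * \<xi>\<^sup>2 - x 2\<bar> \<le> z powr (- l)"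
        using x unfolding mem_Collect_eq Max_1_2_le_iff z_def by simp_all
      have "1 / (4 * C * z) \<le> z powr (- l)"
        using badly_approximable[of "x 0" "x 1"] x e unfolding z_def by auto
      hence "z \<le> 4 * C * (z * (z * z powr (- l)))" using z1 C_pos by (simp add: field_simps)
      hence "z * z powr (l - 1) \<le> 4 * C * z"
        using z1 by (simp add: powr_diff powr_minus field_simps)
      hence "z powr (l - 1) \<le> 4 * C" using z1 by simp
      hence "(z powr (l - 1)) powr (1 / (l - 1)) \<le> (4 * C) powr (1 / (l - 1))"
        using l1 by (intro powr_mono2) auto
      hence zT: "z \<le> (4 * C) powr (1 / (l - 1))" using l1 z1 by (simp add: powr_powr)
      have "z powr (- l) \<le> z powr 0" using z1 l1 by (intro powr_mono) auto
      hence le1: "z powr (- l) \<le> 1" using z1 by simp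
      have "\<bar>x 0 * \<xi>\<bar> \<le> z" "\<bar>x 0 * \<xi>\<^sup>2\<bar> \<le> z"
        unfolding abs_mult z_def using xi_bounds by (auto intro!: mult_left_le simp: power_le_one)
      hence "\<bar>real_of_int (x 1)\<bar> \<le> z + 1" "\<bar>real_of_int (x 2)\<bar> \<le> z + 1" "\<bar>real_of_int (x 0)\<bar> \<le> z + 1"
        using e le1 unfolding z_def by linarith+
      hence "\<bar>x 0\<bar> \<le> T" "\<bar>x 1\<bar> \<le> T" "\<bar>x 2\<bar> \<le> T" using zT unfolding T_def by linarith+
      moreover have "i \<le> 2 \<Longrightarrow> i = 0 \<or> i = 1 \<or> i = 2" for i :: nat by auto
      ultimately have "\<bar>x i\<bar> \<le> T" if "i \<le> 2" for i using that by metis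
      hence "x i \<in> {-T..T}" if "i \<le> 2" for i using that by (fastforce simp: abs_le_iff)
      thus "x \<in> {..2} \<rightarrow>\<^sub>E {-T..T}" using x by (auto simp: PiE_iff)
    qed
    moreover have "finite ({..2::nat} \<rightarrow>\<^sub>E {-T..T})" by (rule finite_PiE) auto
    ultimately show False using inf finite_subset by blast
  qed
  thus "y \<le> 1" using l by simp
qed

text \<open>Restricted to \<open>{..2}\<close> because \<open>exp_lambda\<close> counts extensional
  tuples.\<close>

definition point :: "mat2 \<Rightarrow> nat \<Rightarrow> int" where
  "point Y = (\<lambda>i\<in>{..2}. if i = 0 then m00 Y else if i = 1 then m01 Y else m11 Y)"

lemma point_simps [simp]: "point Y 0 = m00 Y" "point Y (Suc 0) = m01 Y" "point Y 2 = m11 Y"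
  by (simp_all add: point_def)

text \<open>The points \<open>Pal (k+1)\<close> have size of order \<open>Q (k+1)\<close> and errors
  at most of order \<open>1 / Q (k+1)\<close>.\<close>

lemma exp_lambda_ge: "1 \<le> exp_lambda 2 \<xi>"
  unfolding exp_lambda_def
proof (rule le_Sup_ereal_image[of 0])
  fix l :: real assume l0: "0 < l" and "ereal l < 1"
  hence l1: "l < 1" by simp
  let ?S = "{x \<in> {..2} \<rightarrow>\<^sub>E (UNIV :: int set). x 0 \<noteq> 0 \<and>
       (MAX m\<in>{1..2}. \<bar>of_int (x 0) * \<xi> ^ m - of_int (x m)\<bar>) \<le> \<bar>of_int (x 0)\<bar> powr (- l)}"
  note pt = approx_point[OF approx_mat_M Pal_def msym_Pal, folded Q_def]
  have "infinite ?S"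
  proof (rule infinite_if_frequently_small[where f = "\<lambda>k. point (Pal (Suc k))"
        and g = "\<lambda>x. \<bar>x 0 * \<xi> - x 1\<bar>" and F = sequentially])
    have "\<forall>\<^sub>F k in sequentially. (1 + l) * ln C / (1 - l) \<le> L (Suc k)"
      using L_eventually_ge eventually_sequentially_Suc[of "\<lambda>k. (1 + l) * ln C / (1 - l) \<le> L k"] by blast
    with C_le_Q_eventually have "\<forall>\<^sub>F k in sequentially. point (Pal (Suc k)) \<in> ?S"
    proof eventually_elim
      case (elim k)
      let ?Y = "Pal (Suc k)"
      have "Q (Suc k) \<le> C * m00 ?Y" by (rule pt(4)[OF elim(1)])
      hence "0 < C * m00 ?Y" using Q_pos[of "Suc k"] by linarith
      hence y0: "0 < real_of_int (m00 ?Y)" using C_pos zero_less_mult_pos by blast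
      have "C / Q (Suc k) \<le> (C * Q (Suc k)) powr (- l)"
      proof (rule le_powrI)
        have "(1 + l) * ln C \<le> (1 - l) * L (Suc k)" using elim(2) l1 by (simp add: pos_divide_le_eq mult.commute)
        hence "ln C - L (Suc k) \<le> - l * (ln C + L (Suc k))" by (simp add: algebra_simps)
        thus "ln (C / Q (Suc k)) \<le> - l * ln (C * Q (Suc k))"
          using C_pos Q_pos[of "Suc k"] by (simp add: ln_div ln_mult L_def)
      qed (use C_pos Q_pos in auto)
      also have "\<dots> \<le> \<bar>real_of_int (m00 ?Y)\<bar> powr (- l)"
        using pt(3)[of k] y0 l0 by (intro powr_mono2') auto
      finally have "C / Q (Suc k) \<le> \<bar>real_of_int (m00 ?Y)\<bar> powr (- l)" .
      with pt(1,2)[of k] y0 show ?case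
        unfolding mem_Collect_eq Max_1_2_le_iff by (auto simp: point_def)
    qed
    thus "\<exists>\<^sub>F k in sequentially. point (Pal (Suc k)) \<in> ?S"
      by (rule eventually_frequently[OF sequentially_bot])
    show "0 < \<bar>x 0 * \<xi> - x 1\<bar>" if "x \<in> ?S" for x
    proof -
      have "x 0 \<noteq> 0" using that by blast
      hence "0 < 1 / (4 * C * \<bar>real_of_int (x 0)\<bar>)" using C_pos by simp
      also have "\<dots> \<le> \<bar>x 0 * \<xi> - x 1\<bar>" by (rule badly_approximable[OF \<open>x 0 \<noteq> 0\<close>])
      finally show ?thesis .
    qed
    show "(\<lambda>k. \<bar>point (Pal (Suc k)) 0 * \<xi> - point (Pal (Suc k)) 1\<bar>) \<longlonglongrightarrow> 0"
      using pt(1) by (intro tendsto_0_bound_Q[of _ C] always_eventually) simp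
  qed
  thus "l \<in> {l. infinite {x \<in> {..2} \<rightarrow>\<^sub>E (UNIV :: int set). x 0 \<noteq> 0 \<and>
       (MAX m\<in>{1..2}. \<bar>of_int (x 0) * \<xi> ^ m - of_int (x m)\<bar>) \<le> \<bar>of_int (x 0)\<bar> powr (- l)}}" by blast
qed simp

lemma lambda_hat_bound_eq: "(1 + sturm_sigma s) / (2 + sturm_sigma s) = ereal ((1 + \<sigma>) / (2 + \<sigma>))"
  using sigma_nonneg by (simp add: sturm_sigma_eq one_ereal_def numeral_eq_ereal)

lemma lambda_hat_bound_iff:
  "l \<le> (1 + \<sigma>) / (2 + \<sigma>) \<longleftrightarrow> 2 * l - 1 \<le> (1 - l) * \<sigma>"
  "l < (1 + \<sigma>) / (2 + \<sigma>) \<longleftrightarrow> 2 * l - 1 < (1 - l) * \<sigma>"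
  using sigma_nonneg by (simp_all add: pos_le_divide_eq pos_less_divide_eq algebra_simps)

lemma exp_lambda_hat_le: "exp_lambda_hat 2 \<xi> \<le> (1 + sturm_sigma s) / (2 + sturm_sigma s)"
  unfolding exp_lambda_hat_def
proof (rule Sup_least)
  let ?ev = "\<lambda>l. \<forall>\<^sub>F X :: real in at_top. \<exists>x :: nat \<Rightarrow> int.
       0 < \<bar>x 0\<bar> \<and> of_int \<bar>x 0\<bar> \<le> X \<and>
       (MAX m\<in>{1..2}. \<bar>of_int (x 0) * \<xi> ^ m - of_int (x m)\<bar>) \<le> X powr (- l)"
  fix y assume "y \<in> ereal ` {l. ?ev l}"
  then obtain l where l: "y = ereal l" and ev: "?ev l" by blast
  define B0 where "B0 = (1 + l) * ln (8 * C\<^sup>2)"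
  \<comment> \<open>The largest size of \<open>x 0\<close> that
    \<open>simultaneous_lower_bound\<close> admits.\<close>
  let ?X = "\<lambda>k. (Q (Suc (Suc k)))\<^sup>2 * Q (Suc k) / (8 * C\<^sup>2)"
  have "filterlim ?X at_top sequentially"
  proof -
    have "filterlim (\<lambda>k. 1 / (8 * C\<^sup>2) * Q (Suc k)) at_top sequentially"
      using C_pos by (intro filterlim_tendsto_pos_mult_at_top[OF tendsto_const] Q_Suc_at_top) auto
    moreover have "1 / (8 * C\<^sup>2) * Q (Suc k) \<le> ?X k" for k
    proof -
      have "1 * Q (Suc k) \<le> (Q (Suc (Suc k)))\<^sup>2 * Q (Suc k)"
        using Q_ge_1[of "Suc (Suc k)"] Q_pos[of "Suc k"] by (intro mult_right_mono) (auto simp: one_le_power)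
      thus ?thesis using C_pos by (simp add: divide_right_mono)
    qed
    ultimately show ?thesis by (rule filterlim_at_top_mono[OF _ always_eventually[OF allI]])
  qed
  from eventually_compose_filterlim[OF ev this] C_le_Q_eventually
  have ev': "\<forall>\<^sub>F k in sequentially. (2 * l - 1) * L (Suc (Suc k)) \<le> (1 - l) * L (Suc k) + B0"
  proof eventually_elim
    case (elim k)
    then obtain x :: "nat \<Rightarrow> int" where x: "x 0 \<noteq> 0" "\<bar>x 0\<bar> \<le> ?X k"
      "\<bar>x 0 * \<xi> - x 1\<bar> \<le> ?X k powr (- l)" "\<bar>x 0 * \<xi>\<^sup>2 - x 2\<bar> \<le> ?X k powr (- l)"
      unfolding Max_1_2_le_iff by auto
    note Qp = Q_pos[of "Suc k"] Q_pos[of "Suc (Suc k)"]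
    have "1 / (8 * C\<^sup>2 * Q (Suc (Suc k)) * Q (Suc k)) \<le> 1 * ?X k powr (- l)"
      using simultaneous_lower_bound[OF elim(2) x] by simp
    hence "ln (1 / (8 * C\<^sup>2 * Q (Suc (Suc k)) * Q (Suc k))) \<le> ln 1 + (- l) * ln (?X k)"
      using C_pos Qp by (intro le_mult_powrD) auto
    moreover have "ln (1 / (8 * C\<^sup>2 * Q (Suc (Suc k)) * Q (Suc k))) =
        - ln (8 * C\<^sup>2) - L (Suc (Suc k)) - L (Suc k)"
      using C_pos Qp by (simp add: ln_div ln_mult ln_realpow L_def)
    moreover have "ln (?X k) = 2 * L (Suc (Suc k)) + L (Suc k) - ln (8 * C\<^sup>2)"
      using C_pos Qp by (simp add: ln_div ln_mult ln_realpow L_def)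
    ultimately have "- ln (8 * C\<^sup>2) - L (Suc (Suc k)) - L (Suc k) \<le>
        (- l) * (2 * L (Suc (Suc k)) + L (Suc k) - ln (8 * C\<^sup>2))" by simp
    thus ?case unfolding B0_def by (simp add: algebra_simps)
  qed
  have "2 * l - 1 \<le> (1 - l) * \<sigma>"
  proof (rule ccontr)
    assume neg: "\<not> ?thesis"
    \<comment> \<open>For \<open>l < 1\<close>, \<open>ev'\<close> bounds the ratio of successive
      \<open>L\<close> from below. For \<open>l \<ge> 1\<close> its left side is at least
      \<open>L (k+2)\<close> and its right side at most \<open>B0\<close>, although \<open>L\<close>
      is unbounded.\<close>
    show False
    proof (cases "l < 1")
      case True
      define \<rho> where "\<rho> = (2 * l - 1) / (1 - l)"
      have "\<sigma> < \<rho>" using neg True by (simp add: \<rho>_def field_simps)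
      from frequently_eventually_frequently[OF L_ratio_upper[OF this, of "(B0 + 1) / (1 - l)"] ev']
      obtain k where k: "L (Suc k) + (B0 + 1) / (1 - l) \<le> \<rho> * L (Suc (Suc k))"
        "(2 * l - 1) * L (Suc (Suc k)) \<le> (1 - l) * L (Suc k) + B0" by (auto dest!: frequently_ex)
      have "L (Suc k) + (B0 + 1) / (1 - l) = ((1 - l) * L (Suc k) + (B0 + 1)) / (1 - l)"
        using True by (simp add: add_divide_distrib)
      moreover have "\<rho> * L (Suc (Suc k)) = (2 * l - 1) * L (Suc (Suc k)) / (1 - l)" by (simp add: \<rho>_def)
      ultimately have "(1 - l) * L (Suc k) + (B0 + 1) \<le> (2 * l - 1) * L (Suc (Suc k))"
        using k(1) True by (simp add: divide_le_cancel)
      thus False using k(2) by linarith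
    next
      case False
      have "\<forall>\<^sub>F k in sequentially. max 0 B0 + 1 \<le> L (Suc (Suc k))"
        by (rule eventually_compose_filterlim[OF L_eventually_ge filterlim_Suc_Suc])
      from eventually_conj[OF this ev'] obtain k where
        k: "max 0 B0 + 1 \<le> L (Suc (Suc k))" "(2 * l - 1) * L (Suc (Suc k)) \<le> (1 - l) * L (Suc k) + B0"
        by (auto simp: eventually_sequentially)
      have "1 * L (Suc (Suc k)) \<le> (2 * l - 1) * L (Suc (Suc k))"
        using False L_nonneg by (intro mult_right_mono) auto
      moreover have "(1 - l) * L (Suc k) \<le> 0"
        using False L_nonneg[of "Suc k"] by (intro mult_nonpos_nonneg) auto
      ultimately show False using k by linarith
    qed
  qed
  thus "y \<le> (1 + sturm_sigma s) / (2 + sturm_sigma s)"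
    unfolding l lambda_hat_bound_eq by (simp add: lambda_hat_bound_iff)
qed

text \<open>The \<open>s k\<close> may be large, so the points coming from \<open>m (k+2)\<close>
  followed by \<open>m (k+1)\<close> alone are too sparse. Those coming from \<open>i\<close> copies
  of \<open>m (k+2)\<close> followed by \<open>m (k+1)\<close>, for
  \<open>1 \<le> i \<le> s (k+3)\<close>, fill the gaps: one step multiplies \<open>q i\<close> by
  at most \<open>2 * Q (k+2)\<close>. The last one with \<open>C * q i \<le> X\<close> is
  taken.\<close>

lemma power_point:
  fixes k :: nat and X :: real
  assumes CQ: "C \<le> Q (Suc k)"
    and X: "C * m00 (M (Suc (Suc k)) * M (Suc k)) \<le> X"
      "X < C * m00 (M (Suc (Suc (Suc k))) * M (Suc (Suc k)))"
  shows "\<exists>q Y. Q (Suc (Suc k)) * Q (Suc k) \<le> q \<and> X \<le> 2 * C * Q (Suc (Suc k)) * q \<and>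
    0 < m00 Y \<and> m00 Y \<le> X \<and> \<bar>m00 Y * \<xi> - m01 Y\<bar> \<le> C / q \<and> \<bar>m00 Y * \<xi>\<^sup>2 - m11 Y\<bar> \<le> C / q"
proof -
  let ?K = "Suc (Suc k)"
  let ?n = "s (Suc ?K)"
  define W where "W i = M ?K ^ i * M (Suc k)" for i
  define q where "q i = real_of_int (m00 (W i))" for i
  have n: "1 \<le> ?n" by (rule s_pos) simp
  have dom: "mat_dominant (W i)" for i
    unfolding W_def by (rule m00_power_mult_bounds[OF mat_dominant_M mat_dominant_M])
  have qS: "q (Suc i) \<le> 2 * Q ?K * q i" "q i \<le> q (Suc i)" for i
  proof -
    have WS: "W (Suc i) = M ?K * W i" by (simp add: W_def mult.assoc)
    note b = m00_mult_bounds[OF mat_dominant_M[of ?K] dom[of i]]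
    have "real_of_int (m00 (W (Suc i))) \<le> real_of_int (2 * m00 (M ?K) * m00 (W i))"
      unfolding WS using b(2) by (simp only: of_int_le_iff)
    thus "q (Suc i) \<le> 2 * Q ?K * q i" by (simp add: q_def Q_def)
    have "real_of_int (m00 (M ?K) * m00 (W i)) \<le> real_of_int (m00 (W (Suc i)))"
      unfolding WS using b(1) by (simp only: of_int_le_iff)
    moreover have "1 * q i \<le> Q ?K * q i"
      using Q_ge_1 mat_dominant_pos[OF dom[of i]] by (intro mult_right_mono) (auto simp: q_def)
    ultimately show "q i \<le> q (Suc i)" by (simp add: q_def Q_def)
  qed
  have q1: "Q ?K * Q (Suc k) \<le> q 1" "C * q 1 \<le> X"
    using m00_M_mult(1)[of ?K "Suc k"] X by (simp_all add: q_def W_def)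
  have qn: "q ?n = Q (Suc ?K)" by (simp only: q_def W_def Q_def M_Suc_Suc[of "Suc k"])
  define A where "A = {i. 1 \<le> i \<and> i \<le> ?n \<and> C * q i \<le> X}"
  have A: "finite A" "1 \<in> A" using n q1 by (auto simp: A_def intro: finite_subset[of _ "{..?n}"])
  define i where "i = Max A"
  have "i \<in> A" unfolding i_def using A by (intro Max_in) auto
  hence i: "1 \<le> i" "i \<le> ?n" "C * q i \<le> X" by (auto simp: A_def)
  \<comment> \<open>For \<open>i = ?n\<close> the hypothesis bounds \<open>X\<close> from above;
    otherwise \<open>i + 1\<close> violates \<open>C * q (i + 1) \<le> X\<close> by maximality of
    \<open>i\<close>.\<close>
  have XU: "X \<le> 2 * C * Q ?K * q i"
  proof (cases "i = ?n")
    case True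
    have "C * m00 (M (Suc ?K) * M ?K) \<le> C * (2 * Q (Suc ?K) * Q ?K)"
      using m00_M_mult(2) C_pos by (intro mult_left_mono) auto
    also have "\<dots> = 2 * C * Q ?K * q i" by (simp add: True qn)
    finally show ?thesis using X(2) by linarith
  next
    case False
    have "Suc i \<notin> A" using Max_ge[OF A(1), of "Suc i"] by (auto simp: i_def)
    hence "X \<le> C * q (Suc i)" using False i by (auto simp: A_def)
    also have "\<dots> \<le> C * (2 * Q ?K * q i)" using qS(1) C_pos by (intro mult_left_mono) auto
    finally show ?thesis by (simp add: mult_ac)
  qed
  have "q 1 \<le> q i" using i(1) by (induction rule: dec_induct) (auto intro: order_trans qS(2))
  hence qi: "Q ?K * Q (Suc k) \<le> q i" using q1 by linarith
  have "C \<le> q i"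
  proof -
    have "1 * Q (Suc k) \<le> Q ?K * Q (Suc k)" using Q_ge_1 Q_pos[of "Suc k"] by (intro mult_right_mono) auto
    thus ?thesis using CQ qi by linarith
  qed
  define Y where "Y = M ?K ^ i * Pal (Suc k)"
  have "approx_mat (W i)" unfolding W_def by (rule approx_mat_power[OF i(2)])
  moreover have "Y = W i * Einv (Suc k)" by (simp add: Y_def W_def Pal_def mult.assoc)
  moreover have "msym Y" unfolding Y_def by (rule msym_M_power_Pal)
  ultimately have pt: "\<bar>m00 Y * \<xi> - m01 Y\<bar> \<le> C / q i" "\<bar>m00 Y * \<xi>\<^sup>2 - m11 Y\<bar> \<le> C / q i"
    "\<bar>real_of_int (m00 Y)\<bar> \<le> C * q i" "C \<le> q i \<Longrightarrow> q i \<le> C * m00 Y"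
    unfolding q_def by (rule approx_point)+
  have "0 < C * m00 Y" using pt(4) \<open>C \<le> q i\<close> C_pos by linarith
  hence "0 < real_of_int (m00 Y)" using C_pos zero_less_mult_pos by blast
  thus ?thesis using pt qi XU i(3) by (intro exI[of _ "q i"] exI[of _ Y]) auto
qed

lemma exp_lambda_hat_ge: "(1 + sturm_sigma s) / (2 + sturm_sigma s) \<le> exp_lambda_hat 2 \<xi>"
  unfolding exp_lambda_hat_def
proof (rule le_Sup_ereal_image[of 0])
  show "ereal 0 < (1 + sturm_sigma s) / (2 + sturm_sigma s)"
    unfolding lambda_hat_bound_eq using sigma_nonneg by simp
next
  fix l assume l0: "0 < l" and "ereal l < (1 + sturm_sigma s) / (2 + sturm_sigma s)"
  hence l: "2 * l - 1 < (1 - l) * \<sigma>" "l < (1 + \<sigma>) / (2 + \<sigma>)"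
    unfolding lambda_hat_bound_eq by (simp_all add: lambda_hat_bound_iff)
  have "(1 + \<sigma>) / (2 + \<sigma>) < 1" using sigma_nonneg by simp
  hence l1: "l < 1" using l by linarith
  define \<rho> where "\<rho> = (2 * l - 1) / (1 - l)"
  have \<rho>: "\<rho> < \<sigma>" using l(1) l1 by (simp add: \<rho>_def field_simps)
  define B0 where "B0 = ln C + l * ln (2 * C)"
  obtain N where N: "\<And>k. k \<ge> N \<Longrightarrow> C \<le> Q (Suc k) \<and> \<rho> * L (Suc (Suc k)) + B0 / (1 - l) \<le> L (Suc k)"
    using eventually_conj[OF C_le_Q_eventually L_ratio_lower[OF \<rho>, of "B0 / (1 - l)"]]
    unfolding eventually_sequentially by blast
  let ?f = "\<lambda>k. C * m00 (M (Suc (Suc k)) * M (Suc k))"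
  have "filterlim ?f at_top sequentially"
  proof (rule filterlim_at_top_mono[OF Q_Suc_at_top(1) always_eventually[OF allI]])
    fix k
    have "1 * Q (Suc k) \<le> Q (Suc (Suc k)) * Q (Suc k)"
      using Q_ge_1 Q_pos[of "Suc k"] by (intro mult_right_mono) auto
    hence le: "Q (Suc k) \<le> m00 (M (Suc (Suc k)) * M (Suc k))"
      using m00_M_mult(1)[of "Suc (Suc k)" "Suc k"] by linarith
    hence "1 * real_of_int (m00 (M (Suc (Suc k)) * M (Suc k))) \<le> ?f k"
      using C_ge Q_pos[of "Suc k"] by (intro mult_right_mono) linarith+
    thus "Q (Suc k) \<le> ?f k" using le by linarith
  qed
  from eventually_between[OF this, of N]
  have "\<forall>\<^sub>F X :: real in at_top. \<exists>x :: nat \<Rightarrow> int.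
       0 < \<bar>x 0\<bar> \<and> of_int \<bar>x 0\<bar> \<le> X \<and>
       (MAX m\<in>{1..2}. \<bar>of_int (x 0) * \<xi> ^ m - of_int (x m)\<bar>) \<le> X powr (- l)"
  proof eventually_elim
    case (elim X)
    then obtain k where k: "k \<ge> N" "?f k \<le> X" "X < ?f (Suc k)" by blast
    from power_point[OF _ k(2,3)] N[OF k(1)] obtain q Y where
      q: "Q (Suc (Suc k)) * Q (Suc k) \<le> q" "X \<le> 2 * C * Q (Suc (Suc k)) * q" and
      Y: "0 < m00 Y" "m00 Y \<le> X" "\<bar>m00 Y * \<xi> - m01 Y\<bar> \<le> C / q" "\<bar>m00 Y * \<xi>\<^sup>2 - m11 Y\<bar> \<le> C / q" by blast
    note Qp = Q_pos[of "Suc k"] Q_pos[of "Suc (Suc k)"]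
    have q0: "0 < q" using mult_pos_pos[OF Qp(2,1)] q(1) by linarith
    have X0: "0 < X" using Y(1,2) by linarith
    have lnq: "L (Suc (Suc k)) + L (Suc k) \<le> ln q"
    proof -
      have "ln (Q (Suc (Suc k)) * Q (Suc k)) \<le> ln q" using q(1) q0 Qp by (subst ln_le_cancel_iff) auto
      thus ?thesis using Qp by (simp add: ln_mult L_def)
    qed
    \<comment> \<open>In logarithms: since \<open>ln q \<ge> L (k+2) + L (k+1)\<close>, it suffices
      that \<open>(1 - l) * (L (k+2) + L (k+1)) \<ge> l * L (k+2) + B0\<close>, that is,
      \<open>(1 - l) * L (k+1) \<ge> (2 * l - 1) * L (k+2) + B0\<close>.\<close>
    have "C / q \<le> (2 * C * Q (Suc (Suc k)) * q) powr (- l)"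
    proof (rule le_powrI)
      have "(1 - l) * (\<rho> * L (Suc (Suc k)) + B0 / (1 - l)) \<le> (1 - l) * L (Suc k)"
        using N[OF k(1)] l1 by (intro mult_left_mono) auto
      moreover have "(1 - l) * (\<rho> * L (Suc (Suc k)) + B0 / (1 - l)) = (2 * l - 1) * L (Suc (Suc k)) + B0"
      proof -
        have c: "x * (y / x) = y" if "x > 0" for x y :: real using that by simp
        have "(1 - l) * \<rho> = 2 * l - 1" "(1 - l) * (B0 / (1 - l)) = B0"
          unfolding \<rho>_def using l1 by (intro c; simp)+
        thus ?thesis by (simp only: distrib_left mult.assoc[symmetric])
      qed
      moreover have "(1 - l) * (L (Suc (Suc k)) + L (Suc k)) \<le> (1 - l) * ln q"
        using lnq l1 by (intro mult_left_mono) auto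
      ultimately have "ln C - ln q \<le> - l * (ln (2 * C) + L (Suc (Suc k)) + ln q)"
        unfolding B0_def by (simp add: algebra_simps)
      thus "ln (C / q) \<le> - l * ln (2 * C * Q (Suc (Suc k)) * q)"
        using C_pos Qp q0 by (simp add: ln_div ln_mult L_def)
    qed (use C_pos Qp q0 in auto)
    also have "\<dots> \<le> X powr (- l)" using q(2) X0 l0 by (intro powr_mono2') auto
    finally have "C / q \<le> X powr (- l)" .
    hence "\<bar>m00 Y * \<xi> - m01 Y\<bar> \<le> X powr (- l)" "\<bar>m00 Y * \<xi>\<^sup>2 - m11 Y\<bar> \<le> X powr (- l)"
      using Y(3,4) by linarith+
    thus ?case using Y(1,2) unfolding Max_1_2_le_iff by (intro exI[of _ "point Y"]) simp
  qed
  thus "l \<in> {l. \<forall>\<^sub>F X :: real in at_top. \<exists>x :: nat \<Rightarrow> int.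
       0 < \<bar>x 0\<bar> \<and> of_int \<bar>x 0\<bar> \<le> X \<and>
       (MAX m\<in>{1..2}. \<bar>of_int (x 0) * \<xi> ^ m - of_int (x m)\<bar>) \<le> X powr (- l)}" by blast
qed

end

theorem theorem3p1:
  fixes a b :: nat and s :: "nat \<Rightarrow> nat"
  assumes "a > 0" and "b > 0" and "a \<noteq> b"
    and "\<And>k. k \<ge> 1 \<Longrightarrow> s k \<ge> 1"
  shows "exp_lambda 2 (sturm_xi a b s) = 1 \<and>
    exp_w 2 (sturm_xi a b s) = 1 + 2 / sturm_sigma s \<and>
    exp_w_star 2 (sturm_xi a b s) = 1 + 2 / sturm_sigma s \<and>
    exp_lambda_hat 2 (sturm_xi a b s) = (1 + sturm_sigma s) / (2 + sturm_sigma s) \<and>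
    exp_w_hat 2 (sturm_xi a b s) = 2 + sturm_sigma s \<and>
    exp_w_hat_star 2 (sturm_xi a b s) = 2 + sturm_sigma s"
proof -
  interpret sturm a b s by standard (use assms in auto)
  show ?thesis
    by (intro conjI antisym exp_lambda_le exp_lambda_ge exp_w_le exp_w_ge exp_w_star_le
        exp_w_star_ge exp_lambda_hat_le exp_lambda_hat_ge exp_w_hat_le exp_w_hat_ge
        exp_w_hat_star_le exp_w_hat_star_ge)
qed

end
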